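(* Let $X=(X_t)_{t\ge 0}$ be a real-valued Lévy process with characteristic exponent $\Psi$, i.e. $E[e^{i\xi X_t}]=e^{-t\Psi(\xi)}$ for $\xi\in\mathbf{R}$, $t\ge 0$, with $L^2$-generator $\mathsf{L}$ and transition densities $p(t,x,y)$, and assume that $$\Upsilon(\beta):=\frac1{2\pi}\int_{\mathbf{R}}\frac{d\xi}{\beta+2\,\mathrm{Re}\,\Psi(\xi)}<\infty\qquad\text{for all }\beta>0.$$ Let $u_0:\mathbf{R}\to\mathbf{R}_+$ be non-random, bounded and measurable, let $\lambda\in\mathbf{R}$, let $\nu$ be a Lévy measure on $\mathbf{R}$, and let $\tilde N$ be the compensated Poisson random measure associated with a Poisson random measure on $\mathbf{R}_+\times\mathbf{R}\times\mathbf{R}$ with intensity $dt\,dx\,\nu(dh)$. Let $\sigma:\mathbf{R}\times\mathbf{R}\to\mathbf{R}$ be measurable and suppose there exist a positive function $J:\mathbf{R}\to(0,\infty)$ and finite positive constants $\mathrm{Lip}_\sigma$ and $K$ such that for all $x,y,h\in\mathbf{R}$ $$|\sigma(0,h)|\le J(h),\qquad |\sigma(x,h)-\sigma(y,h)|\le J(h)\,\mathrm{Lip}_\sigma|x-y|,\qquad \int_{\mathbf{R}}J(h)^2\,\nu(dh)\le K.$$ Let $u=\{u(t,x)\}_{t>0,x\in\mathbf{R}}$ be the unique random field solution of $$\Big[\frac{\partial u}{\partial t}(t,x)-\mathsf{L}u(t,x)\Big]dx\,dt=\lambda\int_{\mathbf{R}}\sigma(u(t,x),h)\,\tilde N(dh,dx,dt),\qquad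 u(0,x)=u_0(x).$$ Then for each $x\in\mathbf{R}$, $u$ is mean-square continuous in time: for every $t_2>0$, $$\lim_{t_1\uparrow t_2}E|u(t_2,x)-u(t_1,x)|^2=0,$$ and the function $t\mapsto E[|u(t,x)|^2]$ is continuous on $(0,\infty)$.
   Context: The kernel $p(t,x,y)$ is the transition density of $X$: $E^x[f(X_t)]=\int_{\mathbf{R}}p(t,x,y)f(y)\,dy$ for measurable $f:\mathbf{R}\to\mathbf{R}_+$. A Lévy measure $\nu$ on $\mathbf{R}$ satisfies $\int_{\mathbf{R}}(1\wedge h^2)\,\nu(dh)<\infty$. If $N$ is the Poisson random measure with intensity $dt\,dx\,\nu(dh)$, then $\tilde N((0,t],A\times B)=N((0,t],A\times B)-t|A|\nu(B)$ whenever $|A|\nu(B)<\infty$. $\{\mathcal F_t\}$ is the filtration generated by $N$, augmented by null sets. Stochastic integrals with respect to $\tilde N$ are defined for $\{\mathcal F_t\}$-predictable integrands $f(s,x,h)$ with $\int_0^t\int\int E|f(s,x,h)|^2\,ds\,dx\,\nu(dh)<\infty$. A (predictable) process $u$ is a mild solution of the equation if, almost surely, $$u(t,x)=\int_{\mathbf{R}}p(t,x,y)u_0(y)\,dy+\lambda\int_0^t\int_{\mathbf{R}}\int_{\mathbf{R}}p(t-s,x,y)\,\sigma(u(s,y),h)\,\tilde N(dh,dy,ds).$$ It is a random field solution if in addition $\sup_{0\le t\le T}\sup_{x\in\mathbf{R}}E|u(t,x)|^2<\infty$ for all $T>0$. Uniqueness is up to modification. *)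

theory Defs
  imports "HOL-Probability.Probability"
begin

section \<open>Levy processes\<close>

definition levy_process :: "'b measure \<Rightarrow> (real \<Rightarrow> 'b \<Rightarrow> real) \<Rightarrow> bool" where
  "levy_process P X \<longleftrightarrow>
     prob_space P \<and>
     (\<forall>t\<ge>0. X t \<in> borel_measurable P) \<and>
     (AE \<omega> in P. X 0 \<omega> = 0) \<and>
     (\<forall>(n::nat) t. 0 \<le> t 0 \<longrightarrow> (\<forall>i<n. t i < t (Suc i)) \<longrightarrow>
        prob_space.indep_vars P (\<lambda>_. borel) (\<lambda>i \<omega>. X (t (Suc i)) \<omega> - X (t i) \<omega>) {..<n}) \<and>
     (\<forall>s\<ge>0. \<forall>t\<ge>0. distr P borel (\<lambda>\<omega>. X (s + t) \<omega> - X s \<omega>) = distr P borel (X t)) \<and>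
     (\<forall>s\<ge>0. \<forall>\<epsilon>>0.
        ((\<lambda>t. measure P {\<omega>\<in>space P. \<bar>X t \<omega> - X s \<omega>\<bar> > \<epsilon>}) \<longlongrightarrow> 0) (at s within {0..}))"

definition characteristic_exponent ::
  "'b measure \<Rightarrow> (real \<Rightarrow> 'b \<Rightarrow> real) \<Rightarrow> (real \<Rightarrow> complex) \<Rightarrow> bool" where
  "characteristic_exponent P X \<Psi> \<longleftrightarrow>
     (\<forall>t\<ge>0. \<forall>\<xi>. char (distr P borel (X t)) \<xi> = exp (- (complex_of_real t * \<Psi> \<xi>)))"

text \<open>Under the law \<open>P\<^sup>x\<close> the process starts at \<open>x\<close>, so \<open>E\<^sup>x[f(X\<^sub>t)] = E[f(x + X\<^sub>t)]\<close>.
  Nothing is asked of \<open>p t\<close> for \<open>t \<le> 0\<close>.\<close>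

definition transition_density ::
  "'b measure \<Rightarrow> (real \<Rightarrow> 'b \<Rightarrow> real) \<Rightarrow> (real \<Rightarrow> real \<Rightarrow> real \<Rightarrow> real) \<Rightarrow> bool" where
  "transition_density P X p \<longleftrightarrow>
     (\<forall>t>0. \<forall>x. (\<forall>y. 0 \<le> p t x y) \<and>
        distributed P lborel (\<lambda>\<omega>. x + X t \<omega>) (\<lambda>y. ennreal (p t x y)))"

definition Upsilon :: "(real \<Rightarrow> complex) \<Rightarrow> real \<Rightarrow> ennreal" where
  "Upsilon \<Psi> \<beta> = ennreal (1 / (2 * pi)) * (\<integral>\<^sup>+\<xi>. ennreal (1 / (\<beta> + 2 * Re (\<Psi> \<xi>))) \<partial>lborel)"


section \<open>Poisson random measures\<close>

text \<open>An atom of a Levy measure at \<open>0\<close> is not excluded; statements about all measures satisfying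
  the integrability condition cover the convention \<open>\<nu>{0} = 0\<close>.\<close>

definition levy_measure :: "real measure \<Rightarrow> bool" where
  "levy_measure \<nu> \<longleftrightarrow> sets \<nu> = sets borel \<and> (\<integral>\<^sup>+h. ennreal (min 1 (h\<^sup>2)) \<partial>\<nu>) < \<infinity>"

definition poisson_random_measure ::
  "'a measure \<Rightarrow> 'e measure \<Rightarrow> ('a \<Rightarrow> 'e measure) \<Rightarrow> bool" where
  "poisson_random_measure M \<mu> N \<longleftrightarrow>
     prob_space M \<and>
     (\<forall>\<omega>\<in>space M. sets (N \<omega>) = sets \<mu>) \<and>
     (\<forall>C\<in>sets \<mu>. (\<lambda>\<omega>. emeasure (N \<omega>) C) \<in> borel_measurable M) \<and>
     (\<forall>C\<in>sets \<mu>. emeasure \<mu> C < \<infinity> \<longrightarrow>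
        (\<forall>k::nat. measure M {\<omega>\<in>space M. emeasure (N \<omega>) C = of_nat k} =
           measure \<mu> C ^ k / fact k * exp (- measure \<mu> C))) \<and>
     (\<forall>C\<in>sets \<mu>. emeasure \<mu> C = \<infinity> \<longrightarrow> (AE \<omega> in M. emeasure (N \<omega>) C = \<infinity>)) \<and>
     (\<forall>(n::nat) C. disjoint_family_on C {..<n} \<longrightarrow> (\<forall>i<n. C i \<in> sets \<mu>) \<longrightarrow>
        prob_space.indep_vars M (\<lambda>_. borel) (\<lambda>i \<omega>. emeasure (N \<omega>) (C i)) {..<n})"

text \<open>The intensity \<open>dt dx \<nu>(dh)\<close> on \<open>[0,\<infinity>) \<times> \<real> \<times> \<real>\<close>; points are triples \<open>(t, x, h)\<close>.\<close>

definition noise_intensity :: "real measure \<Rightarrow> (real \<times> real \<times> real) measure" where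
  "noise_intensity \<nu> = restrict_space lborel {0..} \<Otimes>\<^sub>M (lborel \<Otimes>\<^sub>M \<nu>)"

text \<open>Only meaningful for sets \<open>C\<close> of finite intensity.\<close>

definition compensated ::
  "real measure \<Rightarrow> ('a \<Rightarrow> (real \<times> real \<times> real) measure) \<Rightarrow> (real \<times> real \<times> real) set \<Rightarrow> 'a \<Rightarrow> real" where
  "compensated \<nu> N C \<omega> = measure (N \<omega>) C - measure (noise_intensity \<nu>) C"

definition noise_filtration ::
  "'a measure \<Rightarrow> ('a \<Rightarrow> (real \<times> real \<times> real) measure) \<Rightarrow> real \<Rightarrow> 'a measure" where
  "noise_filtration M N t = sigma (space M)
     ({(\<lambda>\<omega>. emeasure (N \<omega>) C) -` D \<inter> space M | C D.
        C \<in> sets borel \<and> C \<subseteq> {0..t} \<times> UNIV \<and> D \<in> sets borel} \<union> null_sets M)"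

text \<open>The predictable sigma-algebra on \<open>\<Omega> \<times> (0,\<infinity>)\<close>; time \<open>0\<close> is left out.\<close>

definition predictable_sigma ::
  "'a measure \<Rightarrow> ('a \<Rightarrow> (real \<times> real \<times> real) measure) \<Rightarrow> ('a \<times> real) measure" where
  "predictable_sigma M N = sigma (space M \<times> {0<..})
     {G \<times> {a<..b} | G a b. 0 \<le> a \<and> a < b \<and> G \<in> sets (noise_filtration M N a)}"

definition predictable_process ::
  "'a measure \<Rightarrow> ('a \<Rightarrow> (real \<times> real \<times> real) measure) \<Rightarrow> (real \<Rightarrow> real \<Rightarrow> 'a \<Rightarrow> real) \<Rightarrow> bool" where
  "predictable_process M N u \<longleftrightarrow>
     (\<lambda>((\<omega>, t), x). u t x \<omega>) \<in> borel_measurable (predictable_sigma M N \<Otimes>\<^sub>M borel)"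

definition predictable_integrand ::
  "'a measure \<Rightarrow> ('a \<Rightarrow> (real \<times> real \<times> real) measure) \<Rightarrow> ('a \<Rightarrow> real \<times> real \<times> real \<Rightarrow> real) \<Rightarrow> bool" where
  "predictable_integrand M N f \<longleftrightarrow>
     (\<lambda>((\<omega>, s), y, h). f \<omega> (s, y, h)) \<in>
       borel_measurable (predictable_sigma M N \<Otimes>\<^sub>M (borel \<Otimes>\<^sub>M borel))"


section \<open>The stochastic integral with respect to the compensated measure\<close>

text \<open>\<open>simple_stoch_integral M \<nu> N f I\<close>: the integrand \<open>f\<close> is a finite sum of terms
  \<open>Y(\<omega>) 1\<^bsub>(a,b]\<^esub>(s) 1\<^bsub>A\<^esub>(y) 1\<^bsub>B\<^esub>(h)\<close> with \<open>Y\<close> bounded and measurable at time \<open>a\<close>,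
  and \<open>I\<close> is its integral.\<close>

inductive simple_stoch_integral ::
  "'a measure \<Rightarrow> real measure \<Rightarrow> ('a \<Rightarrow> (real \<times> real \<times> real) measure) \<Rightarrow>
   ('a \<Rightarrow> real \<times> real \<times> real \<Rightarrow> real) \<Rightarrow> ('a \<Rightarrow> real) \<Rightarrow> bool"
  for M \<nu> N where
  zero: "simple_stoch_integral M \<nu> N (\<lambda>_ _. 0) (\<lambda>_. 0)"
| add: "\<lbrakk> simple_stoch_integral M \<nu> N f I; 0 \<le> a; a < b;
          A \<in> sets borel; B \<in> sets borel; emeasure lborel A * emeasure \<nu> B < \<infinity>;
          Y \<in> borel_measurable (noise_filtration M N a); \<forall>\<omega>\<in>space M. \<bar>Y \<omega>\<bar> \<le> c \<rbrakk> \<Longrightarrow>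
        simple_stoch_integral M \<nu> N
          (\<lambda>\<omega> z. f \<omega> z + Y \<omega> * indicator ({a<..b} \<times> A \<times> B) z)
          (\<lambda>\<omega>. I \<omega> + Y \<omega> * compensated \<nu> N ({a<..b} \<times> A \<times> B) \<omega>)"

definition integrand_sqnorm ::
  "'a measure \<Rightarrow> real measure \<Rightarrow> ('a \<Rightarrow> real \<times> real \<times> real \<Rightarrow> real) \<Rightarrow> ennreal" where
  "integrand_sqnorm M \<nu> f =
     (\<integral>\<^sup>+z. (\<integral>\<^sup>+\<omega>. ennreal (\<bar>f \<omega> z\<bar>\<^sup>2) \<partial>M) \<partial>noise_intensity \<nu>)"

text \<open>The isometric extension from simple integrands. The integral is over all of
  \<open>(0,\<infinity>) \<times> \<real> \<times> \<real>\<close>; it is determined up to a null set.\<close>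

definition has_stoch_integral ::
  "'a measure \<Rightarrow> real measure \<Rightarrow> ('a \<Rightarrow> (real \<times> real \<times> real) measure) \<Rightarrow>
   ('a \<Rightarrow> real \<times> real \<times> real \<Rightarrow> real) \<Rightarrow> ('a \<Rightarrow> real) \<Rightarrow> bool" where
  "has_stoch_integral M \<nu> N f I \<longleftrightarrow>
     predictable_integrand M N f \<and> integrand_sqnorm M \<nu> f < \<infinity> \<and> I \<in> borel_measurable M \<and>
     (\<exists>g G. (\<forall>n::nat. simple_stoch_integral M \<nu> N (g n) (G n)) \<and>
        (\<lambda>n. integrand_sqnorm M \<nu> (\<lambda>\<omega> z. g n \<omega> z - f \<omega> z)) \<longlonglongrightarrow> 0 \<and>
        (\<lambda>n. \<integral>\<^sup>+\<omega>. ennreal (\<bar>G n \<omega> - I \<omega>\<bar>\<^sup>2) \<partial>M) \<longlonglongrightarrow> 0)"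


section \<open>Mild and random field solutions\<close>

text \<open>The generator of \<open>X\<close> enters the notion of solution only through the transition densities.
  The time interval of the stochastic integral is taken to be \<open>(0,t)\<close> because \<open>p 0\<close> is arbitrary;
  the slice \<open>s = t\<close> has intensity \<open>0\<close>.\<close>

definition mild_solution ::
  "'a measure \<Rightarrow> real measure \<Rightarrow> ('a \<Rightarrow> (real \<times> real \<times> real) measure) \<Rightarrow>
   (real \<Rightarrow> real \<Rightarrow> real \<Rightarrow> real) \<Rightarrow> (real \<Rightarrow> real) \<Rightarrow> real \<Rightarrow> (real \<Rightarrow> real \<Rightarrow> real) \<Rightarrow>
   (real \<Rightarrow> real \<Rightarrow> 'a \<Rightarrow> real) \<Rightarrow> bool" where
  "mild_solution M \<nu> N p u0 lam \<sigma> u \<longleftrightarrow>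
     predictable_process M N u \<and>
     (\<forall>x. AE \<omega> in M. u 0 x \<omega> = u0 x) \<and>
     (\<forall>t>0. \<forall>x. \<exists>I.
        has_stoch_integral M \<nu> N
          (\<lambda>\<omega> (s, y, h). indicator {0<..<t} s * (p (t - s) x y * \<sigma> (u s y \<omega>) h)) I \<and>
        (AE \<omega> in M. u t x \<omega> = (\<integral>y. p t x y * u0 y \<partial>lborel) + lam * I \<omega>))"

definition random_field_solution ::
  "'a measure \<Rightarrow> real measure \<Rightarrow> ('a \<Rightarrow> (real \<times> real \<times> real) measure) \<Rightarrow>
   (real \<Rightarrow> real \<Rightarrow> real \<Rightarrow> real) \<Rightarrow> (real \<Rightarrow> real) \<Rightarrow> real \<Rightarrow> (real \<Rightarrow> real \<Rightarrow> real) \<Rightarrow>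
   (real \<Rightarrow> real \<Rightarrow> 'a \<Rightarrow> real) \<Rightarrow> bool" where
  "random_field_solution M \<nu> N p u0 lam \<sigma> u \<longleftrightarrow>
     mild_solution M \<nu> N p u0 lam \<sigma> u \<and>
     (\<forall>T>0. (SUP t\<in>{0..T}. SUP x. \<integral>\<^sup>+\<omega>. ennreal (\<bar>u t x \<omega>\<bar>\<^sup>2) \<partial>M) < \<infinity>)"

end

theory Submission
  imports Defs
begin

text \<open>Write \<open>u(t\<^sub>2,x) - u(t\<^sub>1,x)\<close> as a deterministic increment plus \<open>\<lambda>\<close> times an increment of
  stochastic integrals. By the isometry, Plancherel's theorem in space and
  \<open>\<integral>\<^sub>0\<^sup>T e\<^bsup>-2s Re \<Psi>\<^esup> ds \<le> e\<^sup>T / (1 + 2 Re \<Psi>)\<close>, the second moment of the stochastic part is at most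
  a constant times
  \<open>\<integral> (\<bar>e\<^bsup>-\<delta>\<Psi>\<^esup> - 1\<bar>\<^sup>2 + 1 \<and> \<delta>(1 + 2 Re \<Psi>)) / (1 + 2 Re \<Psi>) d\<xi>\<close> with \<open>\<delta> = t\<^sub>2 - t\<^sub>1\<close>, which tends to \<open>0\<close>
  by dominated convergence since \<open>\<Upsilon>(1) < \<infinity>\<close>. The same condition makes the characteristic functions
  integrable, so the densities converge pointwise in time by Fourier inversion and the
  deterministic part is continuous by Scheffe's lemma.\<close>

section \<open>Centred Poisson variables\<close>

text \<open>\<open>has_stoch_integral\<close> is defined by approximation, so the isometry has to be
  extracted from the Poisson counts themselves. The random measure offers independence over finite
  disjoint families, while the coefficients of simple integrands are measurable in
  \<open>F a\<close>, which contains the counts of overlapping past sets and all null sets; bridging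
  this gap is the probabilistic core. The limit only needs an inequality, so the isometry is proved
  for simple integrands and passes to general ones with a constant \<open>9\<close> in place of
  \<open>1\<close>.

  The kernel \<open>p\<close> is fixed by its law only up to a null set in space, separately for
  each time, and is only known to be measurable in space. It therefore never takes part in an
  interchange of time and frequency integration: at each fixed time it is replaced by its Plancherel
  integral, whose integrand is explicit in time. The growth of \<open>\<sigma>\<close> is absorbed
  by the uniform second moment of \<open>u\<close> on bounded time sets, so the stochastic increment
  reduces to a deterministic integral over frequencies that depends on the two times only through
  their distance.\<close>

lemma sums_poisson_moments:
  fixes m :: real
  shows "(\<lambda>k. m ^ k / fact k * exp (- m)) sums 1"
    and "(\<lambda>k. real k * (m ^ k / fact k * exp (- m))) sums m"
    and "(\<lambda>k. (real k)\<^sup>2 * (m ^ k / fact k * exp (- m))) sums (m\<^sup>2 + m)"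
proof -
  have e: "(\<lambda>k. m ^ k / fact k) sums exp m"
    using exp_converges[of m] by (simp add: field_simps scaleR_conv_of_real)
  show s0: "(\<lambda>k. m ^ k / fact k * exp (- m)) sums 1"
    using sums_mult2[OF e, of "exp (- m)"] by (simp add: exp_minus field_simps)
  \<comment> \<open>The factor \<open>Suc k\<close> cancels against the factorial and leaves
    \<open>m\<close> times the previous series; the term with index 0 vanishes, so
    \<open>sums_Suc_iff\<close> shifts the index at no cost.\<close>
  have "(\<lambda>k. real (Suc k) * (m ^ Suc k / fact (Suc k) * exp (- m))) sums m"
    using sums_mult[OF s0, of m] by (simp add: field_simps del: of_nat_Suc)
  from this[THEN sums_Suc_iff[THEN iffD1]]
  show s1: "(\<lambda>k. real k * (m ^ k / fact k * exp (- m))) sums m"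
    by simp
  have "(\<lambda>k. m * (real (Suc k) * (m ^ k / fact k * exp (- m)))) sums (m * (m + 1))"
    using sums_mult[OF sums_add[OF s1 s0], of m] by (simp add: algebra_simps add_divide_distrib)
  also have "(\<lambda>k. m * (real (Suc k) * (m ^ k / fact k * exp (- m)))) =
      (\<lambda>k. (real (Suc k))\<^sup>2 * (m ^ Suc k / fact (Suc k) * exp (- m)))"
    by (auto simp: fun_eq_iff divide_simps power2_eq_square simp del: of_nat_Suc)
  finally have "(\<lambda>k. (real (Suc k))\<^sup>2 * (m ^ Suc k / fact (Suc k) * exp (- m))) sums (m * (m + 1))" .
  from this[THEN sums_Suc_iff[THEN iffD1]]
  show "(\<lambda>k. (real k)\<^sup>2 * (m ^ k / fact k * exp (- m))) sums (m\<^sup>2 + m)"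
    by (simp add: algebra_simps power2_eq_square)
qed

text \<open>The prescribed point masses already sum to \<open>1\<close>, so \<open>Z\<close>, which
  may a priori be infinite, is almost surely a natural number. Expectations of functions of
  \<open>Z\<close> then split over the disjoint events \<open>Z = k\<close> and become
  series.\<close>

lemma (in prob_space)
  fixes Z :: "'a \<Rightarrow> ennreal"
  assumes Z [measurable]: "Z \<in> borel_measurable M" and m: "0 \<le> m"
    and poisson: "\<And>k::nat. prob {\<omega>\<in>space M. Z \<omega> = of_nat k} = m ^ k / fact k * exp (- m)"
  shows poisson_AE_nat: "AE \<omega> in M. \<exists>k. Z \<omega> = of_nat k"
    and nn_integral_poisson: "\<And>g :: real \<Rightarrow> real. (\<And>x. 0 \<le> g x) \<Longrightarrow> g \<in> borel_measurable borel \<Longrightarrow>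
      (\<lambda>k. g (real k) * (m ^ k / fact k * exp (- m))) sums s \<Longrightarrow>
      (\<integral>\<^sup>+\<omega>. ennreal (g (enn2real (Z \<omega>))) \<partial>M) = ennreal s"
proof -
  let ?p = "\<lambda>k. m ^ k / fact k * exp (- m)"
  let ?A = "\<lambda>k. {\<omega>\<in>space M. Z \<omega> = of_nat k}"
  have disj: "disjoint_family ?A"
    by (auto simp: disjoint_family_on_def)
  have "(\<lambda>k. prob (?A k)) sums prob (\<Union>k. ?A k)"
    by (intro finite_measure_UNION disj) auto
  then have "(\<lambda>k. ?p k) sums prob (\<Union>k. ?A k)"
    by (simp add: poisson)
  with sums_poisson_moments(1)[of m] have "prob (\<Union>k. ?A k) = 1"
    using sums_unique2 by blast
  then have "AE \<omega> in M. \<omega> \<in> (\<Union>k. ?A k)"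
    by (subst prob_eq_1[symmetric]) auto
  then show ae: "AE \<omega> in M. \<exists>k. Z \<omega> = of_nat k"
    by auto
  fix g :: "real \<Rightarrow> real" assume g: "\<And>x. 0 \<le> g x" and [measurable]: "g \<in> borel_measurable borel"
    and s: "(\<lambda>k. g (real k) * ?p k) sums s"
  have "(\<integral>\<^sup>+\<omega>. ennreal (g (enn2real (Z \<omega>))) \<partial>M)
      = (\<integral>\<^sup>+\<omega>. (\<Sum>k. ennreal (g (real k)) * indicator (?A k) \<omega>) \<partial>M)"
    using ae
  proof (intro nn_integral_cong_AE, elim AE_mp, intro AE_I2 impI)
    fix \<omega> assume "\<exists>k. Z \<omega> = of_nat k" "\<omega> \<in> space M"
    then obtain k where k: "Z \<omega> = of_nat k" by auto
    have "(\<Sum>j. ennreal (g (real j)) * indicator (?A j) \<omega>)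
        = (\<Sum>j\<in>{k}. ennreal (g (real j)) * indicator (?A j) \<omega>)"
      using k by (intro suminf_finite) (auto simp: indicator_def)
    then show "ennreal (g (enn2real (Z \<omega>))) = (\<Sum>j. ennreal (g (real j)) * indicator (?A j) \<omega>)"
      using k \<open>\<omega> \<in> space M\<close> by (simp add: indicator_def ennreal_of_nat_eq_real_of_nat)
  qed
  also have "\<dots> = (\<Sum>k. ennreal (g (real k)) * emeasure M (?A k))"
    by (subst nn_integral_suminf) (auto simp: nn_integral_cmult_indicator)
  also have "\<dots> = (\<Sum>k. ennreal (g (real k) * ?p k))"
    by (simp add: emeasure_eq_measure poisson g flip: ennreal_mult')
  also have "\<dots> = ennreal s"
    using s by (intro suminf_ennreal_eq) (auto simp: g m)
  finally show "(\<integral>\<^sup>+\<omega>. ennreal (g (enn2real (Z \<omega>))) \<partial>M) = ennreal s" .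
qed

lemma (in prob_space)
  fixes Z :: "'a \<Rightarrow> ennreal"
  assumes Z [measurable]: "Z \<in> borel_measurable M" and m: "0 \<le> m"
    and poisson: "\<And>k::nat. prob {\<omega>\<in>space M. Z \<omega> = of_nat k} = m ^ k / fact k * exp (- m)"
  shows integrable_centred_poisson: "integrable M (\<lambda>\<omega>. enn2real (Z \<omega>) - m)"
    and integral_centred_poisson: "(\<integral>\<omega>. enn2real (Z \<omega>) - m \<partial>M) = 0"
    and integrable_centred_poisson_sq: "integrable M (\<lambda>\<omega>. (enn2real (Z \<omega>) - m)\<^sup>2)"
    and integral_centred_poisson_sq: "(\<integral>\<omega>. (enn2real (Z \<omega>) - m)\<^sup>2 \<partial>M) = m"
proof -
  \<comment> \<open>\<open>nn_integral_poisson\<close> asks for a function that is nonnegative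
    everywhere; \<open>max 0 x\<close> agrees with the identity on the values of
    \<open>enn2real\<close>.\<close>
  have 1: "(\<integral>\<^sup>+\<omega>. ennreal (enn2real (Z \<omega>)) \<partial>M) = ennreal m"
    using nn_integral_poisson[OF Z m poisson, of "\<lambda>x. max 0 x" m] sums_poisson_moments(2)[of m]
    by simp
  have 2: "(\<integral>\<^sup>+\<omega>. ennreal ((enn2real (Z \<omega>))\<^sup>2) \<partial>M) = ennreal (m\<^sup>2 + m)"
    using nn_integral_poisson[OF Z m poisson, of "\<lambda>x. x\<^sup>2" "m\<^sup>2 + m"] sums_poisson_moments(3)[of m]
    by simp
  have i1 [simp]: "has_bochner_integral M (\<lambda>\<omega>. enn2real (Z \<omega>)) m"
    using 1 m by (intro has_bochner_integral_nn_integral) auto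
  have i2: "has_bochner_integral M (\<lambda>\<omega>. (enn2real (Z \<omega>))\<^sup>2) (m\<^sup>2 + m)"
    using 2 m by (intro has_bochner_integral_nn_integral) auto
  have c: "has_bochner_integral M (\<lambda>_. c) c" for c :: real
    by (simp add: has_bochner_integral_iff prob_space)
  have h1: "has_bochner_integral M (\<lambda>\<omega>. enn2real (Z \<omega>) - m) (m - m)"
    by (intro has_bochner_integral_diff i1 c)
  then show "integrable M (\<lambda>\<omega>. enn2real (Z \<omega>) - m)" "(\<integral>\<omega>. enn2real (Z \<omega>) - m \<partial>M) = 0"
    by (auto simp: has_bochner_integral_iff)
  have "has_bochner_integral M (\<lambda>\<omega>. (enn2real (Z \<omega>))\<^sup>2 - 2 * m * enn2real (Z \<omega>) + m\<^sup>2)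
     ((m\<^sup>2 + m) - 2 * m * m + m\<^sup>2)"
    by (intro has_bochner_integral_add has_bochner_integral_diff i2 c has_bochner_integral_mult_right i1)
  then have "has_bochner_integral M (\<lambda>\<omega>. (enn2real (Z \<omega>) - m)\<^sup>2) m"
    by (simp add: power2_eq_square algebra_simps)
  then show "integrable M (\<lambda>\<omega>. (enn2real (Z \<omega>) - m)\<^sup>2)"
     "(\<integral>\<omega>. (enn2real (Z \<omega>) - m)\<^sup>2 \<partial>M) = m"
    by (auto simp: has_bochner_integral_iff)
qed

lemma has_bochner_integral_cong_AE':
  assumes "AE x in M. f x = g x" "f \<in> borel_measurable M" "g \<in> borel_measurable M" "a = b"
  shows "has_bochner_integral M f a \<longleftrightarrow> has_bochner_integral M g b"
  using has_bochner_integral_cong_AE[OF assms(2,3,1)] assms(4) by simp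

section \<open>The compensated Poisson noise\<close>

text \<open>Sigma-finiteness of \<open>\<nu>\<close> makes the intensity a genuine product measure,
  with product mass on rectangles and Fubini's theorem available. In the theorem it is supplied by
  the positive function \<open>J\<close> with integrable square.\<close>

locale poisson_noise = prob_space M + nu: sigma_finite_measure \<nu>
  for M :: "'a measure" and \<nu> :: "real measure" +
  fixes N :: "'a \<Rightarrow> (real \<times> real \<times> real) measure"
  assumes sets_nu [measurable_cong]: "sets \<nu> = sets borel"
    and prm: "poisson_random_measure M (noise_intensity \<nu>) N"
begin

abbreviation "\<mu> \<equiv> noise_intensity \<nu>"

lemma space_nu [simp]: "space \<nu> = UNIV"
  using sets_nu by (metis sets_eq_imp_space_eq space_borel)

lemma space_intensity: "space \<mu> = {0..} \<times> UNIV"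
  by (simp add: noise_intensity_def space_pair_measure space_restrict_space)

text \<open>A bridge between two sigma-algebras: the intensity lives on an iterated product
  restricted to nonnegative times, while the filtration and the boxes speak of Borel sets of
  triples.\<close>

lemma measurable_ident_intensity: "(\<lambda>z. z) \<in> measurable \<mu> borel"
proof -
  have [measurable]: "fst \<in> borel_measurable \<mu>"
    unfolding noise_intensity_def
    by (rule measurable_compose[OF measurable_fst]) (auto intro!: measurable_restrict_space1)
  have [measurable]: "(\<lambda>z. fst (snd z)) \<in> borel_measurable \<mu>"
       "(\<lambda>z. snd (snd z)) \<in> borel_measurable \<mu>"
    unfolding noise_intensity_def by measurable
  have "(\<lambda>z. (fst z, fst (snd z), snd (snd z))) \<in> measurable \<mu> (borel \<Otimes>\<^sub>M (borel \<Otimes>\<^sub>M borel))"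
    by measurable
  then show ?thesis
    by (simp add: borel_prod)
qed

lemma sets_intensityI: "C \<in> sets borel \<Longrightarrow> C \<subseteq> {0..} \<times> UNIV \<Longrightarrow> C \<in> sets \<mu>"
  using measurable_sets[OF measurable_ident_intensity, of C]
  unfolding space_intensity vimage_ident by (metis Int_absorb2)

lemma sets_N:
  assumes "\<omega> \<in> space M"
  shows "sets (N \<omega>) = sets \<mu>"
proof -
  have "\<forall>\<omega>\<in>space M. sets (N \<omega>) = sets \<mu>"
    using prm unfolding poisson_random_measure_def by (elim conjE)
  then show ?thesis using assms by (rule bspec)
qed

lemma measurable_N:
  assumes "C \<in> sets \<mu>"
  shows "(\<lambda>\<omega>. emeasure (N \<omega>) C) \<in> borel_measurable M"
proof -
  have "\<forall>C\<in>sets \<mu>. (\<lambda>\<omega>. emeasure (N \<omega>) C) \<in> borel_measurable M"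
    using prm unfolding poisson_random_measure_def by (elim conjE)
  then show ?thesis using assms by (rule bspec)
qed

lemma poisson_N:
  assumes "C \<in> sets \<mu>" "emeasure \<mu> C < \<infinity>"
  shows "prob {\<omega>\<in>space M. emeasure (N \<omega>) C = of_nat k} =
           measure \<mu> C ^ k / fact k * exp (- measure \<mu> C)"
proof -
  have "\<forall>C\<in>sets \<mu>. emeasure \<mu> C < \<infinity> \<longrightarrow>
      (\<forall>k::nat. prob {\<omega>\<in>space M. emeasure (N \<omega>) C = of_nat k} =
           measure \<mu> C ^ k / fact k * exp (- measure \<mu> C))"
    using prm unfolding poisson_random_measure_def by (elim conjE)
  from this[THEN bspec, OF assms(1), THEN mp, OF assms(2)] show ?thesis
    by (rule spec)
qed

lemma indep_N:
  fixes n :: nat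
  assumes "disjoint_family_on D {..<n}" "\<And>i. i < n \<Longrightarrow> D i \<in> sets \<mu>"
  shows "indep_vars (\<lambda>_. borel) (\<lambda>i \<omega>. emeasure (N \<omega>) (D i)) {..<n}"
proof -
  have "\<forall>(n::nat) C. disjoint_family_on C {..<n} \<longrightarrow> (\<forall>i<n. C i \<in> sets \<mu>) \<longrightarrow>
        indep_vars (\<lambda>_. borel) (\<lambda>i \<omega>. emeasure (N \<omega>) (C i)) {..<n}"
    using prm unfolding poisson_random_measure_def by (elim conjE)
  then show ?thesis using assms by blast
qed

text \<open>The sets whose compensated count is meaningful; on a set of infinite intensity
  \<open>measure\<close> would return its default value \<open>0\<close>.\<close>

definition finite_intensity :: "(real \<times> real \<times> real) set \<Rightarrow> bool" where
  "finite_intensity C \<longleftrightarrow> C \<in> sets \<mu> \<and> emeasure \<mu> C < \<infinity>"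

lemma finite_intensity_subset: "finite_intensity C \<Longrightarrow> D \<in> sets \<mu> \<Longrightarrow> D \<subseteq> C \<Longrightarrow> finite_intensity D"
  unfolding finite_intensity_def using emeasure_mono[of D C \<mu>] by (auto simp: less_top[symmetric] top_unique)

lemma finite_intensity_Un: "finite_intensity C \<Longrightarrow> finite_intensity D \<Longrightarrow> finite_intensity (C \<union> D)"
  unfolding finite_intensity_def using emeasure_subadditive[of C \<mu> D] by (auto simp: less_top[symmetric] top_unique)

lemma finite_intensity_box:
  assumes "0 \<le> a" "A \<in> sets borel" "B \<in> sets borel" "emeasure lborel A * emeasure \<nu> B < \<infinity>"
  shows "finite_intensity ({a<..b} \<times> A \<times> B)"
proof -
  have 1: "A \<times> B \<in> sets (lborel \<Otimes>\<^sub>M \<nu>)"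
    using assms by (auto simp: sets_nu)
  have 2: "{a<..b} \<in> sets (restrict_space lborel {0..})"
    using assms by (auto simp: sets_restrict_space_iff)
  interpret p: sigma_finite_measure "lborel \<Otimes>\<^sub>M \<nu>"
    by (rule sigma_finite_pair_measure[OF sigma_finite_lborel nu.sigma_finite_measure_axioms])
  have "emeasure \<mu> ({a<..b} \<times> A \<times> B) =
      emeasure (restrict_space lborel {0..}) {a<..b} * emeasure (lborel \<Otimes>\<^sub>M \<nu>) (A \<times> B)"
    unfolding noise_intensity_def by (rule p.emeasure_pair_measure_Times[OF 2 1])
  also have "emeasure (restrict_space lborel {0..}) {a<..b} = emeasure lborel {a<..b}"
    using assms by (intro emeasure_restrict_space) auto
  also have "emeasure (lborel \<Otimes>\<^sub>M \<nu>) (A \<times> B) = emeasure lborel A * emeasure \<nu> B"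
    using assms by (intro nu.emeasure_pair_measure_Times) (auto simp: sets_nu)
  also have "emeasure lborel {a<..b} * \<dots> < \<infinity>"
    using assms(4) by (cases "a \<le> b") (auto simp: ennreal_mult_less_top)
  finally show ?thesis
    unfolding finite_intensity_def using 1 2 by (auto simp: noise_intensity_def)
qed

section \<open>Moments and additivity of compensated counts\<close>

abbreviation "Nt \<equiv> compensated \<nu> N"

lemma
  assumes "finite_intensity C"
  shows measurable_Nt [measurable]: "Nt C \<in> borel_measurable M"
    and integrable_Nt: "integrable M (Nt C)"
    and integral_Nt: "(\<integral>\<omega>. Nt C \<omega> \<partial>M) = 0"
    and integrable_Nt_sq: "integrable M (\<lambda>\<omega>. (Nt C \<omega>)\<^sup>2)"
    and integral_Nt_sq: "(\<integral>\<omega>. (Nt C \<omega>)\<^sup>2 \<partial>M) = measure \<mu> C"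
proof -
  have C: "C \<in> sets \<mu>" "emeasure \<mu> C < \<infinity>" using assms by (auto simp: finite_intensity_def)
  note [measurable] = measurable_N[OF C(1)]
  have eq: "Nt C = (\<lambda>\<omega>. enn2real (emeasure (N \<omega>) C) - measure \<mu> C)"
    by (simp add: fun_eq_iff compensated_def measure_def)
  note * = measurable_N[OF C(1)] measure_nonneg poisson_N[OF C]
  show "Nt C \<in> borel_measurable M"
    unfolding eq by measurable
  show "integrable M (Nt C)" "(\<integral>\<omega>. Nt C \<omega> \<partial>M) = 0"
       "integrable M (\<lambda>\<omega>. (Nt C \<omega>)\<^sup>2)" "(\<integral>\<omega>. (Nt C \<omega>)\<^sup>2 \<partial>M) = measure \<mu> C"
    unfolding eq
    by (rule integrable_centred_poisson[OF *] integral_centred_poisson[OF *]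
        integrable_centred_poisson_sq[OF *] integral_centred_poisson_sq[OF *])+
qed

lemma AE_N_finite:
  assumes "finite_intensity C"
  shows "AE \<omega> in M. emeasure (N \<omega>) C < \<infinity>"
proof -
  have "C \<in> sets \<mu>" "emeasure \<mu> C < \<infinity>"
    using assms by (auto simp: finite_intensity_def)
  from poisson_AE_nat[OF measurable_N[OF this(1)] measure_nonneg poisson_N[OF this]]
  show ?thesis
    by eventually_elim (auto simp: ennreal_of_nat_eq_real_of_nat)
qed

text \<open>Additivity holds only almost surely: on the null event where one of the counts is
  infinite, \<open>measure\<close> replaces it by \<open>0\<close> and the identity can
  fail.\<close>

lemma AE_Nt_Un:
  assumes C: "finite_intensity C" and D: "finite_intensity D" and "C \<inter> D = {}"
  shows "AE \<omega> in M. Nt (C \<union> D) \<omega> = Nt C \<omega> + Nt D \<omega>"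
  using AE_N_finite[OF C] AE_N_finite[OF D] AE_space
proof eventually_elim
  case (elim \<omega>)
  have "measure (N \<omega>) (C \<union> D) = measure (N \<omega>) C + measure (N \<omega>) D"
    using elim C D assms(3) by (intro measure_Union) (auto simp: finite_intensity_def sets_N)
  moreover have "measure \<mu> (C \<union> D) = measure \<mu> C + measure \<mu> D"
    using C D assms(3) by (intro measure_Union) (auto simp: finite_intensity_def)
  ultimately show ?case
    by (simp add: compensated_def)
qed

lemma finite_intensity_in_sets [measurable_dest]: "finite_intensity C \<Longrightarrow> C \<in> sets \<mu>"
  by (simp add: finite_intensity_def)

section \<open>The filtration and the independence of past and future\<close>

abbreviation "F \<equiv> noise_filtration M N"

abbreviation "past t \<equiv> {C. C \<in> sets borel \<and> C \<subseteq> {0..t} \<times> (UNIV :: (real \<times> real) set)}"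

lemma past_sets: "C \<in> past t \<Longrightarrow> C \<in> sets \<mu>"
  by (rule sets_intensityI) auto

abbreviation (input) "gens t \<equiv> {(\<lambda>\<omega>. emeasure (N \<omega>) C) -` D \<inter> space M | C D.
        C \<in> sets borel \<and> C \<subseteq> {0..t} \<times> UNIV \<and> D \<in> sets borel} \<union> null_sets M"

lemma gens_events: "gens t \<subseteq> events"
proof -
  have "(\<lambda>\<omega>. emeasure (N \<omega>) C) -` D \<inter> space M \<in> events"
    if "C \<in> sets borel" "C \<subseteq> {0..t} \<times> UNIV" "D \<in> sets borel" for C D
    using that past_sets[of C t] by (intro measurable_sets[OF measurable_N]) auto
  then show ?thesis by auto
qed

lemma gens_Pow: "gens t \<subseteq> Pow (space M)"
  using gens_events sets.sets_into_space by blast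

lemma space_F [simp]: "space (F t) = space M"
  unfolding noise_filtration_def by (rule space_measure_of[OF gens_Pow])

lemma sets_F: "sets (F t) = sigma_sets (space M) (gens t)"
  unfolding noise_filtration_def by (rule sets_measure_of[OF gens_Pow])

lemma F_subset: "sets (F t) \<subseteq> events"
  unfolding sets_F by (rule sets.sigma_sets_subset[OF gens_events])

lemma F_mono: "s \<le> t \<Longrightarrow> sets (F s) \<subseteq> sets (F t)"
  unfolding sets_F by (intro sigma_sets_mono') fastforce

lemma measurable_F: "f \<in> borel_measurable (F t) \<Longrightarrow> f \<in> borel_measurable M"
  using measurable_mono[of borel borel "F t" M] F_subset by auto

lemma measurable_F_mono: "s \<le> t \<Longrightarrow> f \<in> borel_measurable (F s) \<Longrightarrow> f \<in> borel_measurable (F t)"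
  using measurable_mono[of borel borel "F s" "F t"] F_mono by auto

lemma measurable_N_F:
  assumes "C \<in> past t"
  shows "(\<lambda>\<omega>. emeasure (N \<omega>) C) \<in> borel_measurable (F t)"
proof (rule measurableI)
  fix D :: "ennreal set" assume "D \<in> sets borel"
  then have "(\<lambda>\<omega>. emeasure (N \<omega>) C) -` D \<inter> space M \<in> gens t"
    using assms by blast
  then show "(\<lambda>\<omega>. emeasure (N \<omega>) C) -` D \<inter> space (F t) \<in> sets (F t)"
    unfolding sets_F space_F by (rule sigma_sets.Basic)
qed auto

lemma measurable_Nt_F: "C \<in> past t \<Longrightarrow> Nt C \<in> borel_measurable (F t)"
  using measurable_N_F[of C t] unfolding compensated_def[abs_def] measure_def by simp

text \<open>The generating events of \<open>F t\<close> are not closed under intersection, so a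
  Dynkin argument cannot start from them. Their finite intersections are; a cylinder is such an
  intersection, with one constraint \<open>D C\<close> on the count of each set
  \<open>C\<close>.\<close>

definition cylinder :: "(real \<times> real \<times> real) set set \<Rightarrow> ((real \<times> real \<times> real) set \<Rightarrow> ennreal set) \<Rightarrow> 'a set" where
  "cylinder \<C> D = {\<omega>\<in>space M. \<forall>C\<in>\<C>. emeasure (N \<omega>) C \<in> D C}"

definition cylinders :: "real \<Rightarrow> 'a set set" where
  "cylinders t = {cylinder \<C> D | \<C> D. finite \<C> \<and> \<C> \<subseteq> past t \<and> (\<forall>C\<in>\<C>. D C \<in> sets borel)}"

lemma cylinder_event:
  assumes "finite \<C>" "\<C> \<subseteq> past t" "\<forall>C\<in>\<C>. D C \<in> sets borel"
  shows "cylinder \<C> D \<in> events"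
  unfolding cylinder_def
proof (rule sets.sets_Collect_finite_All[OF _ assms(1)])
  fix C assume C: "C \<in> \<C>"
  then have "C \<in> past t" using assms by auto
  have "(\<lambda>\<omega>. emeasure (N \<omega>) C) -` D C \<inter> space M \<in> events"
    using C assms by (intro measurable_sets[OF measurable_N[OF past_sets[OF \<open>C \<in> past t\<close>]]]) auto
  also have "(\<lambda>\<omega>. emeasure (N \<omega>) C) -` D C \<inter> space M = {\<omega>\<in>space M. emeasure (N \<omega>) C \<in> D C}"
    by auto
  finally show "{\<omega>\<in>space M. emeasure (N \<omega>) C \<in> D C} \<in> events" .
qed

lemma Int_stable_cylinders: "Int_stable (cylinders t \<union> null_sets M)"
proof (rule Int_stableI)
  fix E E' assume E: "E \<in> cylinders t \<union> null_sets M" "E' \<in> cylinders t \<union> null_sets M"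
  have ev: "E \<in> events" "E' \<in> events"
    using E cylinder_event by (auto simp: cylinders_def)
  show "E \<inter> E' \<in> cylinders t \<union> null_sets M"
  proof (cases "E \<in> null_sets M \<or> E' \<in> null_sets M")
    case True
    then show ?thesis
      using ev null_set_Int2[of E M E'] null_set_Int1[of E' M E] by auto
  next
    case False
    then obtain \<C> D \<C>' D' where *: "E = cylinder \<C> D" "finite \<C>" "\<C> \<subseteq> past t" "\<forall>C\<in>\<C>. D C \<in> sets borel"
        "E' = cylinder \<C>' D'" "finite \<C>'" "\<C>' \<subseteq> past t" "\<forall>C\<in>\<C>'. D' C \<in> sets borel"
      using E unfolding cylinders_def by auto
    \<comment> \<open>A set that belongs to only one of the two families is left unconstrained by
      the other, hence \<open>UNIV\<close>; a set in both gets the intersection of its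
      constraints.\<close>
    let ?D = "\<lambda>C. (if C \<in> \<C> then D C else UNIV) \<inter> (if C \<in> \<C>' then D' C else UNIV)"
    have "E \<inter> E' = cylinder (\<C> \<union> \<C>') ?D"
      using * by (auto simp: cylinder_def)
    moreover have "\<forall>C\<in>\<C> \<union> \<C>'. ?D C \<in> sets borel"
      using * by auto
    ultimately have "E \<inter> E' \<in> cylinders t"
      unfolding cylinders_def using * by blast
    then show ?thesis by auto
  qed
qed

lemma sets_F_cylinders: "sets (F t) \<subseteq> sigma_sets (space M) (cylinders t \<union> null_sets M)"
  unfolding sets_F
proof (rule sigma_sets_mono')
  have "(\<lambda>\<omega>. emeasure (N \<omega>) C) -` D \<inter> space M \<in> cylinders t"
    if "C \<in> sets borel" "C \<subseteq> {0..t} \<times> UNIV" "D \<in> sets borel" for C D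
  proof -
    have "(\<lambda>\<omega>. emeasure (N \<omega>) C) -` D \<inter> space M = cylinder {C} (\<lambda>_. D)"
      by (auto simp: cylinder_def)
    then show ?thesis
      unfolding cylinders_def using that
      by (intro CollectI exI[of _ "{C}"] exI[of _ "\<lambda>_. D"]) auto
  qed
  then show "gens t \<subseteq> cylinders t \<union> null_sets M"
    by auto
qed

text \<open>The past sets are cut into atoms, which together with the future set \<open>D\<close> form a finite
  disjoint family; the counts of the past sets are sums of counts of atoms.\<close>

lemma cylinder_indep:
  assumes \<C>: "finite \<C>" "\<C> \<subseteq> past t" and DC: "\<forall>C\<in>\<C>. DC C \<in> sets borel"
    and D: "D \<in> sets \<mu>" "D \<subseteq> {t<..} \<times> UNIV" and B: "B \<in> sets borel"
  shows "prob (cylinder \<C> DC \<inter> ((\<lambda>\<omega>. emeasure (N \<omega>) D) -` B \<inter> space M)) =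
    prob (cylinder \<C> DC) * prob ((\<lambda>\<omega>. emeasure (N \<omega>) D) -` B \<inter> space M)"
proof -
  define n where "n = card (Pow \<C>)"
  obtain h where h: "bij_betw h {..<n} (Pow \<C>)"
    using ex_bij_betw_nat_finite[of "Pow \<C>"] \<C> by (auto simp: n_def atLeast0LessThan)
  \<comment> \<open>\<open>atm S\<close> collects the past points that lie in exactly those members
    of \<open>\<C>\<close> that belong to \<open>S\<close>. With \<open>S\<close> ranging over all
    subsets the atoms are disjoint and exhaust every \<open>C\<close>; some may be empty, which does
    no harm. The future set \<open>D\<close> takes the index \<open>n\<close>.\<close>
  define atm where "atm S = {z\<in>{0..t} \<times> UNIV. \<forall>C\<in>\<C>. z \<in> C \<longleftrightarrow> C \<in> S}" for S
  define E where "E i = (if i < n then atm (h i) else D)" for i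
  have at_borel: "atm S \<in> sets borel" for S
  proof -
    have "atm S = {z\<in>space borel. z \<in> {0..t} \<times> UNIV \<and> (\<forall>C\<in>\<C>. z \<in> C \<longleftrightarrow> C \<in> S)}"
      by (auto simp: atm_def)
    also have "\<dots> \<in> sets borel"
    proof (intro sets.sets_Collect_conj sets.sets_Collect_finite_All \<C>)
      have "({0..t} \<times> UNIV :: (real \<times> real \<times> real) set) \<in> sets borel"
        by (intro borel_closed closed_Times) auto
      then show "{z\<in>space borel. z \<in> {0..t} \<times> (UNIV :: (real \<times> real) set)} \<in> sets borel"
        by simp
      fix C assume "C \<in> \<C>"
      then have "C \<in> sets borel" using \<C> by auto
      then show "{z \<in> space borel. (z \<in> C) = (C \<in> S)} \<in> sets borel"
        by (cases "C \<in> S") (auto simp: Compl_eq[symmetric])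
    qed
    finally show ?thesis .
  qed
  have at_past: "atm S \<in> past t" for S
    using at_borel by (auto simp: atm_def)
  have inj: "inj_on h {..<n}" and img: "h ` {..<n} = Pow \<C>"
    using h by (auto simp: bij_betw_def)
  have hsub: "i < n \<Longrightarrow> h i \<subseteq> \<C>" for i using img by auto
  have disj_at: "atm S \<inter> atm S' = {}" if "S \<subseteq> \<C>" "S' \<subseteq> \<C>" "S \<noteq> S'" for S S'
    using that unfolding atm_def by blast
  have disj: "disjoint_family_on E {..<Suc n}"
    unfolding disjoint_family_on_def
  proof (intro ballI impI)
    fix i j assume ij: "i \<in> {..<Suc n}" "j \<in> {..<Suc n}" "i \<noteq> j"
    have atD: "atm S \<inter> D = {}" for S
      using D unfolding atm_def by fastforce
    show "E i \<inter> E j = {}"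
    proof (cases "i < n"; cases "j < n")
      assume "i < n" "j < n"
      moreover have "h i \<noteq> h j"
        using inj ij calculation by (auto dest: inj_onD)
      ultimately show ?thesis
        using disj_at[OF hsub hsub] by (simp add: E_def)
    qed (use ij atD in \<open>auto simp: E_def\<close>)
  qed
  have Esets: "E i \<in> sets \<mu>" for i
    using past_sets[OF at_past] D by (simp add: E_def)
  have ind: "indep_vars (\<lambda>_. borel) (\<lambda>i \<omega>. emeasure (N \<omega>) (E i)) {..<Suc n}"
    by (rule indep_N[OF disj Esets])
  \<comment> \<open>\<open>V\<close> gathers the counts of the atoms and \<open>W\<close> the count
    of \<open>D\<close>. They use disjoint index sets of one independent family, hence are
    independent as random vectors.\<close>
  define V where "V = (\<lambda>\<omega>. \<lambda>i\<in>{..<n}. emeasure (N \<omega>) (E i))"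
  define W where "W = (\<lambda>\<omega>. \<lambda>i\<in>{n}. emeasure (N \<omega>) (E i))"
  have ivar: "indep_var (PiM {..<n} (\<lambda>_. borel)) V (PiM {n} (\<lambda>_. borel)) W"
    unfolding V_def W_def by (rule indep_var_restrict[OF ind]) auto
  \<comment> \<open>\<open>cnt C\<close> is a fixed measurable function of the vector of atom
    counts, so constraints on overlapping past sets become an event about \<open>V\<close>
    alone.\<close>
  define cnt where "cnt C v = (\<Sum>i<n. if C \<in> h i then v i else 0)" for C and v :: "nat \<Rightarrow> ennreal"
  have N_sum: "emeasure (N \<omega>) C = cnt C (V \<omega>)" if "C \<in> \<C>" "\<omega> \<in> space M" for C \<omega>
  proof -
    have "C = (\<Union>i\<in>{i. i < n \<and> C \<in> h i}. E i)"
    proof (rule set_eqI)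
      fix z
      show "z \<in> C \<longleftrightarrow> z \<in> (\<Union>i\<in>{i. i < n \<and> C \<in> h i}. E i)"
      proof
        assume z: "z \<in> C"
        have "{C'\<in>\<C>. z \<in> C'} \<in> h ` {..<n}"
          using img by auto
        then obtain i where i: "i < n" "h i = {C'\<in>\<C>. z \<in> C'}" by auto
        have "C \<in> past t" using that \<C> by auto
        then have "z \<in> atm (h i)"
          using z i by (auto simp: atm_def)
        then show "z \<in> (\<Union>i\<in>{i. i < n \<and> C \<in> h i}. E i)"
          using i z that by (auto simp: E_def)
      next
        assume "z \<in> (\<Union>i\<in>{i. i < n \<and> C \<in> h i}. E i)"
        then show "z \<in> C"
          using that by (auto simp: E_def atm_def)
      qed
    qed
    then have "emeasure (N \<omega>) C = emeasure (N \<omega>) (\<Union>i\<in>{i. i < n \<and> C \<in> h i}. E i)"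
      by simp
    also have "\<dots> = (\<Sum>i\<in>{i. i < n \<and> C \<in> h i}. emeasure (N \<omega>) (E i))"
      using Esets sets_N[OF that(2)] disj
      by (intro sum_emeasure[symmetric]) (auto simp: disjoint_family_on_def)
    also have "\<dots> = cnt C (V \<omega>)"
      unfolding cnt_def V_def by (auto simp: sum.If_cases intro!: sum.cong)
    finally show ?thesis .
  qed
  let ?Xa = "{v\<in>space (PiM {..<n} (\<lambda>_. borel)). \<forall>C\<in>\<C>. cnt C v \<in> DC C}"
  let ?Xb = "(\<lambda>v. v n) -` B \<inter> space (PiM {n} (\<lambda>_. borel :: ennreal measure))"
  have Xa: "?Xa \<in> sets (PiM {..<n} (\<lambda>_. borel))"
  proof (intro sets.sets_Collect_finite_All \<C>)
    fix C assume C: "C \<in> \<C>"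
    have m: "cnt C \<in> borel_measurable (PiM {..<n} (\<lambda>_. borel))"
      unfolding cnt_def[abs_def] by (intro borel_measurable_sum) (auto intro!: measurable_component_singleton)
    have "cnt C -` DC C \<inter> space (PiM {..<n} (\<lambda>_. borel)) \<in> sets (PiM {..<n} (\<lambda>_. borel))"
      using DC C by (intro measurable_sets[OF m]) auto
    also have "cnt C -` DC C \<inter> space (PiM {..<n} (\<lambda>_. borel)) = {v\<in>space (PiM {..<n} (\<lambda>_. borel)). cnt C v \<in> DC C}"
      by auto
    finally show "{v\<in>space (PiM {..<n} (\<lambda>_. borel)). cnt C v \<in> DC C} \<in> sets (PiM {..<n} (\<lambda>_. borel))" .
  qed
  have Xb: "?Xb \<in> sets (PiM {n} (\<lambda>_. borel))"
    using B by (intro measurable_sets[OF measurable_component_singleton]) auto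
  have a: "V -` ?Xa \<inter> space M = cylinder \<C> DC"
    using N_sum by (auto simp: cylinder_def V_def space_PiM)
  have b: "W -` ?Xb \<inter> space M = (\<lambda>\<omega>. emeasure (N \<omega>) D) -` B \<inter> space M"
    by (auto simp: W_def space_PiM E_def)
  have "(\<lambda>\<omega>. (V \<omega>, W \<omega>)) -` (?Xa \<times> ?Xb) \<inter> space M = (V -` ?Xa \<inter> space M) \<inter> (W -` ?Xb \<inter> space M)"
    by auto
  then show ?thesis
    using indep_varD[OF ivar Xa Xb] unfolding a b by simp
qed

text \<open>Cylinders and null sets form an intersection-stable family whose sigma-algebra contains
  \<open>F t\<close>, and null events are independent of everything, so the augmentation is
  harmless. Independence thus extends from cylinders to the whole past. The function
  \<open>g\<close> turns the extended count into the centred count or its square.\<close>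

lemma indep_var_past_future:
  fixes Z :: "'a \<Rightarrow> real" and g :: "ennreal \<Rightarrow> real"
  assumes D: "D \<in> sets \<mu>" "D \<subseteq> {t<..} \<times> UNIV"
    and Z: "Z \<in> borel_measurable (F t)" and g: "g \<in> borel_measurable borel"
  shows "indep_var borel Z borel (\<lambda>\<omega>. g (emeasure (N \<omega>) D))"
proof -
  let ?ND = "\<lambda>\<omega>. emeasure (N \<omega>) D"
  let ?B = "{?ND -` B \<inter> space M | B. B \<in> sets borel}"
  have [measurable]: "?ND \<in> borel_measurable M"
    by (rule measurable_N) fact
  have "indep_set (cylinders t \<union> null_sets M) ?B"
    unfolding indep_sets2_eq
  proof (intro conjI ballI)
    show "cylinders t \<union> null_sets M \<subseteq> events"
      using cylinder_event by (auto simp: cylinders_def)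
    show "?B \<subseteq> events" by auto
    fix E G assume E: "E \<in> cylinders t \<union> null_sets M" and "G \<in> ?B"
    then obtain B where B: "B \<in> sets borel" "G = ?ND -` B \<inter> space M" by auto
    then have Gev: "G \<in> events" by auto
    show "prob (E \<inter> G) = prob E * prob G"
    proof (cases "E \<in> null_sets M")
      case True
      then have "E \<inter> G \<in> null_sets M"
        using Gev by (rule null_set_Int2)
      with True show ?thesis
        by (auto simp: measure_eq_0_null_sets)
    next
      case False
      with E show ?thesis
        unfolding cylinders_def B using cylinder_indep[OF _ _ _ D B(1)] by auto
    qed
  qed
  moreover have "Int_stable ?B"
  proof (rule Int_stableI, safe)
    fix B B' :: "ennreal set" assume "B \<in> sets borel" "B' \<in> sets borel"
    then show "\<exists>Ba. ?ND -` B \<inter> space M \<inter> (?ND -` B' \<inter> space M) = ?ND -` Ba \<inter> space M \<and> Ba \<in> sets borel"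
      by (intro exI[of _ "B \<inter> B'"]) auto
  qed
  ultimately have I: "indep_set (sigma_sets (space M) (cylinders t \<union> null_sets M)) (sigma_sets (space M) ?B)"
    by (intro indep_set_sigma_sets Int_stable_cylinders)
  let ?W = "\<lambda>\<omega>. g (?ND \<omega>)"
  have W: "sigma_sets (space M) {?W -` A \<inter> space M |A. A \<in> sets borel} \<subseteq> sigma_sets (space M) ?B"
  proof (intro sigma_sets_mono' subsetI, safe)
    fix A :: "real set" assume "A \<in> sets borel"
    then show "\<exists>B. ?W -` A \<inter> space M = ?ND -` B \<inter> space M \<and> B \<in> sets borel"
      using measurable_sets[OF g, of A] by (intro exI[of _ "g -` A"]) auto
  qed
  have "indep_set (sigma_sets (space M) {Z -` A \<inter> space M |A. A \<in> sets borel})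
      (sigma_sets (space M) {?W -` A \<inter> space M |A. A \<in> sets borel})"
    unfolding indep_sets2_eq
  proof (intro conjI ballI)
    have sub: "sigma_sets (space M) {Z -` A \<inter> space M |A. A \<in> sets borel} \<subseteq> sets (F t)"
      using measurable_sets[OF Z] sets.sigma_sets_subset[of "{Z -` A \<inter> space M |A. A \<in> sets borel}" "F t"]
      unfolding space_F by blast
    then show "sigma_sets (space M) {Z -` A \<inter> space M |A. A \<in> sets borel} \<subseteq> events"
      using F_subset by blast
    have "sigma_sets (space M) ?B \<subseteq> events"
      by (intro sets.sigma_sets_subset) auto
    with W show "sigma_sets (space M) {?W -` A \<inter> space M |A. A \<in> sets borel} \<subseteq> events"
      by blast
    fix a b assume "a \<in> sigma_sets (space M) {Z -` A \<inter> space M |A. A \<in> sets borel}"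
      "b \<in> sigma_sets (space M) {?W -` A \<inter> space M |A. A \<in> sets borel}"
    then show "prob (a \<inter> b) = prob a * prob b"
      using sub W sets_F_cylinders I unfolding indep_sets2_eq by blast
  qed
  then show ?thesis
    unfolding indep_var_eq using measurable_F[OF Z] g by auto
qed

section \<open>Compensated counts multiplied by factors from the past\<close>

lemma
  assumes D: "finite_intensity D" "D \<subseteq> {t<..} \<times> UNIV" and Z: "Z \<in> borel_measurable (F t)" "integrable M Z"
  shows past_times_Nt: "has_bochner_integral M (\<lambda>\<omega>. Z \<omega> * Nt D \<omega>) 0"
    and past_times_Nt_sq: "has_bochner_integral M (\<lambda>\<omega>. Z \<omega> * (Nt D \<omega>)\<^sup>2) ((\<integral>\<omega>. Z \<omega> \<partial>M) * measure \<mu> D)"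
proof -
  have eq: "Nt D = (\<lambda>\<omega>. enn2real (emeasure (N \<omega>) D) - measure \<mu> D)"
    by (simp add: fun_eq_iff compensated_def measure_def)
  \<comment> \<open>Independence makes the moments factor; the Poisson law makes the mean of
    \<open>Nt D\<close> zero and its variance equal to the intensity of \<open>D\<close>.\<close>
  have i1: "indep_var borel Z borel (Nt D)"
    unfolding eq by (rule indep_var_past_future[OF _ D(2) Z(1)]) (use D in \<open>auto simp: finite_intensity_def\<close>)
  have i2: "indep_var borel Z borel (\<lambda>\<omega>. (Nt D \<omega>)\<^sup>2)"
    unfolding eq by (rule indep_var_past_future[OF _ D(2) Z(1)]) (use D in \<open>auto simp: finite_intensity_def\<close>)
  show "has_bochner_integral M (\<lambda>\<omega>. Z \<omega> * Nt D \<omega>) 0"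
    using indep_var_integrable[OF i1] indep_var_lebesgue_integral[OF i1] Z
      integrable_Nt[OF D(1)] integral_Nt[OF D(1)] by (simp add: has_bochner_integral_iff)
  show "has_bochner_integral M (\<lambda>\<omega>. Z \<omega> * (Nt D \<omega>)\<^sup>2) ((\<integral>\<omega>. Z \<omega> \<partial>M) * measure \<mu> D)"
    using indep_var_integrable[OF i2] indep_var_lebesgue_integral[OF i2] Z
      integrable_Nt_sq[OF D(1)] integral_Nt_sq[OF D(1)] by (simp add: has_bochner_integral_iff)
qed

text \<open>Polarisation: \<open>2 * Nt C * Nt D\<close> is almost surely the square of
  \<open>Nt (C \<union> D)\<close> minus the squares of \<open>Nt C\<close> and \<open>Nt D\<close>.
  Only independence of \<open>Z\<close> from a single count enters, never from a pair, and the three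
  intensities cancel by additivity.\<close>

lemma past_times_Nt_disjoint:
  assumes C: "finite_intensity C" "C \<subseteq> {t<..} \<times> UNIV" and D: "finite_intensity D" "D \<subseteq> {t<..} \<times> UNIV"
    and disj: "C \<inter> D = {}" and Z: "Z \<in> borel_measurable (F t)" "integrable M Z"
  shows "has_bochner_integral M (\<lambda>\<omega>. Z \<omega> * (Nt C \<omega> * Nt D \<omega>)) 0"
proof -
  have U: "finite_intensity (C \<union> D)" "C \<union> D \<subseteq> {t<..} \<times> UNIV"
    using C D finite_intensity_Un by auto
  have m: "measure \<mu> (C \<union> D) = measure \<mu> C + measure \<mu> D"
    using C D disj by (intro measure_Union) (auto simp: finite_intensity_def)
  note [measurable] = measurable_Nt[OF C(1)] measurable_Nt[OF D(1)] measurable_Nt[OF U(1)] measurable_F[OF Z(1)]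
  have "has_bochner_integral M (\<lambda>\<omega>. (Z \<omega> * (Nt (C \<union> D) \<omega>)\<^sup>2 - Z \<omega> * (Nt C \<omega>)\<^sup>2 - Z \<omega> * (Nt D \<omega>)\<^sup>2) / 2)
     (((\<integral>\<omega>. Z \<omega> \<partial>M) * measure \<mu> (C \<union> D) - (\<integral>\<omega>. Z \<omega> \<partial>M) * measure \<mu> C - (\<integral>\<omega>. Z \<omega> \<partial>M) * measure \<mu> D) / 2)"
    by (intro has_bochner_integral_divide has_bochner_integral_diff past_times_Nt_sq[where t = t] Z C D U)
  also have "?this \<longleftrightarrow> has_bochner_integral M (\<lambda>\<omega>. Z \<omega> * (Nt C \<omega> * Nt D \<omega>)) 0"
  proof (rule has_bochner_integral_cong_AE')
    show "AE \<omega> in M. (Z \<omega> * (Nt (C \<union> D) \<omega>)\<^sup>2 - Z \<omega> * (Nt C \<omega>)\<^sup>2 - Z \<omega> * (Nt D \<omega>)\<^sup>2) / 2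
        = Z \<omega> * (Nt C \<omega> * Nt D \<omega>)"
      using AE_Nt_Un[OF C(1) D(1) disj]
      by eventually_elim (simp add: power2_eq_square algebra_simps)
  qed (auto simp: m algebra_simps)
  finally show ?thesis .
qed

text \<open>After cutting \<open>C\<close> and \<open>D\<close> into their differences and their
  intersection, all products of distinct pieces have mean zero against \<open>Z\<close>; only the
  square of the common piece contributes.\<close>

lemma past_times_Nt_Nt:
  assumes C: "finite_intensity C" "C \<subseteq> {t<..} \<times> UNIV" and D: "finite_intensity D" "D \<subseteq> {t<..} \<times> UNIV"
    and Z: "Z \<in> borel_measurable (F t)" "integrable M Z"
  shows "has_bochner_integral M (\<lambda>\<omega>. Z \<omega> * (Nt C \<omega> * Nt D \<omega>)) ((\<integral>\<omega>. Z \<omega> \<partial>M) * measure \<mu> (C \<inter> D))"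
proof -
  let ?A = "C - D" and ?B = "C \<inter> D" and ?E = "D - C"
  have f: "finite_intensity ?A" "finite_intensity ?B" "finite_intensity ?E"
    using C D finite_intensity_subset[OF C(1), of "C - D"] finite_intensity_subset[OF C(1), of "C \<inter> D"] finite_intensity_subset[OF D(1), of "D - C"]
    by (auto dest!: finite_intensity_in_sets)
  have s: "?A \<subseteq> {t<..} \<times> UNIV" "?B \<subseteq> {t<..} \<times> UNIV" "?E \<subseteq> {t<..} \<times> UNIV"
    using C D by auto
  note [measurable] = measurable_Nt[OF C(1)] measurable_Nt[OF D(1)] measurable_Nt[OF f(1)]
    measurable_Nt[OF f(2)] measurable_Nt[OF f(3)] measurable_F[OF Z(1)]
  have eC: "AE \<omega> in M. Nt C \<omega> = Nt ?A \<omega> + Nt ?B \<omega>"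
    using AE_Nt_Un[OF f(1,2)] unfolding Un_Diff_Int by blast
  have eD: "AE \<omega> in M. Nt D \<omega> = Nt ?E \<omega> + Nt ?B \<omega>"
    using AE_Nt_Un[OF f(3,2)] unfolding Int_commute[of C D] Un_Diff_Int by blast
  have "has_bochner_integral M (\<lambda>\<omega>. Z \<omega> * (Nt ?A \<omega> * Nt ?E \<omega>) + Z \<omega> * (Nt ?A \<omega> * Nt ?B \<omega>)
      + Z \<omega> * (Nt ?E \<omega> * Nt ?B \<omega>) + Z \<omega> * (Nt ?B \<omega>)\<^sup>2)
      (0 + 0 + 0 + (\<integral>\<omega>. Z \<omega> \<partial>M) * measure \<mu> ?B)"
    by (intro has_bochner_integral_add past_times_Nt_disjoint[where t = t] past_times_Nt_sq[where t = t] f s Z) auto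
  also have "?this \<longleftrightarrow> ?thesis"
  proof (rule has_bochner_integral_cong_AE')
    show "AE \<omega> in M. Z \<omega> * (Nt ?A \<omega> * Nt ?E \<omega>) + Z \<omega> * (Nt ?A \<omega> * Nt ?B \<omega>)
      + Z \<omega> * (Nt ?E \<omega> * Nt ?B \<omega>) + Z \<omega> * (Nt ?B \<omega>)\<^sup>2 = Z \<omega> * (Nt C \<omega> * Nt D \<omega>)"
      using eC eD by eventually_elim (simp add: power2_eq_square algebra_simps)
  qed auto
  finally show ?thesis .
qed

lemma integrable_bounded:
  fixes Y :: "'a \<Rightarrow> real"
  assumes "Y \<in> borel_measurable M" "\<And>\<omega>. \<omega> \<in> space M \<Longrightarrow> \<bar>Y \<omega>\<bar> \<le> c"
  shows "integrable M Y"
  by (rule integrable_const_bound[of _ c]) (use assms in auto)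

text \<open>Only the part of \<open>C\<close> after time \<open>a'\<close> contributes.\<close>

lemma cross_moment_ordered:
  assumes le: "a \<le> a'"
    and C: "finite_intensity C" "C \<in> sets borel" "C \<subseteq> {a<..} \<times> UNIV" "0 \<le> a"
    and D: "finite_intensity D" "D \<subseteq> {a'<..} \<times> UNIV"
    and Y: "Y \<in> borel_measurable (F a)" "\<And>\<omega>. \<omega> \<in> space M \<Longrightarrow> \<bar>Y \<omega>\<bar> \<le> c"
    and Y': "Y' \<in> borel_measurable (F a')" "\<And>\<omega>. \<omega> \<in> space M \<Longrightarrow> \<bar>Y' \<omega>\<bar> \<le> c'"
  shows "has_bochner_integral M (\<lambda>\<omega>. (Y \<omega> * Nt C \<omega>) * (Y' \<omega> * Nt D \<omega>))
     ((\<integral>\<omega>. Y \<omega> * Y' \<omega> \<partial>M) * measure \<mu> (C \<inter> D))"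
proof -
  define C1 where "C1 = C \<inter> ({..a'} \<times> UNIV)"
  define C2 where "C2 = C \<inter> ({a'<..} \<times> UNIV)"
  have h: "{..a'} \<times> (UNIV :: (real \<times> real) set) \<in> sets borel" "{a'<..} \<times> (UNIV :: (real \<times> real) set) \<in> sets borel"
    by (intro borel_closed closed_Times; simp) (intro borel_open open_Times; simp)
  have b: "C1 \<in> sets borel" "C2 \<in> sets borel"
    unfolding C1_def C2_def using C h by auto
  have past: "C1 \<in> past a'"
    using C b by (auto simp: C1_def)
  have "C2 \<subseteq> {0..} \<times> UNIV"
    using C by (auto simp: C2_def)
  then have f: "finite_intensity C1" "finite_intensity C2"
    using past_sets[OF past] sets_intensityI[OF b(2)] C by (auto intro!: finite_intensity_subset[of C] simp: C1_def C2_def)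
  have U: "C = C1 \<union> C2" and disj: "C1 \<inter> C2 = {}"
    by (auto simp: C1_def C2_def)
  have CD: "C2 \<inter> D = C \<inter> D"
    using D by (auto simp: C2_def)
  have YF: "Y \<in> borel_measurable (F a')"
    using measurable_F_mono[OF le] Y by auto
  note [measurable] = measurable_Nt[OF C(1)] measurable_Nt[OF D(1)] measurable_Nt[OF f(1)]
    measurable_Nt[OF f(2)] measurable_F[OF Y(1)] measurable_F[OF Y'(1)]
  have b': "\<bar>Y \<omega> * Y' \<omega>\<bar> \<le> \<bar>c\<bar> * \<bar>c'\<bar>" if "\<omega> \<in> space M" for \<omega>
    unfolding abs_mult using Y(2)[OF that] Y'(2)[OF that] by (intro mult_mono) auto
  have iYY: "integrable M (\<lambda>\<omega>. Y \<omega> * Y' \<omega>)"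
    by (rule integrable_bounded[OF _ b']) auto
  have iZ: "integrable M (\<lambda>\<omega>. Y \<omega> * Y' \<omega> * Nt C1 \<omega>)"
  proof (rule Bochner_Integration.integrable_bound)
    show "integrable M (\<lambda>\<omega>. \<bar>c\<bar> * \<bar>c'\<bar> * Nt C1 \<omega>)"
      using integrable_Nt[OF f(1)] by auto
    show "AE \<omega> in M. norm (Y \<omega> * Y' \<omega> * Nt C1 \<omega>) \<le> norm (\<bar>c\<bar> * \<bar>c'\<bar> * Nt C1 \<omega>)"
    proof (rule AE_I2)
      fix \<omega> assume "\<omega> \<in> space M"
      from mult_right_mono[OF b'[OF this], of "\<bar>Nt C1 \<omega>\<bar>"]
      show "norm (Y \<omega> * Y' \<omega> * Nt C1 \<omega>) \<le> norm (\<bar>c\<bar> * \<bar>c'\<bar> * Nt C1 \<omega>)"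
        by (simp add: abs_mult)
    qed
  qed auto
  have mZ: "(\<lambda>\<omega>. Y \<omega> * Y' \<omega>) \<in> borel_measurable (F a')"
     "(\<lambda>\<omega>. Y \<omega> * Y' \<omega> * Nt C1 \<omega>) \<in> borel_measurable (F a')"
    using YF Y' measurable_Nt_F[OF past] by auto
  \<comment> \<open>\<open>Nt C1\<close> is known at time \<open>a'\<close> and joins the past
    factor, so its product with the centred count of \<open>D\<close> has mean zero. This factor is
    unbounded, which is why its integrability \<open>iZ\<close> had to be shown.\<close>
  have "has_bochner_integral M (\<lambda>\<omega>. (Y \<omega> * Y' \<omega> * Nt C1 \<omega>) * Nt D \<omega> + (Y \<omega> * Y' \<omega>) * (Nt C2 \<omega> * Nt D \<omega>))
     (0 + (\<integral>\<omega>. Y \<omega> * Y' \<omega> \<partial>M) * measure \<mu> (C2 \<inter> D))"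
    by (intro has_bochner_integral_add past_times_Nt[OF D] past_times_Nt_Nt[where t = a'] f D mZ iZ iYY)
       (auto simp: C2_def)
  also have "?this \<longleftrightarrow> ?thesis"
  proof (rule has_bochner_integral_cong_AE')
    show "AE \<omega> in M. (Y \<omega> * Y' \<omega> * Nt C1 \<omega>) * Nt D \<omega> + (Y \<omega> * Y' \<omega>) * (Nt C2 \<omega> * Nt D \<omega>)
        = (Y \<omega> * Nt C \<omega>) * (Y' \<omega> * Nt D \<omega>)"
      using AE_Nt_Un[OF f disj] unfolding U[symmetric]
      by eventually_elim (simp add: algebra_simps)
  qed (auto simp: CD)
  finally show ?thesis .
qed

lemma cross_moment:
  assumes C: "finite_intensity C" "C \<in> sets borel" "C \<subseteq> {a<..} \<times> UNIV" "0 \<le> a"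
    and D: "finite_intensity D" "D \<in> sets borel" "D \<subseteq> {a'<..} \<times> UNIV" "0 \<le> a'"
    and Y: "Y \<in> borel_measurable (F a)" "\<And>\<omega>. \<omega> \<in> space M \<Longrightarrow> \<bar>Y \<omega>\<bar> \<le> c"
    and Y': "Y' \<in> borel_measurable (F a')" "\<And>\<omega>. \<omega> \<in> space M \<Longrightarrow> \<bar>Y' \<omega>\<bar> \<le> c'"
  shows "has_bochner_integral M (\<lambda>\<omega>. (Y \<omega> * Nt C \<omega>) * (Y' \<omega> * Nt D \<omega>))
     ((\<integral>\<omega>. Y \<omega> * Y' \<omega> \<partial>M) * measure \<mu> (C \<inter> D))"
proof (cases "a \<le> a'")
  case True
  show ?thesis by (rule cross_moment_ordered[OF True C D(1,3) Y Y'])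
next
  case False
  then have "a' \<le> a" by simp
  from cross_moment_ordered[OF this D C(1,3) Y' Y] show ?thesis
    by (simp add: mult.commute Int_commute)
qed

end

section \<open>The stochastic integral\<close>

context poisson_noise begin

abbreviation "simple \<equiv> simple_stoch_integral M \<nu> N"

lemma box_borel: "A \<in> sets borel \<Longrightarrow> B \<in> sets borel \<Longrightarrow> {a<..b::real} \<times> A \<times> B \<in> sets (borel :: (real \<times> real \<times> real) measure)"
  by (intro borel_Times) auto

lemma simple_measurable_I: "simple f I \<Longrightarrow> I \<in> borel_measurable M"
proof (induction rule: simple_stoch_integral.induct)
  case (add f I a b A B Y c)
  note [measurable] = measurable_Nt[OF finite_intensity_box[OF add.hyps(2,4-6), of b]] measurable_F[OF add.hyps(7)] add.IH
  show ?case by measurable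
qed simp

lemma simple_measurable_section: "simple f I \<Longrightarrow> (\<lambda>\<omega>. f \<omega> z) \<in> borel_measurable M"
proof (induction rule: simple_stoch_integral.induct)
  case (add f I a b A B Y c)
  note [measurable] = measurable_F[OF add.hyps(7)] add.IH
  show ?case by measurable
qed simp

lemma simple_measurable_joint: "simple f I \<Longrightarrow> (\<lambda>(z, \<omega>). f \<omega> z) \<in> borel_measurable (\<mu> \<Otimes>\<^sub>M M)"
proof (induction rule: simple_stoch_integral.induct)
  case (add f I a b A B Y c)
  note [measurable] = finite_intensity_in_sets[OF finite_intensity_box[OF add.hyps(2,4-6), of b]] measurable_F[OF add.hyps(7)]
  have [measurable]: "(\<lambda>x. f (snd x) (fst x)) \<in> borel_measurable (\<mu> \<Otimes>\<^sub>M M)"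
    using add.IH by (simp add: split_beta')
  show ?case
    unfolding split_beta' by measurable
qed simp

lemma simple_bounded: "simple f I \<Longrightarrow> \<exists>c. \<forall>\<omega>\<in>space M. \<forall>z. \<bar>f \<omega> z\<bar> \<le> c"
proof (induction rule: simple_stoch_integral.induct)
  case (add f I a b A B Y c)
  then obtain c' where c': "\<forall>\<omega>\<in>space M. \<forall>z. \<bar>f \<omega> z\<bar> \<le> c'" by auto
  have "\<bar>f \<omega> z + Y \<omega> * indicator ({a<..b} \<times> A \<times> B) z\<bar> \<le> c' + \<bar>c\<bar>" if "\<omega> \<in> space M" for \<omega> z
  proof -
    have "\<bar>f \<omega> z\<bar> \<le> c'" using c' that by blast
    moreover have "\<bar>Y \<omega> * indicator ({a<..b} \<times> A \<times> B) z\<bar> \<le> \<bar>c\<bar>"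
      using add.hyps(8) that by (auto simp: indicator_def)
    ultimately show ?thesis by linarith
  qed
  then show ?case by blast
qed auto

lemma simple_times_integrable:
  assumes f: "simple f I" and Y: "Y \<in> borel_measurable M" "\<And>\<omega>. \<omega> \<in> space M \<Longrightarrow> \<bar>Y \<omega>\<bar> \<le> c"
  shows "integrable M (\<lambda>\<omega>. f \<omega> z * Y \<omega>)"
proof -
  obtain c' where c': "\<forall>\<omega>\<in>space M. \<forall>z. \<bar>f \<omega> z\<bar> \<le> c'"
    using simple_bounded[OF f] by auto
  show ?thesis
  proof (rule integrable_bounded[of _ "\<bar>c'\<bar> * \<bar>c\<bar>"])
    fix \<omega> assume w: "\<omega> \<in> space M"
    then have "\<bar>f \<omega> z\<bar> \<le> c'" using c' by blast
    then have "\<bar>f \<omega> z\<bar> \<le> \<bar>c'\<bar>" "\<bar>Y \<omega>\<bar> \<le> \<bar>c\<bar>"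
      using Y(2)[OF w] by linarith+
    then show "\<bar>f \<omega> z * Y \<omega>\<bar> \<le> \<bar>c'\<bar> * \<bar>c\<bar>"
      unfolding abs_mult by (intro mult_mono) auto
  qed (use Y simple_measurable_section[OF f] in measurable)
qed

text \<open>This is the cross term that appears when one more box is added to a simple integrand and
  the integral is squared. The single number \<open>r\<close> records that both integrals exist and
  coincide; linearity reduces the claim to \<open>cross_moment\<close> for two boxes.\<close>

lemma simple_cross:
  assumes "simple f I" and C: "finite_intensity C" "C \<in> sets borel" "C \<subseteq> {a<..} \<times> UNIV" "0 \<le> a"
    and Y: "Y \<in> borel_measurable (F a)" "\<And>\<omega>. \<omega> \<in> space M \<Longrightarrow> \<bar>Y \<omega>\<bar> \<le> c"
  shows "\<exists>r. has_bochner_integral \<mu> (\<lambda>z. (\<integral>\<omega>. f \<omega> z * Y \<omega> \<partial>M) * indicator C z) r \<and>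
     has_bochner_integral M (\<lambda>\<omega>. I \<omega> * (Y \<omega> * Nt C \<omega>)) r"
  using assms(1)
proof (induction rule: simple_stoch_integral.induct)
  case zero
  show ?case by (intro exI[of _ 0]) (simp add: has_bochner_integral_zero)
next
  case (add f I a' b' A B Y' c')
  let ?D = "{a'<..b'} \<times> A \<times> B"
  have D: "finite_intensity ?D" "?D \<in> sets borel" "?D \<subseteq> {a'<..} \<times> UNIV"
    using finite_intensity_box[OF add.hyps(2,4-6), of b'] add.hyps(4,5) by (auto intro: box_borel)
  from add.IH obtain r where r: "has_bochner_integral \<mu> (\<lambda>z. (\<integral>\<omega>. f \<omega> z * Y \<omega> \<partial>M) * indicator C z) r"
     "has_bochner_integral M (\<lambda>\<omega>. I \<omega> * (Y \<omega> * Nt C \<omega>)) r" by auto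
  let ?e = "\<integral>\<omega>. Y' \<omega> * Y \<omega> \<partial>M"
  let ?r = "r + ?e * measure \<mu> (?D \<inter> C)"
  have Y'b: "\<And>\<omega>. \<omega> \<in> space M \<Longrightarrow> \<bar>Y' \<omega>\<bar> \<le> c'" using add.hyps(8) by auto
  note [measurable] = measurable_F[OF add.hyps(7)] measurable_F[OF Y(1)]
  have "has_bochner_integral M (\<lambda>\<omega>. I \<omega> * (Y \<omega> * Nt C \<omega>) + (Y' \<omega> * Nt ?D \<omega>) * (Y \<omega> * Nt C \<omega>)) ?r"
    by (intro has_bochner_integral_add r cross_moment[OF D add.hyps(2) C add.hyps(7) Y'b Y])
  then have 1: "has_bochner_integral M (\<lambda>\<omega>. (I \<omega> + Y' \<omega> * Nt ?D \<omega>) * (Y \<omega> * Nt C \<omega>)) ?r"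
    by (simp add: algebra_simps)
  have i1: "integrable M (\<lambda>\<omega>. f \<omega> z * Y \<omega>)" for z
    by (rule simple_times_integrable[OF add.hyps(1) measurable_F[OF Y(1)] Y(2)])
  have i2: "integrable M (\<lambda>\<omega>. Y' \<omega> * Y \<omega>)"
  proof (rule integrable_bounded[of _ "\<bar>c'\<bar> * \<bar>c\<bar>"])
    fix \<omega> assume w: "\<omega> \<in> space M"
    show "\<bar>Y' \<omega> * Y \<omega>\<bar> \<le> \<bar>c'\<bar> * \<bar>c\<bar>"
      unfolding abs_mult using Y'b[OF w] Y(2)[OF w] by (intro mult_mono) auto
  qed auto
  have "(\<integral>\<omega>. (f \<omega> z + Y' \<omega> * indicator ?D z) * Y \<omega> \<partial>M) * indicator C z
     = (\<integral>\<omega>. f \<omega> z * Y \<omega> \<partial>M) * indicator C z + ?e * indicator (?D \<inter> C) z" for z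
  proof -
    have "(\<integral>\<omega>. (f \<omega> z + Y' \<omega> * indicator ?D z) * Y \<omega> \<partial>M)
       = (\<integral>\<omega>. f \<omega> z * Y \<omega> + (Y' \<omega> * Y \<omega>) * indicator ?D z \<partial>M)"
      by (simp add: algebra_simps)
    also have "\<dots> = (\<integral>\<omega>. f \<omega> z * Y \<omega> \<partial>M) + ?e * indicator ?D z"
      by (subst Bochner_Integration.integral_add) (auto intro!: i1 i2)
    finally show ?thesis
      by (simp add: algebra_simps indicator_inter_arith)
  qed
  moreover have "finite_intensity (?D \<inter> C)"
    using D(1) C(1) by (intro finite_intensity_subset[OF D(1)]) (auto dest: finite_intensity_in_sets)
  then have "has_bochner_integral \<mu> (indicator (?D \<inter> C)) (measure \<mu> (?D \<inter> C))"
    by (intro has_bochner_integral_real_indicator) (auto simp: finite_intensity_def)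
  then have "has_bochner_integral \<mu> (\<lambda>z. (\<integral>\<omega>. f \<omega> z * Y \<omega> \<partial>M) * indicator C z + ?e * indicator (?D \<inter> C) z) ?r"
    by (intro has_bochner_integral_add r has_bochner_integral_mult_right)
  ultimately have 2: "has_bochner_integral \<mu>
     (\<lambda>z. (\<integral>\<omega>. (f \<omega> z + Y' \<omega> * indicator ?D z) * Y \<omega> \<partial>M) * indicator C z) ?r"
    by simp
  from 1 2 show ?case by blast
qed

text \<open>Induction over the construction: the new square consists of the old one, twice the cross
  term from \<open>simple_cross\<close>, and the square of the added term. Boxes may overlap and may
  be added in any order of their starting times, since \<open>cross_moment\<close> covers all these
  cases.\<close>

lemma simple_isometry_real:
  assumes "simple f I"
  shows "\<exists>r. has_bochner_integral \<mu> (\<lambda>z. \<integral>\<omega>. (f \<omega> z)\<^sup>2 \<partial>M) r \<and> has_bochner_integral M (\<lambda>\<omega>. (I \<omega>)\<^sup>2) r"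
  using assms
proof (induction rule: simple_stoch_integral.induct)
  case zero
  show ?case by (intro exI[of _ 0]) (simp add: has_bochner_integral_zero)
next
  case (add f I a b A B Y c)
  let ?C = "{a<..b} \<times> A \<times> B"
  have C: "finite_intensity ?C" "?C \<in> sets borel" "?C \<subseteq> {a<..} \<times> UNIV"
    using finite_intensity_box[OF add.hyps(2,4-6), of b] add.hyps(4,5) by (auto intro: box_borel)
  have Yb: "\<And>\<omega>. \<omega> \<in> space M \<Longrightarrow> \<bar>Y \<omega>\<bar> \<le> c" using add.hyps(8) by auto
  from add.IH obtain r where r: "has_bochner_integral \<mu> (\<lambda>z. \<integral>\<omega>. (f \<omega> z)\<^sup>2 \<partial>M) r"
     "has_bochner_integral M (\<lambda>\<omega>. (I \<omega>)\<^sup>2) r" by auto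
  from simple_cross[OF add.hyps(1) C add.hyps(2) add.hyps(7) Yb] obtain s where
    s: "has_bochner_integral \<mu> (\<lambda>z. (\<integral>\<omega>. f \<omega> z * Y \<omega> \<partial>M) * indicator ?C z) s"
     "has_bochner_integral M (\<lambda>\<omega>. I \<omega> * (Y \<omega> * Nt ?C \<omega>)) s" by auto
  let ?e = "\<integral>\<omega>. Y \<omega> * Y \<omega> \<partial>M"
  let ?r = "r + 2 * s + ?e * measure \<mu> ?C"
  have [measurable]: "Y \<in> borel_measurable M" "\<And>z. (\<lambda>\<omega>. f \<omega> z) \<in> borel_measurable M"
    using measurable_F[OF add.hyps(7)] simple_measurable_section[OF add.hyps(1)] by auto
  have "has_bochner_integral M (\<lambda>\<omega>. (I \<omega>)\<^sup>2 + 2 * (I \<omega> * (Y \<omega> * Nt ?C \<omega>))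
      + (Y \<omega> * Nt ?C \<omega>) * (Y \<omega> * Nt ?C \<omega>)) (r + 2 * s + ?e * measure \<mu> (?C \<inter> ?C))"
    by (intro has_bochner_integral_add has_bochner_integral_mult_right r s
         cross_moment[OF C add.hyps(2) C add.hyps(2) add.hyps(7) Yb add.hyps(7) Yb])
  then have 1: "has_bochner_integral M (\<lambda>\<omega>. (I \<omega> + Y \<omega> * Nt ?C \<omega>)\<^sup>2) ?r"
    by (simp add: power2_eq_square algebra_simps)
  have i1: "integrable M (\<lambda>\<omega>. f \<omega> z * Y \<omega>)" for z
    by (rule simple_times_integrable[OF add.hyps(1) _ Yb]) auto
  obtain c' where c': "\<And>\<omega> z. \<omega> \<in> space M \<Longrightarrow> \<bar>f \<omega> z\<bar> \<le> c'"
    using simple_bounded[OF add.hyps(1)] by blast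
  have i2: "integrable M (\<lambda>\<omega>. (f \<omega> z)\<^sup>2)" for z
    unfolding power2_eq_square by (rule simple_times_integrable[OF add.hyps(1) _ c']) auto
  have i3: "integrable M (\<lambda>\<omega>. Y \<omega> * Y \<omega>)"
  proof (rule integrable_bounded[of _ "\<bar>c\<bar> * \<bar>c\<bar>"])
    fix \<omega> assume w: "\<omega> \<in> space M"
    show "\<bar>Y \<omega> * Y \<omega>\<bar> \<le> \<bar>c\<bar> * \<bar>c\<bar>"
      unfolding abs_mult using Yb[OF w] by (intro mult_mono) auto
  qed auto
  have "(\<integral>\<omega>. (f \<omega> z + Y \<omega> * indicator ?C z)\<^sup>2 \<partial>M)
     = (\<integral>\<omega>. (f \<omega> z)\<^sup>2 \<partial>M) + 2 * ((\<integral>\<omega>. f \<omega> z * Y \<omega> \<partial>M) * indicator ?C z) + ?e * indicator ?C z" for z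
  proof -
    have "(f \<omega> z + Y \<omega> * indicator ?C z)\<^sup>2
       = (f \<omega> z)\<^sup>2 + 2 * indicator ?C z * (f \<omega> z * Y \<omega>) + indicator ?C z * (Y \<omega> * Y \<omega>)" for \<omega>
      by (simp add: power2_eq_square algebra_simps indicator_def)
    then have "(\<integral>\<omega>. (f \<omega> z + Y \<omega> * indicator ?C z)\<^sup>2 \<partial>M)
       = (\<integral>\<omega>. (f \<omega> z)\<^sup>2 + 2 * indicator ?C z * (f \<omega> z * Y \<omega>) + indicator ?C z * (Y \<omega> * Y \<omega>) \<partial>M)"
      by presburger
    also have "\<dots> = (\<integral>\<omega>. (f \<omega> z)\<^sup>2 \<partial>M) + 2 * indicator ?C z * (\<integral>\<omega>. f \<omega> z * Y \<omega> \<partial>M) + indicator ?C z * ?e"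
      using i1 i2 i3 by (simp add: Bochner_Integration.integral_add)
    finally show ?thesis
      by (simp add: algebra_simps)
  qed
  moreover have "has_bochner_integral \<mu> (indicator ?C) (measure \<mu> ?C)"
    using C by (intro has_bochner_integral_real_indicator) (auto simp: finite_intensity_def)
  then have "has_bochner_integral \<mu> (\<lambda>z. (\<integral>\<omega>. (f \<omega> z)\<^sup>2 \<partial>M)
     + 2 * ((\<integral>\<omega>. f \<omega> z * Y \<omega> \<partial>M) * indicator ?C z) + ?e * indicator ?C z) ?r"
    by (intro has_bochner_integral_add r s has_bochner_integral_mult_right)
  ultimately have 2: "has_bochner_integral \<mu> (\<lambda>z. \<integral>\<omega>. (f \<omega> z + Y \<omega> * indicator ?C z)\<^sup>2 \<partial>M) ?r"
    by simp
  from 1 2 show ?case by blast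
qed

lemma simple_isometry:
  assumes f: "simple f I"
  shows "(\<integral>\<^sup>+\<omega>. ennreal (\<bar>I \<omega>\<bar>\<^sup>2) \<partial>M) = integrand_sqnorm M \<nu> f"
proof -
  from simple_isometry_real[OF f] obtain r where
    r: "has_bochner_integral \<mu> (\<lambda>z. \<integral>\<omega>. (f \<omega> z)\<^sup>2 \<partial>M) r" "has_bochner_integral M (\<lambda>\<omega>. (I \<omega>)\<^sup>2) r"
    by auto
  obtain c' where c': "\<And>\<omega> z. \<omega> \<in> space M \<Longrightarrow> \<bar>f \<omega> z\<bar> \<le> c'"
    using simple_bounded[OF f] by blast
  have i2: "integrable M (\<lambda>\<omega>. (f \<omega> z)\<^sup>2)" for z
    unfolding power2_eq_square
    by (rule simple_times_integrable[OF f simple_measurable_section[OF f] c'])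
  have "integrand_sqnorm M \<nu> f = (\<integral>\<^sup>+z. ennreal (\<integral>\<omega>. (f \<omega> z)\<^sup>2 \<partial>M) \<partial>\<mu>)"
    unfolding integrand_sqnorm_def by (intro nn_integral_cong) (simp add: nn_integral_eq_integral[OF i2])
  also have "\<dots> = ennreal r"
    using r(1) by (subst nn_integral_eq_integral) (auto simp: has_bochner_integral_iff)
  also have "\<dots> = (\<integral>\<^sup>+\<omega>. ennreal (\<bar>I \<omega>\<bar>\<^sup>2) \<partial>M)"
    using r(2) by (subst nn_integral_eq_integral) (auto simp: has_bochner_integral_iff)
  finally show ?thesis ..
qed

lemma simple_diff:
  assumes f: "simple f I" and "simple g J"
  shows "simple (\<lambda>\<omega> z. f \<omega> z - g \<omega> z) (\<lambda>\<omega>. I \<omega> - J \<omega>)"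
  using assms(2)
proof (induction rule: simple_stoch_integral.induct)
  case zero
  show ?case using f by simp
next
  case (add g J a b A B Y c)
  have "simple (\<lambda>\<omega> z. (f \<omega> z - g \<omega> z) + (- Y \<omega>) * indicator ({a<..b} \<times> A \<times> B) z)
     (\<lambda>\<omega>. (I \<omega> - J \<omega>) + (- Y \<omega>) * Nt ({a<..b} \<times> A \<times> B) \<omega>)"
    using add.hyps by (intro simple_stoch_integral.add[OF add.IH, where c = c]) auto
  then show ?case
    by (simp add: algebra_simps)
qed

end

lemma nn_integral_sq_sum3_le:
  fixes a b c :: "'a \<Rightarrow> real"
  assumes [measurable]: "a \<in> borel_measurable M" "b \<in> borel_measurable M" "c \<in> borel_measurable M"
  shows "(\<integral>\<^sup>+x. ennreal (\<bar>a x + b x + c x\<bar>\<^sup>2) \<partial>M) \<le>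
    3 * ((\<integral>\<^sup>+x. ennreal (\<bar>a x\<bar>\<^sup>2) \<partial>M) + (\<integral>\<^sup>+x. ennreal (\<bar>b x\<bar>\<^sup>2) \<partial>M) + (\<integral>\<^sup>+x. ennreal (\<bar>c x\<bar>\<^sup>2) \<partial>M))"
proof -
  have *: "(x + y + z)\<^sup>2 \<le> 3 * (x\<^sup>2 + y\<^sup>2 + z\<^sup>2)" for x y z :: real
  proof -
    have "0 \<le> (x - y)\<^sup>2 + (y - z)\<^sup>2 + (x - z)\<^sup>2" by simp
    then show ?thesis by (simp add: power2_eq_square algebra_simps)
  qed
  have "(\<integral>\<^sup>+x. ennreal (\<bar>a x + b x + c x\<bar>\<^sup>2) \<partial>M) \<le>
     (\<integral>\<^sup>+x. 3 * (ennreal (\<bar>a x\<bar>\<^sup>2) + ennreal (\<bar>b x\<bar>\<^sup>2) + ennreal (\<bar>c x\<bar>\<^sup>2)) \<partial>M)"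
  proof (rule nn_integral_mono)
    fix x
    have "ennreal (\<bar>a x + b x + c x\<bar>\<^sup>2) \<le> ennreal (3 * (\<bar>a x\<bar>\<^sup>2 + \<bar>b x\<bar>\<^sup>2 + \<bar>c x\<bar>\<^sup>2))"
      using *[of "a x" "b x" "c x"] by (intro ennreal_leI) simp
    also have "\<dots> = ennreal 3 * ennreal (\<bar>a x\<bar>\<^sup>2 + \<bar>b x\<bar>\<^sup>2 + \<bar>c x\<bar>\<^sup>2)"
      by (rule ennreal_mult') simp
    also have "\<dots> = 3 * (ennreal (\<bar>a x\<bar>\<^sup>2) + ennreal (\<bar>b x\<bar>\<^sup>2) + ennreal (\<bar>c x\<bar>\<^sup>2))"
      by (simp add: ennreal_plus)
    finally show "ennreal (\<bar>a x + b x + c x\<bar>\<^sup>2) \<le> 3 * (ennreal (\<bar>a x\<bar>\<^sup>2) + ennreal (\<bar>b x\<bar>\<^sup>2) + ennreal (\<bar>c x\<bar>\<^sup>2))" .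
  qed
  also have "\<dots> = 3 * ((\<integral>\<^sup>+x. ennreal (\<bar>a x\<bar>\<^sup>2) \<partial>M) + (\<integral>\<^sup>+x. ennreal (\<bar>b x\<bar>\<^sup>2) \<partial>M) + (\<integral>\<^sup>+x. ennreal (\<bar>c x\<bar>\<^sup>2) \<partial>M))"
    by (simp add: nn_integral_cmult nn_integral_add)
  finally show ?thesis .
qed

context poisson_noise begin

section \<open>Predictable integrands and the passage beyond simple ones\<close>

abbreviation "Pr \<equiv> predictable_sigma M N"

lemma predictable_rects: "{G \<times> {a<..b} | G a b. 0 \<le> a \<and> a < b \<and> G \<in> sets (F a)} \<subseteq> Pow (space M \<times> {0<..})"
  using F_subset sets.sets_into_space by fastforce

text \<open>Each generating rectangle has an event as its first side and an interval as its second,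
  so measurability of the two coordinates is enough. Composition then turns predictability of
  \<open>u\<close> and of integrands into ordinary measurability.\<close>

lemma measurable_predictable_time:
  assumes "f \<in> space L \<rightarrow> space M \<times> {0<..}"
    and "(\<lambda>x. fst (f x)) \<in> measurable L M" "(\<lambda>x. snd (f x)) \<in> borel_measurable L"
  shows "f \<in> measurable L Pr"
  unfolding predictable_sigma_def
proof (rule measurable_measure_of[OF predictable_rects assms(1)])
  fix y assume "y \<in> {G \<times> {a<..b} | G a b. 0 \<le> a \<and> a < b \<and> G \<in> sets (F a)}"
  then obtain G a b where y: "y = G \<times> {a<..b}" "G \<in> events"
    using F_subset by blast
  have "f -` y \<inter> space L = ((\<lambda>x. fst (f x)) -` G \<inter> space L) \<inter> ((\<lambda>x. snd (f x)) -` {a<..b} \<inter> space L)"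
    unfolding y by (auto simp: mem_Times_iff)
  also have "\<dots> \<in> sets L"
    using assms y by (intro sets.Int measurable_sets[OF assms(2)] measurable_sets[OF assms(3)]) auto
  finally show "f -` y \<inter> space L \<in> sets L" .
qed

lemma predictable_process_section:
  assumes u: "predictable_process M N u" and s: "0 < s"
  shows "(\<lambda>(\<omega>, y). u s y \<omega>) \<in> borel_measurable (M \<Otimes>\<^sub>M borel)"
proof -
  have "(\<lambda>\<omega>. (\<omega>, s)) \<in> measurable M Pr"
    using s by (intro measurable_predictable_time) auto
  then have "(\<lambda>(\<omega>, y). ((\<omega>, s), y)) \<in> measurable (M \<Otimes>\<^sub>M borel) (Pr \<Otimes>\<^sub>M borel)"
    by (auto intro!: measurable_Pair simp: split_beta' intro: measurable_compose[OF measurable_fst])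
  from measurable_compose[OF this u[unfolded predictable_process_def]]
  show ?thesis by (simp add: split_beta')
qed

lemma predictable_process_measurable:
  assumes u: "predictable_process M N u" and s: "0 < s"
  shows "u s y \<in> borel_measurable M"
  using measurable_Pair_compose_split[OF predictable_process_section[OF assms], of "\<lambda>\<omega>. \<omega>" M "\<lambda>_. y"]
  by simp

text \<open>Joint measurability away from the slice \<open>s = 0\<close>, which the predictable sigma-algebra does
  not see and which has intensity \<open>0\<close>.\<close>

definition jointly_measurable :: "('a \<Rightarrow> real \<times> real \<times> real \<Rightarrow> real) \<Rightarrow> bool" where
  "jointly_measurable f \<longleftrightarrow> (\<lambda>(z, \<omega>). indicator {0<..} (fst z) * f \<omega> z) \<in> borel_measurable (\<mu> \<Otimes>\<^sub>M M)"

lemma measurable_fst_intensity [measurable]: "fst \<in> borel_measurable \<mu>"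
  unfolding noise_intensity_def
  by (rule measurable_compose[OF measurable_fst]) (auto intro!: measurable_restrict_space1)

lemma measurable_snd_intensity [measurable]: "snd \<in> measurable \<mu> (borel \<Otimes>\<^sub>M borel)"
proof -
  have "sets (lborel \<Otimes>\<^sub>M \<nu>) = sets (borel \<Otimes>\<^sub>M borel)"
    by (rule sets_pair_measure_cong) (auto simp: sets_nu)
  then show ?thesis
    unfolding noise_intensity_def using measurable_snd measurable_cong_sets by blast
qed

lemma jointly_measurable_predictable:
  assumes "predictable_integrand M N f"
  shows "jointly_measurable f"
proof -
  let ?L = "\<mu> \<Otimes>\<^sub>M M"
  let ?O = "{z\<in>space \<mu>. 0 < fst z} \<times> space M"
  have O: "?O \<inter> space ?L \<in> sets ?L"
    by (intro sets.Int pair_measureI) auto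
  have sp: "space (restrict_space ?L ?O) = ?O"
    by (auto simp: space_restrict_space space_pair_measure)
  have 1: "(\<lambda>x. (snd x, fst (fst x))) \<in> measurable (restrict_space ?L ?O) Pr"
    by (intro measurable_predictable_time) (auto simp: sp intro!: measurable_restrict_space1)
  have "(\<lambda>x. ((snd x, fst (fst x)), snd (fst x))) \<in> measurable (restrict_space ?L ?O) (Pr \<Otimes>\<^sub>M (borel \<Otimes>\<^sub>M borel))"
    using 1 by (intro measurable_Pair) (auto intro!: measurable_restrict_space1)
  from measurable_compose[OF this assms[unfolded predictable_integrand_def]]
  have "(\<lambda>x. f (snd x) (fst x)) \<in> borel_measurable (restrict_space ?L ?O)"
    by (simp add: split_beta')
  then have "(\<lambda>x. indicator ?O x *\<^sub>R f (snd x) (fst x)) \<in> borel_measurable ?L"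
    by (subst (asm) borel_measurable_restrict_space_iff[OF O])
  also have "?this \<longleftrightarrow> jointly_measurable f"
    unfolding jointly_measurable_def
    by (intro measurable_cong) (auto simp: space_pair_measure indicator_def)
  finally show ?thesis .
qed

lemma jointly_measurable_simple: "simple f I \<Longrightarrow> jointly_measurable f"
  unfolding jointly_measurable_def split_beta'
  by (intro borel_measurable_times) (use simple_measurable_joint[of f I] in \<open>auto simp: split_beta'\<close>)

lemma jointly_measurable_diff: "jointly_measurable f \<Longrightarrow> jointly_measurable g \<Longrightarrow> jointly_measurable (\<lambda>\<omega> z. f \<omega> z - g \<omega> z)"
  unfolding jointly_measurable_def split_beta' right_diff_distrib by (rule borel_measurable_diff)

lemma AE_intensity_pos: "AE z in \<mu>. 0 < fst z"
proof -
  interpret p: sigma_finite_measure "lborel \<Otimes>\<^sub>M \<nu>"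
    by (rule sigma_finite_pair_measure[OF sigma_finite_lborel nu.sigma_finite_measure_axioms])
  have "{0} \<in> null_sets (restrict_space lborel {0::real..})"
    by (auto simp: null_sets_restrict_space)
  then have "{0} \<times> space (lborel \<Otimes>\<^sub>M \<nu>) \<in> null_sets \<mu>"
    unfolding noise_intensity_def by (rule p.times_in_null_sets1) (rule sets.top)
  then show ?thesis
    by (rule AE_I') (auto simp: space_intensity space_pair_measure)
qed

text \<open>The norm becomes one integral over a product space, where the inequality for squares of
  sums applies to plain measurable functions.\<close>

lemma sqnorm_joint:
  "integrand_sqnorm M \<nu> f = (\<integral>\<^sup>+x. ennreal (\<bar>indicator {0<..} (fst (fst x)) * f (snd x) (fst x)\<bar>\<^sup>2) \<partial>(\<mu> \<Otimes>\<^sub>M M))"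
  if "jointly_measurable f"
proof -
  have "integrand_sqnorm M \<nu> f =
    (\<integral>\<^sup>+z. (\<integral>\<^sup>+\<omega>. ennreal (\<bar>indicator {0<..} (fst z) * f \<omega> z\<bar>\<^sup>2) \<partial>M) \<partial>\<mu>)"
    unfolding integrand_sqnorm_def
    by (rule nn_integral_cong_AE) (use AE_intensity_pos in \<open>eventually_elim, simp\<close>)
  also have "\<dots> = (\<integral>\<^sup>+x. ennreal (\<bar>indicator {0<..} (fst (fst x)) * f (snd x) (fst x)\<bar>\<^sup>2) \<partial>(\<mu> \<Otimes>\<^sub>M M))"
    using that unfolding jointly_measurable_def split_beta'
    by (subst nn_integral_fst[symmetric]) auto
  finally show ?thesis .
qed

lemma sqnorm_triangle3:
  assumes j: "jointly_measurable f" "jointly_measurable g" "jointly_measurable h" "jointly_measurable k"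
  shows "integrand_sqnorm M \<nu> (\<lambda>\<omega> z. f \<omega> z - k \<omega> z) \<le> 3 *
    (integrand_sqnorm M \<nu> (\<lambda>\<omega> z. f \<omega> z - g \<omega> z) + integrand_sqnorm M \<nu> (\<lambda>\<omega> z. g \<omega> z - h \<omega> z)
     + integrand_sqnorm M \<nu> (\<lambda>\<omega> z. h \<omega> z - k \<omega> z))"
proof -
  note * = jointly_measurable_diff[OF j(1,2)] jointly_measurable_diff[OF j(2,3)] jointly_measurable_diff[OF j(3,4)]
  have "integrand_sqnorm M \<nu> (\<lambda>\<omega> z. f \<omega> z - k \<omega> z) =
    (\<integral>\<^sup>+x. ennreal (\<bar>indicator {0<..} (fst (fst x)) * (f (snd x) (fst x) - g (snd x) (fst x))
      + indicator {0<..} (fst (fst x)) * (g (snd x) (fst x) - h (snd x) (fst x))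
      + indicator {0<..} (fst (fst x)) * (h (snd x) (fst x) - k (snd x) (fst x))\<bar>\<^sup>2) \<partial>(\<mu> \<Otimes>\<^sub>M M))"
    by (simp add: sqnorm_joint[OF jointly_measurable_diff[OF j(1,4)]] algebra_simps)
  also have "\<dots> \<le> 3 *
    (integrand_sqnorm M \<nu> (\<lambda>\<omega> z. f \<omega> z - g \<omega> z) + integrand_sqnorm M \<nu> (\<lambda>\<omega> z. g \<omega> z - h \<omega> z)
     + integrand_sqnorm M \<nu> (\<lambda>\<omega> z. h \<omega> z - k \<omega> z))"
    unfolding sqnorm_joint[OF *(1)] sqnorm_joint[OF *(2)] sqnorm_joint[OF *(3)]
    using *[unfolded jointly_measurable_def split_beta'] by (rule nn_integral_sq_sum3_le)
  finally show ?thesis .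
qed

text \<open>The constant comes from two applications of \<open>(a + b + c)\<^sup>2 \<le> 3(a\<^sup>2 + b\<^sup>2 + c\<^sup>2)\<close>.\<close>

lemma stoch_integral_diff_bound:
  assumes f: "has_stoch_integral M \<nu> N f I" and f': "has_stoch_integral M \<nu> N f' I'"
  shows "(\<integral>\<^sup>+\<omega>. ennreal (\<bar>I \<omega> - I' \<omega>\<bar>\<^sup>2) \<partial>M) \<le> 9 * integrand_sqnorm M \<nu> (\<lambda>\<omega> z. f \<omega> z - f' \<omega> z)"
proof -
  from f obtain g G where g: "\<And>n. simple (g n) (G n)"
    and lg: "(\<lambda>n. integrand_sqnorm M \<nu> (\<lambda>\<omega> z. g n \<omega> z - f \<omega> z)) \<longlonglongrightarrow> 0"
    and lG: "(\<lambda>n. \<integral>\<^sup>+\<omega>. ennreal (\<bar>G n \<omega> - I \<omega>\<bar>\<^sup>2) \<partial>M) \<longlonglongrightarrow> 0"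
    unfolding has_stoch_integral_def by blast
  from f' obtain g' G' where g': "\<And>n. simple (g' n) (G' n)"
    and lg': "(\<lambda>n. integrand_sqnorm M \<nu> (\<lambda>\<omega> z. g' n \<omega> z - f' \<omega> z)) \<longlonglongrightarrow> 0"
    and lG': "(\<lambda>n. \<integral>\<^sup>+\<omega>. ennreal (\<bar>G' n \<omega> - I' \<omega>\<bar>\<^sup>2) \<partial>M) \<longlonglongrightarrow> 0"
    unfolding has_stoch_integral_def by blast
  have [measurable]: "I \<in> borel_measurable M" "I' \<in> borel_measurable M"
    using f f' by (auto simp: has_stoch_integral_def)
  have [measurable]: "G n \<in> borel_measurable M" "G' n \<in> borel_measurable M" for n
    using simple_measurable_I[OF g] simple_measurable_I[OF g'] by auto
  have jf: "jointly_measurable f" "jointly_measurable f'"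
    using f f' jointly_measurable_predictable by (auto simp: has_stoch_integral_def)
  have comm: "integrand_sqnorm M \<nu> (\<lambda>\<omega> z. a \<omega> z - b \<omega> z) = integrand_sqnorm M \<nu> (\<lambda>\<omega> z. b \<omega> z - a \<omega> z)" for a b
    unfolding integrand_sqnorm_def by (subst abs_minus_commute) simp
  let ?n = "integrand_sqnorm M \<nu>"
  let ?S = "?n (\<lambda>\<omega> z. f \<omega> z - f' \<omega> z)"
  let ?X = "\<integral>\<^sup>+\<omega>. ennreal (\<bar>I \<omega> - I' \<omega>\<bar>\<^sup>2) \<partial>M"
  let ?R = "\<lambda>n. 3 * ((\<integral>\<^sup>+\<omega>. ennreal (\<bar>G n \<omega> - I \<omega>\<bar>\<^sup>2) \<partial>M)
      + 3 * (?n (\<lambda>\<omega> z. g n \<omega> z - f \<omega> z) + ?S + ?n (\<lambda>\<omega> z. g' n \<omega> z - f' \<omega> z))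
      + (\<integral>\<^sup>+\<omega>. ennreal (\<bar>G' n \<omega> - I' \<omega>\<bar>\<^sup>2) \<partial>M))"
  have le: "?X \<le> ?R n" for n
  proof -
    \<comment> \<open>The approximating simple integrals are inserted because the isometry is
      available only between them; the difference of their integrands is then compared with that of
      \<open>f\<close> and \<open>f'\<close>.\<close>
    have "?X = (\<integral>\<^sup>+\<omega>. ennreal (\<bar>(I \<omega> - G n \<omega>) + (G n \<omega> - G' n \<omega>) + (G' n \<omega> - I' \<omega>)\<bar>\<^sup>2) \<partial>M)"
      by simp
    also have "\<dots> \<le> 3 * ((\<integral>\<^sup>+\<omega>. ennreal (\<bar>I \<omega> - G n \<omega>\<bar>\<^sup>2) \<partial>M)
       + (\<integral>\<^sup>+\<omega>. ennreal (\<bar>G n \<omega> - G' n \<omega>\<bar>\<^sup>2) \<partial>M) + (\<integral>\<^sup>+\<omega>. ennreal (\<bar>G' n \<omega> - I' \<omega>\<bar>\<^sup>2) \<partial>M))"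
      by (rule nn_integral_sq_sum3_le) auto
    also have "(\<integral>\<^sup>+\<omega>. ennreal (\<bar>G n \<omega> - G' n \<omega>\<bar>\<^sup>2) \<partial>M) = ?n (\<lambda>\<omega> z. g n \<omega> z - g' n \<omega> z)"
      by (rule simple_isometry[OF simple_diff[OF g g']])
    also have "\<dots> \<le> 3 * (?n (\<lambda>\<omega> z. g n \<omega> z - f \<omega> z) + ?S + ?n (\<lambda>\<omega> z. f' \<omega> z - g' n \<omega> z))"
      by (rule sqnorm_triangle3[OF jointly_measurable_simple[OF g] jf jointly_measurable_simple[OF g']])
    finally show ?thesis
      by (simp add: abs_minus_commute[of "I _"] comm[of f' "g' n"] add_mono mult_left_mono)
  qed
  have "?R \<longlonglongrightarrow> 3 * (0 + 3 * (0 + ?S + 0) + 0)"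
    by (intro ennreal_tendsto_cmult tendsto_add tendsto_const lg lg' lG lG') auto
  from LIMSEQ_le_const[OF this] le have "?X \<le> 3 * (0 + 3 * (0 + ?S + 0) + 0)"
    by blast
  then show ?thesis
    by (simp add: mult.assoc[symmetric])
qed

text \<open>The kernel \<open>\<kappa>\<close> need not be measurable in time, since transition densities are only known to be
  measurable in space; hence time is the outermost variable of integration and \<open>A\<close> is a
  measurable majorant.\<close>

lemma kernel_sqnorm_bound:
  fixes \<kappa> :: "real \<Rightarrow> real \<Rightarrow> real" and u :: "real \<Rightarrow> real \<Rightarrow> 'a \<Rightarrow> real" and A :: "real \<Rightarrow> ennreal"
  assumes j: "jointly_measurable (\<lambda>\<omega> (s, y, h). \<kappa> s y * \<sigma> (u s y \<omega>) h)"
    and \<kappa>: "\<And>s. 0 < s \<Longrightarrow> s < T \<Longrightarrow> \<kappa> s \<in> borel_measurable borel"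
    and \<kappa>0: "\<And>s y. T \<le> s \<Longrightarrow> \<kappa> s y = 0"
    and u: "\<And>s y. 0 < s \<Longrightarrow> u s y \<in> borel_measurable M"
    and U: "0 \<le> U" "\<And>s y. 0 < s \<Longrightarrow> s < T \<Longrightarrow> (\<integral>\<^sup>+\<omega>. ennreal (\<bar>u s y \<omega>\<bar>\<^sup>2) \<partial>M) \<le> ennreal U"
    and J: "J \<in> borel_measurable borel" "\<And>h. 0 \<le> J h" "(\<integral>\<^sup>+h. ennreal ((J h)\<^sup>2) \<partial>\<nu>) \<le> ennreal K" "0 \<le> K"
    and \<sigma>: "\<And>h. (\<lambda>x. \<sigma> x h) \<in> borel_measurable borel"
    and \<sigma>0: "\<And>h. \<bar>\<sigma> 0 h\<bar> \<le> J h"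
    and Lip: "0 \<le> Lip" "\<And>x y h. \<bar>\<sigma> x h - \<sigma> y h\<bar> \<le> J h * Lip * \<bar>x - y\<bar>"
    and A: "A \<in> borel_measurable borel"
      "\<And>s. 0 < s \<Longrightarrow> s < T \<Longrightarrow> (\<integral>\<^sup>+y. ennreal ((\<kappa> s y)\<^sup>2) \<partial>lborel) \<le> A s"
  shows "integrand_sqnorm M \<nu> (\<lambda>\<omega> (s, y, h). \<kappa> s y * \<sigma> (u s y \<omega>) h) \<le>
    ennreal (2 * (1 + Lip\<^sup>2 * U) * K) * (\<integral>\<^sup>+s. A s * indicator {0<..<T} s \<partial>lborel)"
proof -
  \<comment> \<open>Comparison with \<open>\<sigma> 0 h\<close> gives the growth bound
    \<open>\<bar>\<sigma> x h\<bar> \<le> J h + J h * Lip * \<bar>x\<bar>\<close>. The factor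
    \<open>2\<close> comes from squaring this sum, and \<open>U\<close> replaces the second moment
    of \<open>u s y\<close>.\<close>
  define c where "c = 2 * (1 + Lip\<^sup>2 * U)"
  have c: "0 \<le> c" using U(1) by (simp add: c_def)
  interpret M2: sigma_finite_measure "lborel \<Otimes>\<^sub>M \<nu>"
    by (rule sigma_finite_pair_measure[OF sigma_finite_lborel nu.sigma_finite_measure_axioms])
  have mJ [measurable]: "J \<in> borel_measurable \<nu>"
    using J(1) measurable_cong_sets[OF sets_nu refl] by blast
  have \<sigma>_sq: "(\<sigma> x h)\<^sup>2 \<le> 2 * (J h)\<^sup>2 + 2 * (J h)\<^sup>2 * Lip\<^sup>2 * x\<^sup>2" for x h
  proof -
    have "\<bar>\<sigma> x h\<bar> \<le> J h + J h * Lip * \<bar>x\<bar>"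
      using \<sigma>0[of h] Lip(2)[of x h 0] by simp
    then have "\<bar>\<sigma> x h\<bar>\<^sup>2 \<le> (J h + J h * Lip * \<bar>x\<bar>)\<^sup>2"
      by (intro power_mono) auto
    also have "\<dots> \<le> 2 * (J h)\<^sup>2 + 2 * (J h * Lip * \<bar>x\<bar>)\<^sup>2"
      using sum_squares_bound[of "J h" "J h * Lip * \<bar>x\<bar>"] by (simp add: power2_sum)
    finally show ?thesis by (simp add: power_mult_distrib)
  qed
  have E\<sigma>: "(\<integral>\<^sup>+\<omega>. ennreal ((\<sigma> (u s y \<omega>) h)\<^sup>2) \<partial>M) \<le> ennreal c * ennreal ((J h)\<^sup>2)"
    if s: "0 < s" "s < T" for s y h
  proof -
    note [measurable] = u[OF s(1)]
    have "(\<integral>\<^sup>+\<omega>. ennreal ((\<sigma> (u s y \<omega>) h)\<^sup>2) \<partial>M) \<le>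
      (\<integral>\<^sup>+\<omega>. ennreal (2 * (J h)\<^sup>2) + ennreal (2 * (J h)\<^sup>2 * Lip\<^sup>2) * ennreal (\<bar>u s y \<omega>\<bar>\<^sup>2) \<partial>M)"
      by (intro nn_integral_mono) (use \<sigma>_sq in \<open>auto simp flip: ennreal_plus ennreal_mult' intro!: ennreal_leI\<close>)
    also have "\<dots> = ennreal (2 * (J h)\<^sup>2) + ennreal (2 * (J h)\<^sup>2 * Lip\<^sup>2) * (\<integral>\<^sup>+\<omega>. ennreal (\<bar>u s y \<omega>\<bar>\<^sup>2) \<partial>M)"
      by (subst nn_integral_add) (auto simp: nn_integral_cmult emeasure_space_1)
    also have "\<dots> \<le> ennreal (2 * (J h)\<^sup>2) + ennreal (2 * (J h)\<^sup>2 * Lip\<^sup>2) * ennreal U"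
      by (intro add_left_mono mult_left_mono U s) simp
    also have "\<dots> = ennreal c * ennreal ((J h)\<^sup>2)"
      using U(1) by (simp add: c_def algebra_simps flip: ennreal_plus ennreal_mult')
    finally show ?thesis .
  qed
  let ?f = "\<lambda>\<omega> (s, y, h). \<kappa> s y * \<sigma> (u s y \<omega>) h"
  let ?H = "\<lambda>z. \<integral>\<^sup>+\<omega>. ennreal (\<bar>indicator {0<..} (fst z) * ?f \<omega> z\<bar>\<^sup>2) \<partial>M"
  have mH: "?H \<in> borel_measurable \<mu>"
    using j unfolding jointly_measurable_def split_beta'
    by (intro borel_measurable_nn_integral) (auto simp: split_beta')
  have "integrand_sqnorm M \<nu> ?f = (\<integral>\<^sup>+z. ?H z \<partial>\<mu>)"
    unfolding integrand_sqnorm_def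
    by (rule nn_integral_cong_AE) (use AE_intensity_pos in \<open>eventually_elim, simp\<close>)
  also have "\<dots> = (\<integral>\<^sup>+s. \<integral>\<^sup>+w. ?H (s, w) \<partial>(lborel \<Otimes>\<^sub>M \<nu>) \<partial>restrict_space lborel {0..})"
    using mH unfolding noise_intensity_def by (rule M2.nn_integral_fst[symmetric])
  also have "\<dots> \<le> (\<integral>\<^sup>+s. ennreal (c * K) * (A s * indicator {0<..<T} s) \<partial>restrict_space lborel {0..})"
  proof (rule nn_integral_mono)
    fix s
    show "(\<integral>\<^sup>+w. ?H (s, w) \<partial>(lborel \<Otimes>\<^sub>M \<nu>)) \<le> ennreal (c * K) * (A s * indicator {0<..<T} s)"
    proof (cases "0 < s \<and> s < T")
      case False
      then have "?H (s, w) = 0" for w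
        using \<kappa>0[of s] by (cases w) (auto simp: indicator_def)
      then show ?thesis by simp
    next
      case True
      then have s: "0 < s" "s < T" by auto
      note [measurable] = \<kappa>[OF s]
      have "?H (s, w) \<le> ennreal (c * (\<kappa> s (fst w))\<^sup>2 * (J (snd w))\<^sup>2)" for w
      proof -
        have "?H (s, w) = (\<integral>\<^sup>+\<omega>. ennreal ((\<kappa> s (fst w))\<^sup>2) * ennreal ((\<sigma> (u s (fst w) \<omega>) (snd w))\<^sup>2) \<partial>M)"
          using s by (cases w) (auto simp: power_mult_distrib ennreal_mult')
        also have "\<dots> = ennreal ((\<kappa> s (fst w))\<^sup>2) * (\<integral>\<^sup>+\<omega>. ennreal ((\<sigma> (u s (fst w) \<omega>) (snd w))\<^sup>2) \<partial>M)"
          using measurable_compose[OF u[OF s(1)] \<sigma>] by (intro nn_integral_cmult) auto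
        also have "\<dots> \<le> ennreal ((\<kappa> s (fst w))\<^sup>2) * (ennreal c * ennreal ((J (snd w))\<^sup>2))"
          by (intro mult_left_mono E\<sigma> s) simp
        finally show ?thesis
          using c by (simp add: mult_ac flip: ennreal_mult')
      qed
      then have "(\<integral>\<^sup>+w. ?H (s, w) \<partial>(lborel \<Otimes>\<^sub>M \<nu>)) \<le>
          (\<integral>\<^sup>+w. ennreal (c * (\<kappa> s (fst w))\<^sup>2 * (J (snd w))\<^sup>2) \<partial>(lborel \<Otimes>\<^sub>M \<nu>))"
        by (intro nn_integral_mono) auto
      also have "\<dots> = (\<integral>\<^sup>+y. \<integral>\<^sup>+h. ennreal (c * (\<kappa> s y)\<^sup>2 * (J h)\<^sup>2) \<partial>\<nu> \<partial>lborel)"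
        by (subst nu.nn_integral_fst[symmetric]) auto
      also have "\<dots> = (\<integral>\<^sup>+y. ennreal (c * (\<kappa> s y)\<^sup>2) * (\<integral>\<^sup>+h. ennreal ((J h)\<^sup>2) \<partial>\<nu>) \<partial>lborel)"
        using c by (intro nn_integral_cong) (simp add: ennreal_mult' nn_integral_cmult)
      also have "\<dots> \<le> (\<integral>\<^sup>+y. ennreal (c * (\<kappa> s y)\<^sup>2) * ennreal K \<partial>lborel)"
        by (intro nn_integral_mono mult_left_mono J) simp
      also have "\<dots> = (\<integral>\<^sup>+y. ennreal (c * K) * ennreal ((\<kappa> s y)\<^sup>2) \<partial>lborel)"
        using c J by (intro nn_integral_cong) (simp add: mult_ac flip: ennreal_mult' ennreal_mult'')
      also have "\<dots> = ennreal (c * K) * (\<integral>\<^sup>+y. ennreal ((\<kappa> s y)\<^sup>2) \<partial>lborel)"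
        by (rule nn_integral_cmult) auto
      also have "\<dots> \<le> ennreal (c * K) * A s"
        by (intro mult_left_mono A s) simp
      finally show ?thesis using s by simp
    qed
  qed
  also have "\<dots> = (\<integral>\<^sup>+s. ennreal (c * K) * (A s * indicator {0<..<T} s) * indicator {0..} s \<partial>lborel)"
    by (subst nn_integral_restrict_space) auto
  also have "\<dots> = (\<integral>\<^sup>+s. ennreal (c * K) * (A s * indicator {0<..<T} s) \<partial>lborel)"
    by (intro nn_integral_cong) (auto simp: indicator_def)
  also have "\<dots> = ennreal (c * K) * (\<integral>\<^sup>+s. A s * indicator {0<..<T} s \<partial>lborel)"
    using A(1) by (intro nn_integral_cmult) auto
  finally show ?thesis
    by (simp add: c_def)
qed

end

section \<open>Fourier inversion and Plancherel for densities\<close>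

text \<open>A signed function is not the density of a measure, and the inverse transform to which
  this is applied is not known in advance to be nonnegative. Adding \<open>c\<close> makes both
  functions densities of measures that are finite on bounded intervals. These agree on half-open
  intervals, which generate the Borel sets, and densities are unique almost everywhere.\<close>

lemma AE_eq_of_Ioc_integrals:
  fixes f g :: "real \<Rightarrow> real"
  assumes [measurable]: "f \<in> borel_measurable borel" "g \<in> borel_measurable borel"
    and f: "\<And>x. - c \<le> f x" and g: "\<And>x. - c \<le> g x"
    and fi: "\<And>a b. a \<le> b \<Longrightarrow> integrable lborel (\<lambda>x. f x * indicator {a<..b} x)"
    and gi: "\<And>a b. a \<le> b \<Longrightarrow> integrable lborel (\<lambda>x. g x * indicator {a<..b} x)"
    and eq: "\<And>a b. a \<le> b \<Longrightarrow> (\<integral>x. f x * indicator {a<..b} x \<partial>lborel) = (\<integral>x. g x * indicator {a<..b} x \<partial>lborel)"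
  shows "AE x in lborel. f x = g x"
proof -
  let ?E = "range (\<lambda>(a, b). {a<..b::real})"
  let ?D = "\<lambda>h. density lborel (\<lambda>x. ennreal (h x + c))"
  have em: "emeasure (?D h) {a<..b} = ennreal ((\<integral>x. h x * indicator {a<..b} x \<partial>lborel) + c * (b - a))"
    if "a \<le> b" and [measurable]: "h \<in> borel_measurable borel" and h: "\<And>x. - c \<le> h x"
      and i: "integrable lborel (\<lambda>x. h x * indicator {a<..b} x)" for h and a b :: real
  proof -
    have ic: "has_bochner_integral lborel (\<lambda>x. c * indicator {a<..b} x) (c * (b - a))"
    proof (rule has_bochner_integral_mult_right)
      have "has_bochner_integral lborel (indicator {a<..b}) (measure lborel {a<..b})"
        by (rule has_bochner_integral_real_indicator) (use that(1) in auto)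
      then show "has_bochner_integral lborel (indicator {a<..b}) (b - a)"
        using that(1) by simp
    qed
    have hb: "has_bochner_integral lborel (\<lambda>x. (h x + c) * indicator {a<..b} x)
       ((\<integral>x. h x * indicator {a<..b} x \<partial>lborel) + c * (b - a))"
      using has_bochner_integral_add[OF has_bochner_integral_integrable[OF i] ic]
      by (simp add: algebra_simps)
    have h0: "0 \<le> h x + c" for x using h[of x] by simp
    have "emeasure (?D h) {a<..b} = (\<integral>\<^sup>+x. ennreal ((h x + c) * indicator {a<..b} x) \<partial>lborel)"
      by (subst emeasure_density) (auto intro!: nn_integral_cong simp: indicator_def)
    also have "\<dots> = ennreal ((\<integral>x. h x * indicator {a<..b} x \<partial>lborel) + c * (b - a))"
      using hb h0 by (subst nn_integral_eq_integral) (auto simp: has_bochner_integral_iff)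
    finally show ?thesis .
  qed
  have "?D f = ?D g"
  proof (rule measure_eqI_generator_eq)
    show "Int_stable ?E"
    proof (rule Int_stableI)
      fix A B assume "A \<in> ?E" "B \<in> ?E"
      then obtain a b c d :: real where "A = {a<..b}" "B = {c<..d}" by auto
      then have "A \<inter> B = {max a c<..min b d}" by auto
      then show "A \<inter> B \<in> ?E" by (auto intro!: image_eqI[of _ _ "(max a c, min b d)"])
    qed
    show "?E \<subseteq> Pow UNIV" by auto
    show "sets (?D f) = sigma_sets UNIV ?E" "sets (?D g) = sigma_sets UNIV ?E"
      using sets_measure_of[of ?E UNIV "\<lambda>_. 0"] borel_sigma_sets_Ioc by auto
    fix X assume "X \<in> ?E"
    then obtain a b :: real where X: "X = {a<..b}" by auto
    show "emeasure (?D f) X = emeasure (?D g) X"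
    proof (cases "a \<le> b")
      case True
      show ?thesis unfolding X
        using em[OF True _ f fi[OF True]] em[OF True _ g gi[OF True]] eq[OF True] by simp
    next
      case False
      then have "X = {}" using X by auto
      then show ?thesis by simp
    qed
  next
    show "range (\<lambda>n::nat. {- real n<..real n}) \<subseteq> ?E" by auto
    show "(\<Union>n::nat. {- real n<..real n}) = UNIV" by (rule UN_Ioc_eq_UNIV)
    fix n :: nat
    have "- real n \<le> real n" by simp
    from em[OF this _ f fi[OF this]] show "emeasure (?D f) {- real n<..real n} \<noteq> \<infinity>"
      by simp
  qed
  then have "AE x in lborel. ennreal (f x + c) = ennreal (g x + c)"
    by (subst (asm) sigma_finite_measure.density_unique_iff[OF sigma_finite_lborel]) auto
  then show ?thesis
  proof eventually_elim
    case (elim x)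
    then show ?case using f[of x] g[of x] by simp
  qed
qed

text \<open>The sign and the factor are the ones inverse to \<open>char\<close>, which integrates
  \<open>iexp (t * x)\<close>.\<close>

definition inverse_fourier :: "(real \<Rightarrow> complex) \<Rightarrow> real \<Rightarrow> complex" where
  "inverse_fourier \<phi> x = (\<integral>t. iexp (- (t * x)) * \<phi> t \<partial>lborel) / (2 * pi)"

lemma inverse_fourier_measurable [measurable]:
  assumes [measurable]: "\<phi> \<in> borel_measurable borel"
  shows "inverse_fourier \<phi> \<in> borel_measurable borel"
  unfolding inverse_fourier_def[abs_def] by measurable

lemma norm_inverse_fourier_le:
  "cmod (inverse_fourier \<phi> x) \<le> (\<integral>t. cmod (\<phi> t) \<partial>lborel) / (2 * pi)"
proof -
  have "cmod (\<integral>t. iexp (- (t * x)) * \<phi> t \<partial>lborel) \<le> (\<integral>t. cmod (iexp (- (t * x)) * \<phi> t) \<partial>lborel)"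
    by (rule integral_norm_bound)
  also have "\<dots> = (\<integral>t. cmod (\<phi> t) \<partial>lborel)"
    by (simp add: norm_mult)
  finally show ?thesis
    unfolding inverse_fourier_def by (simp add: norm_divide divide_right_mono)
qed

text \<open>The right-hand side is the factor in Levy's inversion formula; reading it as the Fourier
  integral of an interval is what opens that formula to Fubini's theorem.\<close>

lemma integral_iexp_Ioc:
  fixes a b t :: real
  assumes "a \<le> b" "t \<noteq> 0"
  shows "(\<integral>x. indicator {a<..b} x *\<^sub>R iexp (- (t * x)) \<partial>lborel) = (iexp (- (t * a)) - iexp (- (t * b))) / (\<i> * t)"
proof -
  let ?F = "\<lambda>x. - iexp (- (t * x)) / (\<i> * t)"
  have d: "(?F has_vector_derivative iexp (- (t * x))) (at x within {a..b})" for x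
  proof -
    have "((\<lambda>z. - exp (- (\<i> * t * z)) / (\<i> * t)) has_field_derivative exp (- (\<i> * t * of_real x))) (at (of_real x))"
      using assms(2) by (auto intro!: derivative_eq_intros)
    from has_vector_derivative_real_field[OF this, of "{a..b}"] show ?thesis
      by (simp add: comp_def mult.assoc)
  qed
  have c: "continuous_on {a..b} (\<lambda>x. iexp (- (t * x)))"
    by (intro continuous_intros)
  have "(\<integral>x. indicator {a<..b} x *\<^sub>R iexp (- (t * x)) \<partial>lborel) = (\<integral>x. indicator {a..b} x *\<^sub>R iexp (- (t * x)) \<partial>lborel)"
    by (intro integral_cong_AE) (auto intro!: AE_I'[of "{a}"] simp: indicator_def)
  also have "\<dots> = ?F b - ?F a"
    using has_bochner_integral_FTC_Icc[OF assms(1) d c] by (simp add: has_bochner_integral_iff)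
  finally show ?thesis
    by (simp add: diff_divide_distrib)
qed

text \<open>Levy's inversion formula gives the mass of an interval with massless endpoints as a
  limit of truncated integrals. With \<open>char M\<close> integrable the truncation disappears by
  dominated convergence; writing the factor as an integral over the interval and exchanging the
  order of integration exposes the inverse transform.\<close>

lemma (in real_distribution) measure_Ioc_inverse_fourier:
  assumes int: "integrable lborel (char M)" and "a \<le> b"
    and atoms: "measure M {a} = 0" "measure M {b} = 0"
  shows "integrable lborel (\<lambda>x. indicator {a<..b} x *\<^sub>R inverse_fourier (char M) x)"
    and "complex_of_real (measure M {a<..b}) = (\<integral>x. indicator {a<..b} x *\<^sub>R inverse_fourier (char M) x \<partial>lborel)"
proof -
  let ?\<phi> = "char M"
  let ?F = "\<lambda>t. (iexp (-(t * a)) - iexp (-(t * b))) / (\<i> * t)"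
  \<comment> \<open>At \<open>t = 0\<close> the quotient is \<open>0\<close>, as a division by zero.
    Otherwise the bound is the one for the interval from \<open>- b\<close> to \<open>- a\<close>,
    because the exponents carry the opposite sign.\<close>
  have norm_F: "cmod (?F t) \<le> b - a" for t
  proof (cases "t = 0")
    case False
    have "?F t = (iexp (t * (- a)) - iexp (t * (- b))) / (\<i> * t)" by simp
    then show ?thesis
      using Levy_Inversion_aux2[of "- b" "- a" t] \<open>a \<le> b\<close> False by simp
  qed (use \<open>a \<le> b\<close> in simp)
  have iF: "integrable lborel (\<lambda>t. ?F t * ?\<phi> t)"
  proof (rule Bochner_Integration.integrable_bound)
    show "integrable lborel (\<lambda>t. (b - a) * cmod (?\<phi> t))"
      using int by auto
    show "AE t in lborel. norm (?F t * ?\<phi> t) \<le> norm ((b - a) * cmod (?\<phi> t))"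
    proof (rule AE_I2)
      fix t
      have "norm (?F t * ?\<phi> t) = norm (?F t) * norm (?\<phi> t)"
        by (rule norm_mult)
      also have "\<dots> \<le> (b - a) * cmod (?\<phi> t)"
        by (intro mult_right_mono norm_F) simp
      finally show "norm (?F t * ?\<phi> t) \<le> norm ((b - a) * cmod (?\<phi> t))"
        using \<open>a \<le> b\<close> by simp
    qed
  qed auto
  have "(\<lambda>n::nat. CLBINT t=ereal (real_of_int (- int n))..ereal (real n). ?F t * ?\<phi> t) \<longlonglongrightarrow> (\<integral>t. ?F t * ?\<phi> t \<partial>lborel)"
  proof -
    have "(\<lambda>n::nat. \<integral>t. indicator {- real n<..<real n} t *\<^sub>R (?F t * ?\<phi> t) \<partial>lborel) \<longlonglongrightarrow> (\<integral>t. ?F t * ?\<phi> t \<partial>lborel)"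
    proof (rule integral_dominated_convergence[where w = "\<lambda>t. cmod (?F t * ?\<phi> t)"])
      show "AE t in lborel. (\<lambda>n::nat. indicator {- real n<..<real n} t *\<^sub>R (?F t * ?\<phi> t)) \<longlonglongrightarrow> ?F t * ?\<phi> t"
      proof (rule AE_I2)
        fix t :: real
        obtain m :: nat where m: "\<bar>t\<bar> < real m" using reals_Archimedean2 by blast
        have "eventually (\<lambda>n::nat. indicator {- real n<..<real n} t *\<^sub>R (?F t * ?\<phi> t) = ?F t * ?\<phi> t) sequentially"
          using eventually_ge_at_top[of m]
        proof eventually_elim
          case (elim n)
          then have "real m \<le> real n" by simp
          with m have "t \<in> {- real n<..<real n}" by auto
          then show ?case by simp
        qed
        then show "(\<lambda>n::nat. indicator {- real n<..<real n} t *\<^sub>R (?F t * ?\<phi> t)) \<longlonglongrightarrow> ?F t * ?\<phi> t"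
          by (rule tendsto_eventually)
      qed
      show "integrable lborel (\<lambda>t. cmod (?F t * ?\<phi> t))"
        using iF by (rule integrable_norm)
    qed (auto simp: indicator_def intro!: AE_I2)
    moreover have "(CLBINT t=ereal (real_of_int (- int n))..ereal (real n). ?F t * ?\<phi> t) = (\<integral>t. indicator {- real n<..<real n} t *\<^sub>R (?F t * ?\<phi> t) \<partial>lborel)" for n :: nat
    proof -
      have "einterval (ereal (real_of_int (- int n))) (ereal (real n)) = {- real n<..<real n}"
        by (simp only: einterval_eq of_int_minus of_int_of_nat_eq)
      moreover have "ereal (real_of_int (- int n)) \<le> ereal (real n)" by simp
      ultimately show ?thesis
        unfolding interval_lebesgue_integral_def set_lebesgue_integral_def by (simp only: if_True)
    qed
    ultimately show ?thesis by (simp only:)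
  qed
  then have "(\<lambda>n::nat. 1 / (2 * pi) * (CLBINT t=ereal (real_of_int (- int n))..ereal (real n). ?F t * ?\<phi> t)) \<longlonglongrightarrow> 1 / (2 * pi) * (\<integral>t. ?F t * ?\<phi> t \<partial>lborel)"
    by (intro tendsto_mult tendsto_const)
  from LIMSEQ_unique[OF Levy_Inversion[OF \<open>a \<le> b\<close> atoms] this]
  have 1: "complex_of_real (measure M {a<..b}) = (\<integral>t. ?F t * ?\<phi> t \<partial>lborel) / (2 * pi)"
    by simp
  let ?G = "\<lambda>(x, t). indicator {a<..b} x *\<^sub>R (iexp (- (t * x)) * ?\<phi> t)"
  have iG: "integrable (lborel \<Otimes>\<^sub>M lborel) ?G"
  proof (rule lborel_pair.Fubini_integrable)
    have "integrable lborel (\<lambda>x. indicator {a<..b} x * (\<integral>t. cmod (?\<phi> t) \<partial>lborel))"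
      using \<open>a \<le> b\<close> by (intro integrable_mult_left integrable_real_indicator) auto
    then show "integrable lborel (\<lambda>x. \<integral>t. norm (?G (x, t)) \<partial>lborel)"
      by (simp add: norm_mult)
    show "AE x in lborel. integrable lborel (\<lambda>t. ?G (x, t))"
    proof (rule AE_I2)
      fix x
      have "integrable lborel (\<lambda>t. iexp (- (t * x)) * ?\<phi> t)"
        by (rule Bochner_Integration.integrable_bound[OF int]) (auto simp: norm_mult)
      then show "integrable lborel (\<lambda>t. ?G (x, t))" by simp
    qed
  qed measurable
  have "integrable lborel (\<lambda>x. (\<integral>t. ?G (x, t) \<partial>lborel) / (2 * pi))"
    using lborel_pair.integrable_fst'[OF iG] by (intro integrable_divide) auto
  then show "integrable lborel (\<lambda>x. indicator {a<..b} x *\<^sub>R inverse_fourier (char M) x)"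
    by (simp add: inverse_fourier_def scaleR_conv_of_real)
  have "indicator {a<..b} x *\<^sub>R inverse_fourier ?\<phi> x = (\<integral>t. ?G (x, t) \<partial>lborel) / (2 * pi)" for x
    by (simp add: inverse_fourier_def scaleR_conv_of_real)
  then have "(\<integral>x. indicator {a<..b} x *\<^sub>R inverse_fourier ?\<phi> x \<partial>lborel) = (\<integral>x. \<integral>t. ?G (x, t) \<partial>lborel \<partial>lborel) / (2 * pi)"
    by (simp only: integral_divide_zero)
  also have "(\<integral>x. \<integral>t. ?G (x, t) \<partial>lborel \<partial>lborel) = (\<integral>t. \<integral>x. ?G (x, t) \<partial>lborel \<partial>lborel)"
    using lborel_pair.Fubini_integral[of "\<lambda>x t. ?G (x, t)"] iG by simp
  also have "\<dots> = (\<integral>t. ?F t * ?\<phi> t \<partial>lborel)"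
  proof (rule integral_cong_AE)
    have "AE t in lborel. t \<noteq> (0::real)"
      by (intro AE_I'[of "{0}"]) auto
    then show "AE t in lborel. (\<integral>x. ?G (x, t) \<partial>lborel) = ?F t * ?\<phi> t"
    proof eventually_elim
      case (elim t)
      have "(\<integral>x. ?G (x, t) \<partial>lborel) = (\<integral>x. (indicator {a<..b} x *\<^sub>R iexp (- (t * x))) * ?\<phi> t \<partial>lborel)"
        by simp
      also have "\<dots> = (\<integral>x. indicator {a<..b} x *\<^sub>R iexp (- (t * x)) \<partial>lborel) * ?\<phi> t"
        by (rule integral_mult_left_zero)
      finally show ?case
        using integral_iexp_Ioc[OF \<open>a \<le> b\<close> elim] by simp
    qed
  qed measurable
  finally show "complex_of_real (measure M {a<..b}) = (\<integral>x. indicator {a<..b} x *\<^sub>R inverse_fourier (char M) x \<partial>lborel)"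
    using 1 by simp
qed

text \<open>A law with a density has no atoms, so the interval formula is valid for all endpoints,
  and both functions have the same integral over every bounded interval. The uniform bound on the
  inverse transform supplies the lower bound \<open>- ?c\<close>.\<close>

lemma (in real_distribution) AE_density_eq_inverse_fourier:
  fixes f :: "real \<Rightarrow> real"
  assumes f [measurable]: "f \<in> borel_measurable borel" "\<And>x. 0 \<le> f x"
    and M: "M = density lborel (\<lambda>x. ennreal (f x))"
    and int: "integrable lborel (char M)"
  shows "AE x in lborel. f x = Re (inverse_fourier (char M) x)"
proof (rule AE_eq_of_Ioc_integrals)
  let ?c = "(\<integral>t. cmod (char M t) \<partial>lborel) / (2 * pi)"
  show "- ?c \<le> f x" for x
  proof -
    have "0 \<le> ?c" by simp
    then show ?thesis using f(2)[of x] by linarith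
  qed
  show "- ?c \<le> Re (inverse_fourier (char M) x)" for x
    using norm_inverse_fourier_le[of "char M" x] abs_Re_le_cmod[of "inverse_fourier (char M) x"] by linarith
  show "(\<lambda>x. Re (inverse_fourier (char M) x)) \<in> borel_measurable borel"
    by measurable
  fix a b :: real assume ab: "a \<le> b"
  have atom: "measure M {x} = 0" for x
  proof -
    have "emeasure M {x} = (\<integral>\<^sup>+y. ennreal (f y) * indicator {x} y \<partial>lborel)"
      unfolding M by (rule emeasure_density) auto
    also have "\<dots> = (\<integral>\<^sup>+y. 0 \<partial>(lborel :: real measure))"
      by (intro nn_integral_cong_AE AE_I'[of "{x}"]) (auto simp: indicator_def)
    finally show ?thesis by (simp add: measure_def)
  qed
  note 1 = measure_Ioc_inverse_fourier[OF int ab atom atom]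
  have "(\<integral>\<^sup>+x. ennreal (f x * indicator {a<..b} x) \<partial>lborel) = emeasure M {a<..b}"
    unfolding M by (subst emeasure_density) (auto intro!: nn_integral_cong simp: indicator_def)
  also have "\<dots> = ennreal (measure M {a<..b})"
    by (simp add: emeasure_eq_measure)
  finally have 2: "has_bochner_integral lborel (\<lambda>x. f x * indicator {a<..b} x) (measure M {a<..b})"
    by (intro has_bochner_integral_nn_integral) (auto simp: f)
  then show "integrable lborel (\<lambda>x. f x * indicator {a<..b} x)"
    by (simp add: has_bochner_integral_iff)
  have "has_bochner_integral lborel (\<lambda>x. indicator {a<..b} x *\<^sub>R inverse_fourier (char M) x) (complex_of_real (measure M {a<..b}))"
    using 1 by (simp add: has_bochner_integral_iff)
  from has_bochner_integral_bounded_linear[OF bounded_linear_Re this]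
  have 3: "has_bochner_integral lborel (\<lambda>x. Re (inverse_fourier (char M) x) * indicator {a<..b} x) (measure M {a<..b})"
    by (simp add: mult.commute)
  then show "integrable lborel (\<lambda>x. Re (inverse_fourier (char M) x) * indicator {a<..b} x)"
    by (simp add: has_bochner_integral_iff)
  show "(\<integral>x. f x * indicator {a<..b} x \<partial>lborel) = (\<integral>x. Re (inverse_fourier (char M) x) * indicator {a<..b} x \<partial>lborel)"
    using 2 3 by (simp add: has_bochner_integral_iff)
qed fact

text \<open>Replace one factor of \<open>(f x)\<^sup>2\<close> by the inverse transform and exchange
  the integrals: the inner one becomes the complex conjugate of \<open>\<phi> t\<close>.
  Integrability of \<open>f\<close> and \<open>\<phi>\<close> justifies the exchange, and square
  integrability comes out as a result. Inversion is a hypothesis so that differences of densities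
  are covered as well.\<close>

lemma plancherel:
  fixes f :: "real \<Rightarrow> real"
  assumes f: "integrable lborel f"
    and \<phi>: "integrable lborel \<phi>" "\<And>t. \<phi> t = (\<integral>x. complex_of_real (f x) * iexp (t * x) \<partial>lborel)"
    and inv: "AE x in lborel. f x = Re (inverse_fourier \<phi> x)"
  shows "(\<integral>\<^sup>+x. ennreal ((f x)\<^sup>2) \<partial>lborel) = ennreal ((\<integral>t. (cmod (\<phi> t))\<^sup>2 \<partial>lborel) / (2 * pi))"
proof -
  have [measurable]: "f \<in> borel_measurable borel" "\<phi> \<in> borel_measurable borel"
    using f \<phi>(1) by (auto dest: borel_measurable_integrable)
  let ?G = "\<lambda>(x, t). complex_of_real (f x) * (iexp (- (t * x)) * \<phi> t)"
  have iG: "integrable (lborel \<Otimes>\<^sub>M lborel) ?G"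
  proof (rule lborel_pair.Fubini_integrable)
    show "integrable lborel (\<lambda>x. \<integral>t. norm (?G (x, t)) \<partial>lborel)"
      using f by (simp add: norm_mult)
    show "AE x in lborel. integrable lborel (\<lambda>t. ?G (x, t))"
    proof (rule AE_I2)
      fix x
      have "integrable lborel (\<lambda>t. iexp (- (t * x)) * \<phi> t)"
        by (rule Bochner_Integration.integrable_bound[OF \<phi>(1)]) (auto simp: norm_mult)
      then show "integrable lborel (\<lambda>t. ?G (x, t))" by simp
    qed
  qed measurable
  have H: "(\<integral>t. ?G (x, t) \<partial>lborel) = complex_of_real (2 * pi * f x) * inverse_fourier \<phi> x" for x
    by (simp add: inverse_fourier_def)
  have iH: "integrable lborel (\<lambda>x. \<integral>t. ?G (x, t) \<partial>lborel)"
    using lborel_pair.integrable_fst'[OF iG] by auto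
  have "(\<integral>x. \<integral>t. ?G (x, t) \<partial>lborel \<partial>lborel) = (\<integral>t. \<integral>x. ?G (x, t) \<partial>lborel \<partial>lborel)"
    using lborel_pair.Fubini_integral[of "\<lambda>x t. ?G (x, t)"] iG by simp
  also have "\<dots> = (\<integral>t. complex_of_real ((cmod (\<phi> t))\<^sup>2) \<partial>lborel)"
  proof (rule Bochner_Integration.integral_cong[OF refl])
    fix t
    have "(\<integral>x. ?G (x, t) \<partial>lborel) = (\<integral>x. cnj (complex_of_real (f x) * iexp (t * x)) * \<phi> t \<partial>lborel)"
      by (simp add: exp_cnj mult_ac)
    also have "\<dots> = (\<integral>x. cnj (complex_of_real (f x) * iexp (t * x)) \<partial>lborel) * \<phi> t"
      by (rule integral_mult_left_zero)
    also have "\<dots> = cnj (\<phi> t) * \<phi> t"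
      unfolding \<phi>(2)[of t] by (simp only: Bochner_Integration.integral_cnj)
    finally show "(\<integral>x. ?G (x, t) \<partial>lborel) = complex_of_real ((cmod (\<phi> t))\<^sup>2)"
      by (simp only: complex_norm_square mult.commute)
  qed
  also have "\<dots> = complex_of_real (\<integral>t. (cmod (\<phi> t))\<^sup>2 \<partial>lborel)"
    by (rule integral_complex_of_real)
  finally have "has_bochner_integral lborel (\<lambda>x. \<integral>t. ?G (x, t) \<partial>lborel) (complex_of_real (\<integral>t. (cmod (\<phi> t))\<^sup>2 \<partial>lborel))"
    using iH by (simp add: has_bochner_integral_iff)
  from has_bochner_integral_bounded_linear[OF bounded_linear_Re this]
  have "has_bochner_integral lborel (\<lambda>x. 2 * pi * f x * Re (inverse_fourier \<phi> x)) (\<integral>t. (cmod (\<phi> t))\<^sup>2 \<partial>lborel)"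
    unfolding H by simp
  from has_bochner_integral_divide[OF this, of "2 * pi"]
  have hb: "has_bochner_integral lborel (\<lambda>x. f x * Re (inverse_fourier \<phi> x)) ((\<integral>t. (cmod (\<phi> t))\<^sup>2 \<partial>lborel) / (2 * pi))"
    by simp
  also have "?this \<longleftrightarrow> has_bochner_integral lborel (\<lambda>x. (f x)\<^sup>2) ((\<integral>t. (cmod (\<phi> t))\<^sup>2 \<partial>lborel) / (2 * pi))"
    by (rule has_bochner_integral_cong_AE) (use inv in \<open>auto simp: power2_eq_square elim: eventually_mono\<close>)
  finally show ?thesis
    by (subst nn_integral_eq_integral) (auto simp: has_bochner_integral_iff)
qed

section \<open>Transition densities of a Levy process\<close>

lemma nn_integral_exp_decay_le:
  fixes a b k :: real
  assumes "a \<le> b" "0 < k"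
  shows "(\<integral>\<^sup>+s. ennreal (exp (- (k * (b - s)))) * indicator {a..b} s \<partial>lborel) \<le> ennreal (1 / k)"
proof -
  have "(\<integral>\<^sup>+s. ennreal (exp (- (k * (b - s)))) * indicator {a..b} s \<partial>lborel)
     = ennreal (exp (- (k * (b - b))) / k - exp (- (k * (b - a))) / k)"
    by (rule nn_integral_FTC_Icc)
       (use assms in \<open>auto intro!: derivative_eq_intros simp: has_real_derivative_iff_has_vector_derivative[symmetric]\<close>)
  also have "\<dots> \<le> ennreal (1 / k)"
    using assms by (intro ennreal_leI) simp
  finally show ?thesis .
qed

locale levy_kernel =
  fixes P :: "'b measure" and X :: "real \<Rightarrow> 'b \<Rightarrow> real" and \<Psi> :: "real \<Rightarrow> complex"
    and p :: "real \<Rightarrow> real \<Rightarrow> real \<Rightarrow> real"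
  assumes levy: "levy_process P X"
    and expo: "characteristic_exponent P X \<Psi>"
    and dens: "transition_density P X p"
    and Upsilon_1: "Upsilon \<Psi> 1 < \<infinity>"
begin

sublocale P: prob_space P
  using levy by (simp add: levy_process_def)

abbreviation r :: "real \<Rightarrow> real" where "r \<xi> \<equiv> Re (\<Psi> \<xi>)"

text \<open>The characteristic function of \<open>X t\<close>, in a closed form that makes
  multiplicativity and continuity in \<open>t\<close> immediate.\<close>

definition \<phi> :: "real \<Rightarrow> real \<Rightarrow> complex" where
  "\<phi> t \<xi> = exp (- (complex_of_real t * \<Psi> \<xi>))"

lemma X_measurable: "0 \<le> t \<Longrightarrow> X t \<in> borel_measurable P"
  using levy by (simp add: levy_process_def)

lemma real_distribution_X: "0 \<le> t \<Longrightarrow> real_distribution (distr P borel (X t))"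
  using X_measurable by (intro P.real_distribution_distr) auto

lemma char_X: "0 \<le> t \<Longrightarrow> char (distr P borel (X t)) = \<phi> t"
  using expo by (auto simp: characteristic_exponent_def \<phi>_def fun_eq_iff)

lemma \<phi>_measurable [measurable]: "0 \<le> t \<Longrightarrow> \<phi> t \<in> borel_measurable borel"
  using real_distribution.char_measurable[OF real_distribution_X[of t]] char_X[of t] by simp

lemma norm_\<phi>: "cmod (\<phi> t \<xi>) = exp (- (t * r \<xi>))"
  by (simp add: \<phi>_def)

lemma r_nonneg: "0 \<le> r \<xi>"
proof -
  have "cmod (\<phi> 1 \<xi>) \<le> 1"
    using real_distribution.cmod_char_le_1[OF real_distribution_X[of 1], of \<xi>] char_X[of 1] by simp
  then show ?thesis by (simp add: norm_\<phi>)
qed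

text \<open>Measurability of \<open>\<Psi>\<close> is not among the assumptions. Characteristic
  functions are measurable, and the modulus of the one at time \<open>1\<close> determines
  \<open>r\<close>.\<close>

lemma r_measurable [measurable]: "r \<in> borel_measurable borel"
proof -
  have "r = (\<lambda>\<xi>. - ln (cmod (\<phi> 1 \<xi>)))"
    by (simp add: norm_\<phi> fun_eq_iff)
  also have "\<dots> \<in> borel_measurable borel"
    by measurable
  finally show ?thesis .
qed

lemma \<phi>_add: "\<phi> (s + t) \<xi> = \<phi> s \<xi> * \<phi> t \<xi>"
  by (simp add: \<phi>_def algebra_simps flip: exp_add)

lemma norm_\<phi>_le_1: "0 \<le> t \<Longrightarrow> cmod (\<phi> t \<xi>) \<le> 1"
  using r_nonneg by (simp add: norm_\<phi>)

text \<open>The integrand of \<open>Upsilon\<close> at \<open>1\<close>; all frequency estimates are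
  dominated by multiples of it.\<close>

definition weight :: "real \<Rightarrow> real" where "weight \<xi> = 1 / (1 + 2 * r \<xi>)"

lemma weight_measurable [measurable]: "weight \<in> borel_measurable borel"
  unfolding weight_def[abs_def] by measurable

lemma weight_nonneg: "0 \<le> weight \<xi>"
  using r_nonneg by (simp add: weight_def)

lemma nn_integral_weight: "(\<integral>\<^sup>+\<xi>. ennreal (weight \<xi>) \<partial>lborel) < \<infinity>"
  using Upsilon_1 unfolding Upsilon_def weight_def
  by (auto simp: ennreal_mult_less_top)

lemma integrable_weight: "integrable lborel weight"
  using nn_integral_weight weight_nonneg by (intro integrableI_nonneg) auto

text \<open>With \<open>y = t * r \<xi>\<close> both \<open>exp (- y) \<le> 1\<close> and
  \<open>y * exp (- y) \<le> 1\<close>; the first plus \<open>2 / t\<close> times the second gives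
  the constant. This is the source of integrability of the characteristic functions at positive
  times.\<close>

lemma norm_\<phi>_le_weight:
  assumes "0 < t"
  shows "cmod (\<phi> t \<xi>) \<le> (1 + 2 / t) * weight \<xi>"
proof -
  have "t * r \<xi> \<le> exp (t * r \<xi>)"
    using exp_ge_add_one_self[of "t * r \<xi>"] by linarith
  moreover have "0 \<le> t * r \<xi>" using assms r_nonneg by simp
  ultimately have 1: "t * r \<xi> * exp (- (t * r \<xi>)) \<le> 1" and "exp (- (t * r \<xi>)) \<le> 1"
    by (simp_all add: exp_minus field_simps)
  from mult_left_mono[OF this(2), of t] have 2: "t * exp (- (t * r \<xi>)) \<le> t"
    using assms by simp
  have "exp (- (t * r \<xi>)) * (1 + 2 * r \<xi>) * t = t * exp (- (t * r \<xi>)) + 2 * (t * r \<xi> * exp (- (t * r \<xi>)))"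
    by (simp add: algebra_simps)
  also have "\<dots> \<le> t + 2"
    using 1 2 by linarith
  finally have "exp (- (t * r \<xi>)) * (1 + 2 * r \<xi>) \<le> (t + 2) / t"
    using assms by (simp add: pos_le_divide_eq)
  then have "exp (- (t * r \<xi>)) * (1 + 2 * r \<xi>) \<le> 1 + 2 / t"
    using assms by (simp add: add_divide_distrib)
  moreover have "0 < 1 + 2 * r \<xi>" using r_nonneg[of \<xi>] by simp
  ultimately show ?thesis
    unfolding norm_\<phi> weight_def by (simp add: pos_le_divide_eq)
qed

lemma integrable_\<phi>:
  assumes "0 < t"
  shows "integrable lborel (\<phi> t)"
proof (rule Bochner_Integration.integrable_bound)
  show "integrable lborel (\<lambda>\<xi>. (1 + 2 / t) * weight \<xi>)"
    using integrable_weight by auto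
  show "AE \<xi> in lborel. norm (\<phi> t \<xi>) \<le> norm ((1 + 2 / t) * weight \<xi>)"
    using norm_\<phi>_le_weight[OF assms] by (intro AE_I2) (metis abs_ge_self order_trans real_norm_def)
qed (use assms in auto)

text \<open>The Fourier transform of \<open>p t x\<close>: the starting point \<open>x\<close>
  contributes only a phase, so bounds on the modulus are uniform in \<open>x\<close>.\<close>

definition \<psi> :: "real \<Rightarrow> real \<Rightarrow> real \<Rightarrow> complex" where
  "\<psi> t x \<xi> = iexp (\<xi> * x) * \<phi> t \<xi>"

lemma \<psi>_measurable [measurable]: "0 \<le> t \<Longrightarrow> \<psi> t x \<in> borel_measurable borel"
  unfolding \<psi>_def[abs_def] by measurable

lemma integrable_\<psi>: "0 < t \<Longrightarrow> integrable lborel (\<psi> t x)"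
  by (rule Bochner_Integration.integrable_bound[OF integrable_\<phi>]) (auto simp: \<psi>_def norm_mult)

lemma
  assumes t: "0 < t"
  shows p_nonneg: "0 \<le> p t x y"
    and p_measurable: "p t x \<in> borel_measurable borel"
    and p_has_integral: "has_bochner_integral lborel (p t x) 1"
    and \<psi>_eq: "\<psi> t x \<xi> = (\<integral>y. complex_of_real (p t x y) * iexp (\<xi> * y) \<partial>lborel)"
    and p_inverse_fourier: "AE y in lborel. p t x y = Re (inverse_fourier (\<psi> t x) y)"
proof -
  have d: "distributed P lborel (\<lambda>\<omega>. x + X t \<omega>) (\<lambda>y. ennreal (p t x y))" and n: "\<And>y. 0 \<le> p t x y"
    using dens t unfolding transition_density_def by auto
  show "0 \<le> p t x y" by (rule n)
  have [measurable]: "X t \<in> borel_measurable P" using X_measurable t by simp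
  \<comment> \<open>Measurability is given for the extended-valued density only; nonnegativity lets
    \<open>enn2real\<close> recover the real one.\<close>
  have "(\<lambda>y. enn2real (ennreal (p t x y))) \<in> borel_measurable borel"
    using distributed_borel_measurable[OF d] by (intro borel_measurable_enn2real) simp
  then show m [measurable]: "p t x \<in> borel_measurable borel"
    using n by simp
  define D where "D = distr P borel (\<lambda>\<omega>. x + X t \<omega>)"
  interpret D: real_distribution D
    unfolding D_def by (rule P.real_distribution_distr) simp
  have D: "D = density lborel (\<lambda>y. ennreal (p t x y))"
    using distributed_distr_eq_density[OF d] unfolding D_def
    by (metis distr_cong sets_lborel)
  have "(\<integral>\<^sup>+y. ennreal (p t x y) \<partial>lborel) = emeasure D (space D)"
    unfolding D by (subst emeasure_density) auto
  also have "\<dots> = ennreal 1" using D.emeasure_space_1 by simp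
  finally show "has_bochner_integral lborel (p t x) 1"
    using n by (intro has_bochner_integral_nn_integral) auto
  have ch: "char D = \<psi> t x"
  proof
    fix \<xi>
    have "char D \<xi> = (CLINT \<omega>|P. iexp (\<xi> * (x + X t \<omega>)))"
      unfolding char_def D_def by (rule integral_distr) auto
    also have "\<dots> = (CLINT \<omega>|P. iexp (\<xi> * x) * iexp (\<xi> * X t \<omega>))"
      by (simp add: algebra_simps flip: exp_add)
    also have "\<dots> = iexp (\<xi> * x) * (CLINT \<omega>|P. iexp (\<xi> * X t \<omega>))"
      by (rule integral_mult_right_zero)
    also have "(CLINT \<omega>|P. iexp (\<xi> * X t \<omega>)) = char (distr P borel (X t)) \<xi>"
      unfolding char_def by (rule integral_distr[symmetric]) auto
    also have "\<dots> = \<phi> t \<xi>" using char_X[of t] t by simp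
    finally show "char D \<xi> = \<psi> t x \<xi>" by (simp add: \<psi>_def)
  qed
  have "char D \<xi> = (\<integral>y. p t x y *\<^sub>R iexp (\<xi> * y) \<partial>lborel)"
    unfolding char_def D by (rule integral_density) (auto simp: n)
  then show "\<psi> t x \<xi> = (\<integral>y. complex_of_real (p t x y) * iexp (\<xi> * y) \<partial>lborel)"
    unfolding ch by (simp add: scaleR_conv_of_real)
  show "AE y in lborel. p t x y = Re (inverse_fourier (\<psi> t x) y)"
    using D.AE_density_eq_inverse_fourier[OF m n D] integrable_\<psi>[OF t] unfolding ch by auto
qed

text \<open>A function that is not integrable has Bochner integral \<open>0\<close>, so the
  inequality holds in that case too. It lets the squared transforms be handled by nonnegative
  integrals, with no integrability to check.\<close>

lemma ennreal_integral_le_nn_integral: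
  fixes f :: "'c \<Rightarrow> real"
  assumes "\<And>x. 0 \<le> f x"
  shows "ennreal (\<integral>x. f x \<partial>M) \<le> (\<integral>\<^sup>+x. ennreal (f x) \<partial>M)"
  using assms by (cases "integrable M f") (simp_all add: nn_integral_eq_integral not_integrable_integral_eq)

section \<open>Plancherel bounds for the kernel and its time increments\<close>

lemma plancherel_p:
  assumes "0 < t"
  shows "(\<integral>\<^sup>+y. ennreal ((p t x y)\<^sup>2) \<partial>lborel) \<le> (\<integral>\<^sup>+\<xi>. ennreal ((cmod (\<phi> t \<xi>))\<^sup>2 / (2 * pi)) \<partial>lborel)"
proof -
  have "(\<integral>\<^sup>+y. ennreal ((p t x y)\<^sup>2) \<partial>lborel) = ennreal ((\<integral>\<xi>. (cmod (\<psi> t x \<xi>))\<^sup>2 \<partial>lborel) / (2 * pi))"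
    by (rule plancherel[OF _ integrable_\<psi>[OF assms] \<psi>_eq[OF assms] p_inverse_fourier[OF assms]])
       (use p_has_integral[OF assms] in \<open>simp add: has_bochner_integral_iff\<close>)
  also have "\<dots> = ennreal (\<integral>\<xi>. (cmod (\<phi> t \<xi>))\<^sup>2 / (2 * pi) \<partial>lborel)"
    by (simp add: \<psi>_def norm_mult)
  also have "\<dots> \<le> (\<integral>\<^sup>+\<xi>. ennreal ((cmod (\<phi> t \<xi>))\<^sup>2 / (2 * pi)) \<partial>lborel)"
    by (rule ennreal_integral_le_nn_integral) simp
  finally show ?thesis .
qed

lemma plancherel_p_diff:
  assumes t: "0 < t" "0 < t'"
  shows "(\<integral>\<^sup>+y. ennreal ((p t x y - p t' x y)\<^sup>2) \<partial>lborel) \<le>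
    (\<integral>\<^sup>+\<xi>. ennreal ((cmod (\<phi> t \<xi> - \<phi> t' \<xi>))\<^sup>2 / (2 * pi)) \<partial>lborel)"
proof -
  let ?\<psi> = "\<lambda>\<xi>. \<psi> t x \<xi> - \<psi> t' x \<xi>"
  have ip: "integrable lborel (p t x)" "integrable lborel (p t' x)"
    using p_has_integral t by (auto simp: has_bochner_integral_iff)
  have m: "p t x \<in> borel_measurable borel" "p t' x \<in> borel_measurable borel"
    using p_measurable t by auto
  have ii: "integrable lborel (\<lambda>y. complex_of_real (p s x y) * iexp (\<xi> * y))" if "0 < s" for s \<xi>
  proof (rule Bochner_Integration.integrable_bound)
    show "integrable lborel (p s x)" using p_has_integral[OF that] by (simp add: has_bochner_integral_iff)
    show "AE y in lborel. norm (complex_of_real (p s x y) * iexp (\<xi> * y)) \<le> norm (p s x y)"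
      by (simp add: norm_mult)
  qed (use p_measurable[OF that] in measurable)
  have if': "inverse_fourier ?\<psi> y = inverse_fourier (\<psi> t x) y - inverse_fourier (\<psi> t' x) y" for y
  proof -
    have i: "integrable lborel (\<lambda>s. iexp (- (s * y)) * \<psi> t0 x s)" if "0 < t0" for t0
      by (rule Bochner_Integration.integrable_bound[OF integrable_\<psi>[OF that, of x]])
         (use that in \<open>auto simp: norm_mult\<close>)
    show ?thesis
      unfolding inverse_fourier_def right_diff_distrib
      by (subst Bochner_Integration.integral_diff[OF i i]) (auto simp: t diff_divide_distrib)
  qed
  have "(\<integral>\<^sup>+y. ennreal ((p t x y - p t' x y)\<^sup>2) \<partial>lborel) = ennreal ((\<integral>\<xi>. (cmod (?\<psi> \<xi>))\<^sup>2 \<partial>lborel) / (2 * pi))"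
  proof (rule plancherel)
    show "?\<psi> \<xi> = (\<integral>y. complex_of_real (p t x y - p t' x y) * iexp (\<xi> * y) \<partial>lborel)" for \<xi>
      using \<psi>_eq[OF t(1), of x \<xi>] \<psi>_eq[OF t(2), of x \<xi>] ii[OF t(1)] ii[OF t(2)]
      by (simp add: left_diff_distrib)
    show "AE y in lborel. p t x y - p t' x y = Re (inverse_fourier ?\<psi> y)"
      using p_inverse_fourier[OF t(1), of x] p_inverse_fourier[OF t(2), of x]
      by eventually_elim (simp add: if')
  qed (use ip integrable_\<psi> t in auto)
  also have "\<dots> = ennreal (\<integral>\<xi>. (cmod (\<phi> t \<xi> - \<phi> t' \<xi>))\<^sup>2 / (2 * pi) \<partial>lborel)"
    by (simp add: \<psi>_def norm_mult flip: right_diff_distrib)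
  also have "\<dots> \<le> (\<integral>\<^sup>+\<xi>. ennreal ((cmod (\<phi> t \<xi> - \<phi> t' \<xi>))\<^sup>2 / (2 * pi)) \<partial>lborel)"
    by (rule ennreal_integral_le_nn_integral) simp
  finally show ?thesis .
qed

text \<open>The Plancherel integral of the kernel increment at time \<open>s\<close>. Before
  \<open>t1\<close> both kernels are present and multiplicativity of \<open>\<phi>\<close> factors
  out \<open>\<phi> (t2 - t1) \<xi> - 1\<close>; from \<open>t1\<close> on only the later kernel is
  left. The expression is explicit, hence measurable, in \<open>s\<close>, as the kernels need not
  be.\<close>

definition dens_bound :: "real \<Rightarrow> real \<Rightarrow> real \<Rightarrow> ennreal" where
  "dens_bound t1 t2 s = (\<integral>\<^sup>+\<xi>. ennreal ((if s < t1 then exp (- (2 * (t1 - s) * r \<xi>)) * (cmod (\<phi> (t2 - t1) \<xi> - 1))\<^sup>2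
     else exp (- (2 * (t2 - s) * r \<xi>))) / (2 * pi)) \<partial>lborel)"

lemma dens_bound_measurable [measurable]: "t1 \<le> t2 \<Longrightarrow> dens_bound t1 t2 \<in> borel_measurable borel"
  unfolding dens_bound_def[abs_def] by measurable

lemma kernel_le_dens_bound:
  assumes t: "0 < t1" "t1 < t2" and s: "0 < s" "s < t2"
  shows "(\<integral>\<^sup>+y. ennreal ((indicator {0<..<t2} s * p (t2 - s) x y - indicator {0<..<t1} s * p (t1 - s) x y)\<^sup>2) \<partial>lborel)
    \<le> dens_bound t1 t2 s"
proof (cases "s < t1")
  case True
  have "(cmod (\<phi> (t2 - s) \<xi> - \<phi> (t1 - s) \<xi>))\<^sup>2 = exp (- (2 * (t1 - s) * r \<xi>)) * (cmod (\<phi> (t2 - t1) \<xi> - 1))\<^sup>2" for \<xi>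
  proof -
    have "\<phi> (t2 - s) \<xi> - \<phi> (t1 - s) \<xi> = \<phi> (t1 - s) \<xi> * (\<phi> (t2 - t1) \<xi> - 1)"
      using \<phi>_add[of "t1 - s" "t2 - t1" \<xi>] by (simp add: algebra_simps)
    then show ?thesis
      by (simp add: norm_mult power_mult_distrib norm_\<phi> flip: exp_double)
  qed
  then show ?thesis
    using plancherel_p_diff[of "t2 - s" "t1 - s" x] True s by (simp add: dens_bound_def)
next
  case False
  have "(cmod (\<phi> (t2 - s) \<xi>))\<^sup>2 = exp (- (2 * (t2 - s) * r \<xi>))" for \<xi>
    by (simp add: norm_\<phi> flip: exp_double)
  then show ?thesis
    using plancherel_p[of "t2 - s" x] False s by (simp add: dens_bound_def)
qed

text \<open>The integrand is at most \<open>1\<close>, which gives the length of the interval. For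
  the other bound the decay rate \<open>2 * r \<xi>\<close>, which may vanish, is raised by
  \<open>1\<close>; the factor \<open>exp T\<close> pays for this because
  \<open>b - s \<le> T\<close>.\<close>

lemma exp_time_integral:
  assumes "0 \<le> a" "a \<le> b" "b \<le> T"
  shows "(\<integral>\<^sup>+s. ennreal (exp (- (2 * (b - s) * r \<xi>))) * indicator {a..b} s \<partial>lborel) \<le> ennreal (min (b - a) (exp T * weight \<xi>))"
proof -
  have k: "0 < 1 + 2 * r \<xi>" using r_nonneg[of \<xi>] by simp
  have "(\<integral>\<^sup>+s. ennreal (exp (- (2 * (b - s) * r \<xi>))) * indicator {a..b} s \<partial>lborel) \<le> (\<integral>\<^sup>+s. indicator {a..b} s \<partial>lborel)"
    using r_nonneg[of \<xi>] by (intro nn_integral_mono) (auto simp: indicator_def)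
  also have "\<dots> = ennreal (b - a)"
    using assms by simp
  finally have 1: "(\<integral>\<^sup>+s. ennreal (exp (- (2 * (b - s) * r \<xi>))) * indicator {a..b} s \<partial>lborel) \<le> ennreal (b - a)" .
  have "(\<integral>\<^sup>+s. ennreal (exp (- (2 * (b - s) * r \<xi>))) * indicator {a..b} s \<partial>lborel)
      \<le> (\<integral>\<^sup>+s. ennreal (exp T) * (ennreal (exp (- ((1 + 2 * r \<xi>) * (b - s)))) * indicator {a..b} s) \<partial>lborel)"
  proof (rule nn_integral_mono)
    fix s
    show "ennreal (exp (- (2 * (b - s) * r \<xi>))) * indicator {a..b} s
       \<le> ennreal (exp T) * (ennreal (exp (- ((1 + 2 * r \<xi>) * (b - s)))) * indicator {a..b} s)"
    proof (cases "s \<in> {a..b}")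
      case True
      have "exp (- (2 * (b - s) * r \<xi>)) \<le> exp (T + - ((1 + 2 * r \<xi>) * (b - s)))"
        using True assms by (simp add: algebra_simps)
      then have "exp (- (2 * (b - s) * r \<xi>)) \<le> exp T * exp (- ((1 + 2 * r \<xi>) * (b - s)))"
        by (simp only: exp_add)
      then show ?thesis
        using True by (simp flip: ennreal_mult')
    qed simp
  qed
  also have "\<dots> = ennreal (exp T) * (\<integral>\<^sup>+s. ennreal (exp (- ((1 + 2 * r \<xi>) * (b - s)))) * indicator {a..b} s \<partial>lborel)"
    by (rule nn_integral_cmult) measurable
  also have "\<dots> \<le> ennreal (exp T) * ennreal (1 / (1 + 2 * r \<xi>))"
    by (intro mult_left_mono nn_integral_exp_decay_le assms k) simp
  also have "\<dots> = ennreal (exp T * weight \<xi>)"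
    by (simp add: weight_def flip: ennreal_mult')
  finally show ?thesis
    using 1 by (auto simp: min_def)
qed

text \<open>The first summand comes from the times before \<open>t1\<close>, the \<open>min\<close>
  from the last stretch of length \<open>\<delta>\<close>: its first entry makes it vanish in the
  limit, its second makes it integrable over frequencies. The denominator is the one from
  Plancherel's identity.\<close>

definition freq_bound :: "real \<Rightarrow> real \<Rightarrow> real \<Rightarrow> real" where
  "freq_bound T \<delta> \<xi> = ((cmod (\<phi> \<delta> \<xi> - 1))\<^sup>2 * (exp T * weight \<xi>) + min \<delta> (exp T * weight \<xi>)) / (2 * pi)"

lemma freq_bound_measurable [measurable]: "0 \<le> \<delta> \<Longrightarrow> freq_bound T \<delta> \<in> borel_measurable borel"
  unfolding freq_bound_def[abs_def] by measurable

lemma integral_dens_bound_le: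
  assumes t: "0 < t1" "t1 < t2" "t2 \<le> T"
  shows "(\<integral>\<^sup>+s. dens_bound t1 t2 s * indicator {0<..<t2} s \<partial>lborel) \<le> (\<integral>\<^sup>+\<xi>. ennreal (freq_bound T (t2 - t1) \<xi>) \<partial>lborel)"
proof -
  let ?\<delta> = "t2 - t1"
  let ?B = "\<lambda>s \<xi>. ennreal ((if s < t1 then exp (- (2 * (t1 - s) * r \<xi>)) * (cmod (\<phi> ?\<delta> \<xi> - 1))\<^sup>2
     else exp (- (2 * (t2 - s) * r \<xi>))) / (2 * pi))"
  have [measurable]: "\<phi> ?\<delta> \<in> borel_measurable borel" using t by (intro \<phi>_measurable) simp
  have "(\<integral>\<^sup>+s. dens_bound t1 t2 s * indicator {0<..<t2} s \<partial>lborel)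
     = (\<integral>\<^sup>+s. \<integral>\<^sup>+\<xi>. ?B s \<xi> * indicator {0<..<t2} s \<partial>lborel \<partial>lborel)"
    unfolding dens_bound_def by (subst nn_integral_multc) auto
  also have "\<dots> = (\<integral>\<^sup>+\<xi>. \<integral>\<^sup>+s. ?B s \<xi> * indicator {0<..<t2} s \<partial>lborel \<partial>lborel)"
    by (rule lborel_pair.Fubini'[symmetric]) measurable
  also have "\<dots> \<le> (\<integral>\<^sup>+\<xi>. ennreal (freq_bound T ?\<delta> \<xi>) \<partial>lborel)"
  proof (rule nn_integral_mono)
    fix \<xi>
    let ?c = "(cmod (\<phi> ?\<delta> \<xi> - 1))\<^sup>2"
    let ?E = "\<lambda>a b s. ennreal (exp (- (2 * (b - s) * r \<xi>))) * indicator {a..b} s"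
    have "(\<integral>\<^sup>+s. ?B s \<xi> * indicator {0<..<t2} s \<partial>lborel)
       \<le> (\<integral>\<^sup>+s. ennreal (?c / (2 * pi)) * ?E 0 t1 s + ennreal (1 / (2 * pi)) * ?E t1 t2 s \<partial>lborel)"
      by (intro nn_integral_mono) (auto simp: indicator_def mult.commute simp flip: ennreal_mult')
    also have "\<dots> = ennreal (?c / (2 * pi)) * (\<integral>\<^sup>+s. ?E 0 t1 s \<partial>lborel) + ennreal (1 / (2 * pi)) * (\<integral>\<^sup>+s. ?E t1 t2 s \<partial>lborel)"
      by (subst nn_integral_add) (auto simp: nn_integral_cmult)
    also have "\<dots> \<le> ennreal (?c / (2 * pi)) * ennreal (exp T * weight \<xi>) + ennreal (1 / (2 * pi)) * ennreal (min ?\<delta> (exp T * weight \<xi>))"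
    proof (intro add_mono mult_left_mono)
      have "(\<integral>\<^sup>+s. ?E 0 t1 s \<partial>lborel) \<le> ennreal (min (t1 - 0) (exp T * weight \<xi>))"
        using t by (intro exp_time_integral) auto
      also have "\<dots> \<le> ennreal (exp T * weight \<xi>)" by (intro ennreal_leI) simp
      finally show "(\<integral>\<^sup>+s. ?E 0 t1 s \<partial>lborel) \<le> ennreal (exp T * weight \<xi>)" .
      show "(\<integral>\<^sup>+s. ?E t1 t2 s \<partial>lborel) \<le> ennreal (min ?\<delta> (exp T * weight \<xi>))"
        using t by (intro exp_time_integral) auto
    qed auto
    also have "\<dots> = ennreal (freq_bound T ?\<delta> \<xi>)"
      using t weight_nonneg[of \<xi>] unfolding freq_bound_def
      by (simp add: add_divide_distrib flip: ennreal_mult' ennreal_plus)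
    finally show "(\<integral>\<^sup>+s. ?B s \<xi> * indicator {0<..<t2} s \<partial>lborel) \<le> ennreal (freq_bound T ?\<delta> \<xi>)" .
  qed
  finally show ?thesis .
qed

lemma integral_freq_bound_tendsto:
  assumes \<delta>: "\<And>n. 0 < \<delta> n" "\<delta> \<longlonglongrightarrow> 0"
  shows "(\<lambda>n. \<integral>\<^sup>+\<xi>. ennreal (freq_bound T (\<delta> n) \<xi>) \<partial>lborel) \<longlonglongrightarrow> 0"
proof -
  have m: "\<phi> (\<delta> n) \<in> borel_measurable borel" for n
    using \<delta>(1)[of n] by (intro \<phi>_measurable) simp
  have mf: "freq_bound T (\<delta> n) \<in> borel_measurable borel" for n
    using \<delta>(1)[of n] by (intro freq_bound_measurable) simp
  \<comment> \<open>The majorant has the factor \<open>5\<close> because the squared modulus of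
    \<open>\<phi> (\<delta> n) \<xi> - 1\<close> is at most \<open>4\<close> and the
    \<open>min\<close> adds one more multiple of the weight; the denominator \<open>2 * pi\<close>
    exceeds \<open>1\<close> and is dropped.\<close>
  have "(\<lambda>n. \<integral>\<^sup>+\<xi>. ennreal (freq_bound T (\<delta> n) \<xi>) \<partial>lborel) \<longlonglongrightarrow> (\<integral>\<^sup>+\<xi>. 0 \<partial>(lborel :: real measure))"
  proof (rule nn_integral_dominated_convergence[where w = "\<lambda>\<xi>. ennreal (5 * exp T * weight \<xi>)"])
    show "(\<integral>\<^sup>+\<xi>. ennreal (5 * exp T * weight \<xi>) \<partial>lborel) < \<infinity>"
      using nn_integral_weight by (simp add: ennreal_mult' nn_integral_cmult ennreal_mult_less_top)
    fix n
    show "AE \<xi> in lborel. ennreal (freq_bound T (\<delta> n) \<xi>) \<le> ennreal (5 * exp T * weight \<xi>)"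
    proof (intro AE_I2 ennreal_leI)
      fix \<xi>
      have "cmod (\<phi> (\<delta> n) \<xi> - 1) \<le> 2"
        using norm_triangle_ineq4[of "\<phi> (\<delta> n) \<xi>" 1] norm_\<phi>_le_1[of "\<delta> n" \<xi>] \<delta>(1)[of n] by simp
      then have "(cmod (\<phi> (\<delta> n) \<xi> - 1))\<^sup>2 \<le> 2\<^sup>2"
        by (intro power_mono) auto
      then have "(cmod (\<phi> (\<delta> n) \<xi> - 1))\<^sup>2 * (exp T * weight \<xi>) \<le> 4 * (exp T * weight \<xi>)"
        using weight_nonneg by (intro mult_right_mono) auto
      then have "(cmod (\<phi> (\<delta> n) \<xi> - 1))\<^sup>2 * (exp T * weight \<xi>) + min (\<delta> n) (exp T * weight \<xi>) \<le> 5 * exp T * weight \<xi>" (is "?l \<le> ?r")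
        by linarith
      also have "?r = ?r * 1" by simp
      also have "\<dots> \<le> ?r * (2 * pi)"
        using pi_gt3 weight_nonneg[of \<xi>] by (intro mult_left_mono) auto
      finally show "freq_bound T (\<delta> n) \<xi> \<le> ?r"
        unfolding freq_bound_def by (simp only: pos_divide_le_eq[of "2 * pi"] pi_gt_zero mult_pos_pos zero_less_numeral)
    qed
  next
    show "AE \<xi> in lborel. (\<lambda>n. ennreal (freq_bound T (\<delta> n) \<xi>)) \<longlonglongrightarrow> 0"
    proof (rule AE_I2)
      fix \<xi>
      have "(\<lambda>n. \<phi> (\<delta> n) \<xi>) \<longlonglongrightarrow> exp (- (complex_of_real 0 * \<Psi> \<xi>))"
        unfolding \<phi>_def by (intro tendsto_intros \<delta>)
      then have "(\<lambda>n. freq_bound T (\<delta> n) \<xi>) \<longlonglongrightarrow> ((cmod (1 - 1))\<^sup>2 * (exp T * weight \<xi>) + min 0 (exp T * weight \<xi>)) / (2 * pi)"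
        unfolding freq_bound_def by (intro tendsto_intros \<delta>) auto
      also have "((cmod (1 - 1))\<^sup>2 * (exp T * weight \<xi>) + min 0 (exp T * weight \<xi>)) / (2 * pi) = 0"
        using weight_nonneg[of \<xi>] by simp
      finally show "(\<lambda>n. ennreal (freq_bound T (\<delta> n) \<xi>)) \<longlonglongrightarrow> 0"
        by (metis ennreal_0 tendsto_ennrealI)
    qed
  qed (use mf in auto)
  then show ?thesis by simp
qed

text \<open>Scheffe's lemma turns pointwise convergence of the densities into convergence in \<open>L\<^sup>1\<close>.\<close>

lemma semigroup_continuous:
  assumes u0: "u0 \<in> borel_measurable borel" "\<And>x. \<bar>u0 x\<bar> \<le> C"
    and \<tau>: "0 < \<tau>" "\<And>n. \<tau> \<le> t n" and lim: "t \<longlonglongrightarrow> t0"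
  shows "(\<lambda>n. \<integral>y. p (t n) x y * u0 y \<partial>lborel) \<longlonglongrightarrow> (\<integral>y. p t0 x y * u0 y \<partial>lborel)"
proof -
  have t0: "0 < t0"
    using LIMSEQ_le_const[OF lim] \<tau> by (meson less_le_trans)
  have tn: "0 < t n" for n using \<tau> by (meson less_le_trans)
  note [measurable] = u0(1)
  have [measurable]: "p t0 x \<in> borel_measurable borel" "\<And>n. p (t n) x \<in> borel_measurable borel"
    using p_measurable t0 tn by auto
  have ip: "integrable lborel (p t0 x)" "\<And>n. integrable lborel (p (t n) x)"
    using p_has_integral t0 tn by (auto simp: has_bochner_integral_iff)
  \<comment> \<open>Keeping the times above \<open>\<tau>\<close> supplies the dominating function:
    the modulus of \<open>\<phi>\<close> decreases in time, so its value at \<open>\<tau>\<close>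
    bounds the whole sequence.\<close>
  have if': "(\<lambda>n. inverse_fourier (\<psi> (t n) x) y) \<longlonglongrightarrow> inverse_fourier (\<psi> t0 x) y" for y
    unfolding inverse_fourier_def
  proof (intro tendsto_divide tendsto_const integral_dominated_convergence[where w = "\<lambda>\<xi>. (1 + 2 / \<tau>) * weight \<xi>"])
    show "integrable lborel (\<lambda>\<xi>. (1 + 2 / \<tau>) * weight \<xi>)" using integrable_weight by auto
    show "AE \<xi> in lborel. (\<lambda>n. iexp (- (\<xi> * y)) * \<psi> (t n) x \<xi>) \<longlonglongrightarrow> iexp (- (\<xi> * y)) * \<psi> t0 x \<xi>"
      unfolding \<psi>_def \<phi>_def by (intro AE_I2 tendsto_intros lim)
    fix n
    show "AE \<xi> in lborel. norm (iexp (- (\<xi> * y)) * \<psi> (t n) x \<xi>) \<le> (1 + 2 / \<tau>) * weight \<xi>"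
    proof (rule AE_I2)
      fix \<xi>
      have "norm (iexp (- (\<xi> * y)) * \<psi> (t n) x \<xi>) = exp (- (t n * r \<xi>))"
        by (simp add: \<psi>_def norm_mult norm_\<phi>)
      also have "\<dots> \<le> exp (- (\<tau> * r \<xi>))"
        using \<tau>(2)[of n] r_nonneg[of \<xi>] by (simp add: mult_right_mono)
      also have "\<dots> \<le> (1 + 2 / \<tau>) * weight \<xi>"
        using norm_\<phi>_le_weight[OF \<tau>(1), of \<xi>] by (simp add: norm_\<phi>)
      finally show "norm (iexp (- (\<xi> * y)) * \<psi> (t n) x \<xi>) \<le> (1 + 2 / \<tau>) * weight \<xi>" .
    qed
    show "(\<lambda>\<xi>. iexp (- (\<xi> * y)) * \<psi> (t n) x \<xi>) \<in> borel_measurable lborel"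
      using tn[of n] by simp
  next
    show "(\<lambda>\<xi>. iexp (- (\<xi> * y)) * \<psi> t0 x \<xi>) \<in> borel_measurable lborel"
      using t0 by simp
  qed simp
  \<comment> \<open>Inversion holds outside a null set that depends on the time. A sequence of times
    meets only countably many of them, which is why continuity is proved along sequences.\<close>
  have "AE y in lborel. \<forall>n. p (t n) x y = Re (inverse_fourier (\<psi> (t n) x) y)"
    unfolding AE_all_countable using p_inverse_fourier tn by blast
  then have conv: "AE y in lborel. (\<lambda>n. p (t n) x y) \<longlonglongrightarrow> p t0 x y"
    using p_inverse_fourier[OF t0, of x]
    by eventually_elim (simp add: tendsto_Re if')
  have one: "(\<integral>\<^sup>+y. ennreal (norm (p s x y)) \<partial>lborel) = 1" if "0 < s" for s
    using p_has_integral[OF that, of x] p_nonneg[OF that]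
    by (subst nn_integral_eq_integral) (auto simp: has_bochner_integral_iff)
  have L1: "(\<lambda>n. \<integral>\<^sup>+y. ennreal (norm (p (t n) x y - p t0 x y)) \<partial>lborel) \<longlonglongrightarrow> 0"
    by (rule Scheffe_lemma2[OF _ ip(1) conv]) (measurable, simp only: one[OF tn] one[OF t0] order_refl)
  have C: "0 \<le> C" using u0(2)[of 0] by simp
  have iu: "integrable lborel (\<lambda>y. p s x y * u0 y)" if "0 < s" for s
  proof (rule Bochner_Integration.integrable_bound)
    show "integrable lborel (\<lambda>y. C * p s x y)" using p_has_integral[OF that] by (auto simp: has_bochner_integral_iff)
    show "AE y in lborel. norm (p s x y * u0 y) \<le> norm (C * p s x y)"
      using u0(2) C p_nonneg[OF that] by (auto simp: abs_mult mult.commute intro!: mult_right_mono)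
  qed (use p_measurable[OF that] in measurable)
  have "(\<lambda>n. ennreal (norm ((\<integral>y. p (t n) x y * u0 y \<partial>lborel) - (\<integral>y. p t0 x y * u0 y \<partial>lborel)))) \<longlonglongrightarrow> 0"
  proof (rule tendsto_sandwich[OF _ _ tendsto_const])
    show "\<forall>\<^sub>F n in sequentially. ennreal (norm ((\<integral>y. p (t n) x y * u0 y \<partial>lborel) - (\<integral>y. p t0 x y * u0 y \<partial>lborel)))
      \<le> ennreal C * (\<integral>\<^sup>+y. ennreal (norm (p (t n) x y - p t0 x y)) \<partial>lborel)"
    proof (intro always_eventually allI)
      fix n
      have "(\<integral>y. p (t n) x y * u0 y \<partial>lborel) - (\<integral>y. p t0 x y * u0 y \<partial>lborel) = (\<integral>y. (p (t n) x y - p t0 x y) * u0 y \<partial>lborel)"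
        using iu[OF tn[of n]] iu[OF t0] by (simp add: left_diff_distrib)
      also have "ennreal (norm \<dots>) \<le> (\<integral>\<^sup>+y. ennreal (norm ((p (t n) x y - p t0 x y) * u0 y)) \<partial>lborel)"
        using iu[OF tn[of n]] iu[OF t0] by (intro integral_norm_bound_ennreal) (auto simp: left_diff_distrib)
      also have "\<dots> \<le> (\<integral>\<^sup>+y. ennreal C * ennreal (norm (p (t n) x y - p t0 x y)) \<partial>lborel)"
        using C u0(2) by (intro nn_integral_mono) (auto simp: abs_mult mult.commute simp flip: ennreal_mult' intro!: ennreal_leI mult_right_mono)
      also have "\<dots> = ennreal C * (\<integral>\<^sup>+y. ennreal (norm (p (t n) x y - p t0 x y)) \<partial>lborel)"
        by (rule nn_integral_cmult) measurable
      finally show "ennreal (norm ((\<integral>y. p (t n) x y * u0 y \<partial>lborel) - (\<integral>y. p t0 x y * u0 y \<partial>lborel)))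
        \<le> ennreal C * (\<integral>\<^sup>+y. ennreal (norm (p (t n) x y - p t0 x y)) \<partial>lborel)" .
    qed
    show "(\<lambda>n. ennreal C * (\<integral>\<^sup>+y. ennreal (norm (p (t n) x y - p t0 x y)) \<partial>lborel)) \<longlonglongrightarrow> 0"
      using ennreal_tendsto_cmult[OF _ L1, of "ennreal C"] by simp
  qed auto
  then have "(\<lambda>n. norm ((\<integral>y. p (t n) x y * u0 y \<partial>lborel) - (\<integral>y. p t0 x y * u0 y \<partial>lborel))) \<longlonglongrightarrow> 0"
    by (subst (asm) ennreal_tendsto_0_iff) auto
  then show ?thesis
    by (rule LIM_zero_cancel[OF tendsto_norm_zero_cancel])
qed

end

section \<open>Mean-square continuity\<close>

text \<open>With \<open>c = a - b\<close>, the difference of squares is at most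
  \<open>c\<^sup>2 + 2 * \<bar>b * c\<bar>\<close>. Young's inequality with weight
  \<open>e = sqrt d\<close> splits the mixed term into \<open>e * b\<^sup>2\<close> and
  \<open>c\<^sup>2 / e\<close>; the latter integrates to \<open>d / e = e\<close>, whence the
  summand \<open>1\<close>. The case \<open>d = 0\<close> is separate because of the
  division.\<close>

lemma second_moment_diff_le:
  fixes a b :: "'a \<Rightarrow> real"
  assumes [measurable]: "a \<in> borel_measurable M" "b \<in> borel_measurable M"
    and ia: "integrable M (\<lambda>x. (a x)\<^sup>2)" and ib: "integrable M (\<lambda>x. (b x)\<^sup>2)"
  defines "d \<equiv> \<integral>x. (a x - b x)\<^sup>2 \<partial>M"
  shows "\<bar>(\<integral>x. (a x)\<^sup>2 \<partial>M) - (\<integral>x. (b x)\<^sup>2 \<partial>M)\<bar> \<le> d + sqrt d * ((\<integral>x. (b x)\<^sup>2 \<partial>M) + 1)"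
proof -
  have id: "integrable M (\<lambda>x. (a x - b x)\<^sup>2)"
  proof (rule Bochner_Integration.integrable_bound)
    show "integrable M (\<lambda>x. 2 * (a x)\<^sup>2 + 2 * (b x)\<^sup>2)" using ia ib by auto
    show "AE x in M. norm ((a x - b x)\<^sup>2) \<le> norm (2 * (a x)\<^sup>2 + 2 * (b x)\<^sup>2)"
    proof (rule AE_I2)
      fix x
      have "0 \<le> (a x + b x)\<^sup>2" by simp
      then have "(a x - b x)\<^sup>2 \<le> 2 * (a x)\<^sup>2 + 2 * (b x)\<^sup>2"
        by (simp add: power2_eq_square algebra_simps)
      then show "norm ((a x - b x)\<^sup>2) \<le> norm (2 * (a x)\<^sup>2 + 2 * (b x)\<^sup>2)"
        by simp
    qed
  qed measurable
  have d0: "0 \<le> d" unfolding d_def by simp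
  show ?thesis
  proof (cases "d = 0")
    case True
    then have "AE x in M. (a x - b x)\<^sup>2 = 0"
      unfolding d_def using id by (subst (asm) integral_nonneg_eq_0_iff_AE) auto
    then have "(\<integral>x. (a x)\<^sup>2 \<partial>M) = (\<integral>x. (b x)\<^sup>2 \<partial>M)"
      by (intro integral_cong_AE) (auto elim: eventually_mono)
    then show ?thesis using True by simp
  next
    case False
    define e where "e = sqrt d"
    have e: "0 < e" "d = e * e" using False d0 by (auto simp: e_def)
    have pt: "\<bar>(a x)\<^sup>2 - (b x)\<^sup>2\<bar> \<le> (a x - b x)\<^sup>2 + (e * (b x)\<^sup>2 + (a x - b x)\<^sup>2 / e)" for x
    proof -
      let ?c = "a x - b x"
      have "0 \<le> (e * \<bar>b x\<bar> - \<bar>?c\<bar>)\<^sup>2" by simp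
      then have "2 * \<bar>b x * ?c\<bar> * e \<le> e * e * (b x)\<^sup>2 + ?c\<^sup>2"
        by (simp add: power2_diff abs_mult power_mult_distrib) (simp add: power2_eq_square algebra_simps)
      then have "2 * \<bar>b x * ?c\<bar> \<le> (e * e * (b x)\<^sup>2 + ?c\<^sup>2) / e"
        using e by (simp add: pos_le_divide_eq)
      then have *: "2 * \<bar>b x * ?c\<bar> \<le> e * (b x)\<^sup>2 + ?c\<^sup>2 / e"
        using e by (simp add: add_divide_distrib)
      have "(a x)\<^sup>2 - (b x)\<^sup>2 = ?c\<^sup>2 + 2 * (b x * ?c)"
        by (simp add: power2_eq_square algebra_simps)
      then have "\<bar>(a x)\<^sup>2 - (b x)\<^sup>2\<bar> \<le> ?c\<^sup>2 + 2 * \<bar>b x * ?c\<bar>"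
        by (simp only: abs_le_iff) (smt (verit) zero_le_power2)
      with * show ?thesis by linarith
    qed
    have "\<bar>(\<integral>x. (a x)\<^sup>2 \<partial>M) - (\<integral>x. (b x)\<^sup>2 \<partial>M)\<bar> = \<bar>\<integral>x. (a x)\<^sup>2 - (b x)\<^sup>2 \<partial>M\<bar>"
      using ia ib by simp
    also have "\<dots> \<le> (\<integral>x. \<bar>(a x)\<^sup>2 - (b x)\<^sup>2\<bar> \<partial>M)"
      by (rule integral_abs_bound)
    also have "\<dots> \<le> (\<integral>x. (a x - b x)\<^sup>2 + (e * (b x)\<^sup>2 + (a x - b x)\<^sup>2 / e) \<partial>M)"
      using ia ib id by (intro integral_mono pt) auto
    also have "\<dots> = d + (e * (\<integral>x. (b x)\<^sup>2 \<partial>M) + d / e)"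
      using ib id by (simp add: d_def)
    also have "\<dots> = d + e * ((\<integral>x. (b x)\<^sup>2 \<partial>M) + 1)"
      using e by (simp add: algebra_simps)
    finally show ?thesis by (simp add: e_def)
  qed
qed

text \<open>As in Markov's inequality, the sets where \<open>1 \<le> real n * f x\<close> have
  finite measure, and positivity of \<open>f\<close> makes them exhaust the space.\<close>

lemma sigma_finite_of_positive_integrable:
  fixes f :: "'a \<Rightarrow> real"
  assumes f [measurable]: "f \<in> borel_measurable M" "\<And>x. 0 < f x" and int: "(\<integral>\<^sup>+x. ennreal (f x) \<partial>M) < \<infinity>"
  shows "sigma_finite_measure M"
proof
  let ?A = "\<lambda>n::nat. {x\<in>space M. 1 \<le> real n * f x}"
  have "emeasure M (?A n) \<noteq> \<infinity>" for n
  proof -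
    have "emeasure M (?A n) = (\<integral>\<^sup>+x. indicator (?A n) x \<partial>M)"
      by (subst nn_integral_indicator) auto
    also have "\<dots> \<le> (\<integral>\<^sup>+x. ennreal (real n) * ennreal (f x) \<partial>M)"
    proof (rule nn_integral_mono)
      fix x
      show "indicator (?A n) x \<le> ennreal (real n) * ennreal (f x)"
        using ennreal_leI[of 1 "real n * f x"] by (auto simp: indicator_def simp flip: ennreal_mult')
    qed
    also have "\<dots> = ennreal (real n) * (\<integral>\<^sup>+x. ennreal (f x) \<partial>M)"
      by (rule nn_integral_cmult) measurable
    also have "\<dots> < \<infinity>"
      using int by (simp add: ennreal_mult_less_top)
    finally show ?thesis by simp
  qed
  moreover have "(\<Union>n. ?A n) = space M"
  proof (intro equalityI subsetI)
    fix x assume x: "x \<in> space M"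
    obtain n :: nat where "1 / f x < real n" using reals_Archimedean2 by blast
    then have "1 \<le> real n * f x" using f(2)[of x] by (simp add: field_simps)
    then show "x \<in> (\<Union>n. ?A n)" using x by auto
  qed auto
  ultimately show "\<exists>A. countable A \<and> A \<subseteq> sets M \<and> \<Union> A = space M \<and> (\<forall>a\<in>A. emeasure M a \<noteq> \<infinity>)"
    by (intro exI[of _ "range ?A"]) auto
qed

locale field_solution = levy_kernel P X \<Psi> p + poisson_noise M \<nu> N
  for P :: "'b measure" and X \<Psi> p and M :: "'a measure" and \<nu> N +
  fixes u0 :: "real \<Rightarrow> real" and lam :: real and \<sigma> :: "real \<Rightarrow> real \<Rightarrow> real"
    and J :: "real \<Rightarrow> real" and Lip K C :: real
    and u :: "real \<Rightarrow> real \<Rightarrow> 'a \<Rightarrow> real"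
  assumes u0: "u0 \<in> borel_measurable borel" "\<And>x. \<bar>u0 x\<bar> \<le> C"
    and \<sigma>: "\<And>h. (\<lambda>x. \<sigma> x h) \<in> borel_measurable borel"
    and J: "J \<in> borel_measurable borel" "\<And>h. 0 \<le> J h" "(\<integral>\<^sup>+h. ennreal ((J h)\<^sup>2) \<partial>\<nu>) \<le> ennreal K" "0 \<le> K"
    and \<sigma>0: "\<And>h. \<bar>\<sigma> 0 h\<bar> \<le> J h"
    and Lip: "0 \<le> Lip" "\<And>x y h. \<bar>\<sigma> x h - \<sigma> y h\<bar> \<le> J h * Lip * \<bar>x - y\<bar>"
    and sol: "random_field_solution M \<nu> N p u0 lam \<sigma> u"
begin

section \<open>Increments of the solution\<close>

definition semigroup :: "real \<Rightarrow> real \<Rightarrow> real" where "semigroup t x = (\<integral>y. p t x y * u0 y \<partial>lborel)"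

definition sq_dist :: "real \<Rightarrow> real \<Rightarrow> real \<Rightarrow> ennreal" where
  "sq_dist x s t = (\<integral>\<^sup>+\<omega>. ennreal (\<bar>u s x \<omega> - u t x \<omega>\<bar>\<^sup>2) \<partial>M)"

lemma sq_dist_commute: "sq_dist x s t = sq_dist x t s"
  unfolding sq_dist_def by (simp add: abs_minus_commute)

lemma u_measurable: "0 < t \<Longrightarrow> u t x \<in> borel_measurable M"
  using sol unfolding random_field_solution_def mild_solution_def
  by (intro predictable_process_measurable) auto

lemma moment_bound:
  assumes "0 < T"
  obtains U where "0 \<le> U" "\<And>t x. 0 \<le> t \<Longrightarrow> t \<le> T \<Longrightarrow> (\<integral>\<^sup>+\<omega>. ennreal (\<bar>u t x \<omega>\<bar>\<^sup>2) \<partial>M) \<le> ennreal U"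
proof
  let ?s = "SUP t\<in>{0..T}. SUP x. \<integral>\<^sup>+\<omega>. ennreal (\<bar>u t x \<omega>\<bar>\<^sup>2) \<partial>M"
  have "?s < \<infinity>" using sol assms unfolding random_field_solution_def by blast
  then have s: "ennreal (enn2real ?s) = ?s" by simp
  fix t x assume "0 \<le> t" "t \<le> T"
  then have "(\<integral>\<^sup>+\<omega>. ennreal (\<bar>u t x \<omega>\<bar>\<^sup>2) \<partial>M) \<le> ?s"
    by (intro SUP_upper2[of t] SUP_upper2[of x]) auto
  then show "(\<integral>\<^sup>+\<omega>. ennreal (\<bar>u t x \<omega>\<bar>\<^sup>2) \<partial>M) \<le> ennreal (enn2real ?s)"
    unfolding s .
qed simp

text \<open>The constant is chosen before the times and the point, since the second moments of
  \<open>u\<close> enter only through their supremum up to \<open>T\<close>. This uniformity allows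
  either of the two times to vary.\<close>

lemma increment_bound:
  assumes T: "0 < T"
  obtains c where "0 \<le> c" "\<And>t1 t2 x. 0 < t1 \<Longrightarrow> t1 < t2 \<Longrightarrow> t2 \<le> T \<Longrightarrow>
    sq_dist x t2 t1 \<le> ennreal (3 * (semigroup t2 x - semigroup t1 x)\<^sup>2) + ennreal c * (\<integral>\<^sup>+\<xi>. ennreal (freq_bound T (t2 - t1) \<xi>) \<partial>lborel)"
proof -
  obtain U where U: "0 \<le> U" "\<And>t x. 0 \<le> t \<Longrightarrow> t \<le> T \<Longrightarrow> (\<integral>\<^sup>+\<omega>. ennreal (\<bar>u t x \<omega>\<bar>\<^sup>2) \<partial>M) \<le> ennreal U"
    using moment_bound[OF T] by blast
  define k where "k = 2 * (1 + Lip\<^sup>2 * U) * K"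
  have k: "0 \<le> k" using U J by (simp add: k_def)
  \<comment> \<open>The factors of the constant: \<open>3\<close> from splitting the increment,
    \<open>lam\<^sup>2\<close> from the coefficient of the noise, \<open>9\<close> from
    \<open>stoch_integral_diff_bound\<close> and \<open>k\<close> from
    \<open>kernel_sqnorm_bound\<close>.\<close>
  show ?thesis
  proof (rule that[of "3 * lam\<^sup>2 * 9 * k"])
    show "0 \<le> 3 * lam\<^sup>2 * 9 * k" using k by simp
    fix t1 t2 x :: real
    assume t: "0 < t1" "t1 < t2" "t2 \<le> T"
    let ?f = "\<lambda>t \<omega> (s, y, h). indicator {0<..<t} s * (p (t - s) x y * \<sigma> (u s y \<omega>) h)"
    have "\<exists>I. has_stoch_integral M \<nu> N (?f s) I \<and> (AE \<omega> in M. u s x \<omega> = semigroup s x + lam * I \<omega>)" if "0 < s" for s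
      using sol that unfolding random_field_solution_def mild_solution_def semigroup_def by blast
    then obtain I1 I2 where
      I1: "has_stoch_integral M \<nu> N (?f t1) I1" "AE \<omega> in M. u t1 x \<omega> = semigroup t1 x + lam * I1 \<omega>" and
      I2: "has_stoch_integral M \<nu> N (?f t2) I2" "AE \<omega> in M. u t2 x \<omega> = semigroup t2 x + lam * I2 \<omega>"
      using t by (meson less_trans)
    have [measurable]: "I1 \<in> borel_measurable M" "I2 \<in> borel_measurable M"
      using I1 I2 by (auto simp: has_stoch_integral_def)
    \<comment> \<open>Both stochastic integrals run over the whole time axis with the cut-off inside
      the integrand, so their difference again has the form of a single kernel times
      \<open>\<sigma> (u s y \<omega>) h\<close>.\<close>
    let ?\<kappa> = "\<lambda>s y. indicator {0<..<t2} s * p (t2 - s) x y - indicator {0<..<t1} s * p (t1 - s) x y"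
    let ?g = "\<lambda>\<omega> (s, y, h). ?\<kappa> s y * \<sigma> (u s y \<omega>) h"
    have g: "(\<lambda>\<omega> z. ?f t2 \<omega> z - ?f t1 \<omega> z) = ?g"
      by (auto simp: fun_eq_iff algebra_simps)
    have "jointly_measurable ?g"
      unfolding g[symmetric]
      using I1 I2 by (intro jointly_measurable_diff jointly_measurable_predictable) (auto simp: has_stoch_integral_def)
    then have "integrand_sqnorm M \<nu> ?g \<le> ennreal k * (\<integral>\<^sup>+s. dens_bound t1 t2 s * indicator {0<..<t2} s \<partial>lborel)"
      unfolding k_def
    proof (rule kernel_sqnorm_bound[OF _ _ _ u_measurable U(1) _ J \<sigma> \<sigma>0 Lip])
      fix s :: real assume s: "0 < s" "s < t2"
      show "?\<kappa> s \<in> borel_measurable borel"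
        using p_measurable[of "t2 - s" x] p_measurable[of "t1 - s" x] s by (cases "s < t1") auto
      show "(\<integral>\<^sup>+y. ennreal ((?\<kappa> s y)\<^sup>2) \<partial>lborel) \<le> dens_bound t1 t2 s"
        by (rule kernel_le_dens_bound) (use t s in auto)
      fix y show "(\<integral>\<^sup>+\<omega>. ennreal (\<bar>u s y \<omega>\<bar>\<^sup>2) \<partial>M) \<le> ennreal U"
        using s t by (intro U(2)) auto
    next
      show "dens_bound t1 t2 \<in> borel_measurable borel" using t by simp
    qed (use t in auto)
    also have "\<dots> \<le> ennreal k * (\<integral>\<^sup>+\<xi>. ennreal (freq_bound T (t2 - t1) \<xi>) \<partial>lborel)"
      using t by (intro mult_left_mono integral_dens_bound_le) auto
    finally have sq: "integrand_sqnorm M \<nu> ?g \<le> ennreal k * (\<integral>\<^sup>+\<xi>. ennreal (freq_bound T (t2 - t1) \<xi>) \<partial>lborel)" .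
    have "sq_dist x t2 t1 = (\<integral>\<^sup>+\<omega>. ennreal (\<bar>(semigroup t2 x - semigroup t1 x) + lam * (I2 \<omega> - I1 \<omega>) + 0\<bar>\<^sup>2) \<partial>M)"
      unfolding sq_dist_def using I1(2) I2(2)
      by (intro nn_integral_cong_AE) (auto elim!: eventually_elim2 simp: algebra_simps)
    also have "\<dots> \<le> 3 * ((\<integral>\<^sup>+\<omega>. ennreal (\<bar>semigroup t2 x - semigroup t1 x\<bar>\<^sup>2) \<partial>M)
       + (\<integral>\<^sup>+\<omega>. ennreal (\<bar>lam * (I2 \<omega> - I1 \<omega>)\<bar>\<^sup>2) \<partial>M) + (\<integral>\<^sup>+\<omega>. ennreal (\<bar>0\<bar>\<^sup>2) \<partial>M))"
      by (rule nn_integral_sq_sum3_le) auto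
    also have "\<dots> = ennreal (3 * (semigroup t2 x - semigroup t1 x)\<^sup>2) + ennreal (3 * lam\<^sup>2) * (\<integral>\<^sup>+\<omega>. ennreal (\<bar>I2 \<omega> - I1 \<omega>\<bar>\<^sup>2) \<partial>M)"
      by (simp add: power_mult_distrib ennreal_mult' nn_integral_cmult emeasure_space_1 distrib_left mult.assoc)
    also have "(\<integral>\<^sup>+\<omega>. ennreal (\<bar>I2 \<omega> - I1 \<omega>\<bar>\<^sup>2) \<partial>M) \<le> 9 * integrand_sqnorm M \<nu> ?g"
      using stoch_integral_diff_bound[OF I2(1) I1(1)] unfolding g .
    also have "\<dots> \<le> 9 * (ennreal k * (\<integral>\<^sup>+\<xi>. ennreal (freq_bound T (t2 - t1) \<xi>) \<partial>lborel))"
      by (intro mult_left_mono sq) simp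
    finally have "sq_dist x t2 t1 \<le> ennreal (3 * (semigroup t2 x - semigroup t1 x)\<^sup>2) +
        ennreal (3 * lam\<^sup>2) * (9 * (ennreal k * (\<integral>\<^sup>+\<xi>. ennreal (freq_bound T (t2 - t1) \<xi>) \<partial>lborel)))"
      by (simp add: add_left_mono mult_left_mono)
    also have "ennreal (3 * lam\<^sup>2) * (9 * (ennreal k * (\<integral>\<^sup>+\<xi>. ennreal (freq_bound T (t2 - t1) \<xi>) \<partial>lborel)))
       = ennreal (3 * lam\<^sup>2 * 9 * k) * (\<integral>\<^sup>+\<xi>. ennreal (freq_bound T (t2 - t1) \<xi>) \<partial>lborel)"
    proof -
      have "ennreal (3 * lam\<^sup>2 * 9 * k) = ennreal (3 * lam\<^sup>2 * 9) * ennreal k"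
        by (rule ennreal_mult') simp
      also have "ennreal (3 * lam\<^sup>2 * 9) = ennreal (3 * lam\<^sup>2) * ennreal 9"
        by (rule ennreal_mult') simp
      finally show ?thesis by (simp only: mult.assoc ennreal_numeral)
    qed
    finally show "sq_dist x t2 t1 \<le> ennreal (3 * (semigroup t2 x - semigroup t1 x)\<^sup>2)
      + ennreal (3 * lam\<^sup>2 * 9 * k) * (\<integral>\<^sup>+\<xi>. ennreal (freq_bound T (t2 - t1) \<xi>) \<partial>lborel)" .
  qed
qed

text \<open>With the horizon \<open>2 * t0\<close> one constant from \<open>increment_bound\<close>
  serves times on either side of \<open>t0\<close>, the limit point being the later time in one case
  and the earlier in the other. Hence the limit is two-sided.\<close>

lemma mean_square_continuous:
  assumes t0: "0 < t0"
  shows "((\<lambda>t. sq_dist x t t0) \<longlongrightarrow> 0) (at t0)"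
proof -
  obtain c where c: "0 \<le> c" "\<And>t1 t2 x. 0 < t1 \<Longrightarrow> t1 < t2 \<Longrightarrow> t2 \<le> 2 * t0 \<Longrightarrow>
    sq_dist x t2 t1 \<le> ennreal (3 * (semigroup t2 x - semigroup t1 x)\<^sup>2) + ennreal c * (\<integral>\<^sup>+\<xi>. ennreal (freq_bound (2 * t0) (t2 - t1) \<xi>) \<partial>lborel)"
    using increment_bound[of "2 * t0"] t0 by auto
  \<comment> \<open>The lower end keeps the times away from \<open>0\<close>, as
    \<open>semigroup_continuous\<close> requires; the upper end is the horizon. The set is open, so
    restricting to it does not change the limit at \<open>t0\<close>.\<close>
  let ?U = "{t0 / 2<..<2 * t0}"
  have "((\<lambda>t. sq_dist x t t0) \<longlongrightarrow> 0) (at t0 within ?U)"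
    unfolding tendsto_at_iff_sequentially comp_def
  proof (intro allI impI)
    fix Y assume Y: "\<forall>n. Y n \<in> ?U - {t0}" and lim: "Y \<longlonglongrightarrow> t0"
    have \<delta>: "0 < \<bar>Y n - t0\<bar>" for n using Y by auto
    have \<delta>0: "(\<lambda>n. \<bar>Y n - t0\<bar>) \<longlonglongrightarrow> 0"
      using tendsto_rabs_zero[OF LIM_zero[OF lim]] .
    have semigroup_lim: "(\<lambda>n. semigroup (Y n) x) \<longlonglongrightarrow> semigroup t0 x"
      unfolding semigroup_def by (rule semigroup_continuous[OF u0, of "t0 / 2"]) (use Y t0 lim in \<open>auto simp: less_imp_le\<close>)
    let ?R = "\<lambda>n. ennreal (3 * (semigroup (Y n) x - semigroup t0 x)\<^sup>2) + ennreal c * (\<integral>\<^sup>+\<xi>. ennreal (freq_bound (2 * t0) \<bar>Y n - t0\<bar> \<xi>) \<partial>lborel)"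
    have le: "sq_dist x (Y n) t0 \<le> ?R n" for n
    proof (cases "Y n < t0")
      case True
      then show ?thesis
        using c(2)[of "Y n" t0 x] Y[rule_format, of n] t0
        by (simp add: sq_dist_commute[of x "Y n"] power2_commute[of "semigroup t0 x"])
    next
      case False
      then show ?thesis
        using c(2)[of t0 "Y n" x] Y[rule_format, of n] t0 by (simp add: less_le)
    qed
    have "(\<lambda>n. ennreal (3 * (semigroup (Y n) x - semigroup t0 x)\<^sup>2)) \<longlonglongrightarrow> ennreal (3 * (semigroup t0 x - semigroup t0 x)\<^sup>2)"
      by (intro tendsto_intros semigroup_lim)
    moreover have "(\<lambda>n. ennreal c * (\<integral>\<^sup>+\<xi>. ennreal (freq_bound (2 * t0) \<bar>Y n - t0\<bar> \<xi>) \<partial>lborel)) \<longlonglongrightarrow> ennreal c * 0"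
      by (intro ennreal_tendsto_cmult integral_freq_bound_tendsto \<delta> \<delta>0) simp
    ultimately have "?R \<longlonglongrightarrow> ennreal (3 * (semigroup t0 x - semigroup t0 x)\<^sup>2) + ennreal c * 0"
      by (rule tendsto_add)
    then have R: "?R \<longlonglongrightarrow> 0" by simp
    show "(\<lambda>n. sq_dist x (Y n) t0) \<longlonglongrightarrow> 0"
      by (rule tendsto_sandwich[OF _ _ tendsto_const R]) (auto intro!: always_eventually le)
  qed
  then show ?thesis
    using t0 by (subst (asm) at_within_open) auto
qed

lemma mean_square_continuous_real:
  assumes t0: "0 < t0"
  shows "((\<lambda>t. \<integral>\<omega>. (u t x \<omega> - u t0 x \<omega>)\<^sup>2 \<partial>M) \<longlongrightarrow> 0) (at t0)"
proof -
  have "((\<lambda>t. enn2real (sq_dist x t t0)) \<longlongrightarrow> 0) (at t0)"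
    using mean_square_continuous[OF t0] by (intro tendsto_enn2real) auto
  \<comment> \<open>Measurability of \<open>u t x\<close> is available for positive times, so the
    two kinds of integral are identified only near \<open>t0\<close>.\<close>
  moreover have "eventually (\<lambda>t. enn2real (sq_dist x t t0) = (\<integral>\<omega>. (u t x \<omega> - u t0 x \<omega>)\<^sup>2 \<partial>M)) (at t0)"
    using order_tendstoD(1)[OF tendsto_ident_at t0]
  proof eventually_elim
    case (elim t)
    then show ?case
      using u_measurable[of t x] u_measurable[OF t0, of x]
      by (subst integral_eq_nn_integral) (auto simp: sq_dist_def)
  qed
  ultimately show ?thesis
    by (rule Lim_transform_eventually)
qed

lemma integrable_sq:
  assumes t: "0 < t"
  shows "integrable M (\<lambda>\<omega>. (u t x \<omega>)\<^sup>2)"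
proof -
  obtain U where "(\<integral>\<^sup>+\<omega>. ennreal (\<bar>u t x \<omega>\<bar>\<^sup>2) \<partial>M) \<le> ennreal U"
    using moment_bound[OF t] t by (metis less_imp_le order_refl)
  then have "(\<integral>\<^sup>+\<omega>. ennreal ((u t x \<omega>)\<^sup>2) \<partial>M) < \<infinity>"
    by (simp add: le_less_trans[OF _ ennreal_less_top])
  then show ?thesis
    using u_measurable[OF t, of x] by (intro integrableI_nonneg) auto
qed

lemma second_moment_continuous:
  assumes t0: "0 < t0"
  shows "((\<lambda>t. \<integral>\<omega>. (u t x \<omega>)\<^sup>2 \<partial>M) \<longlongrightarrow> (\<integral>\<omega>. (u t0 x \<omega>)\<^sup>2 \<partial>M)) (at t0)"
proof (rule LIM_zero_cancel, rule tendsto_rabs_zero_cancel)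
  let ?d = "\<lambda>t. \<integral>\<omega>. (u t x \<omega> - u t0 x \<omega>)\<^sup>2 \<partial>M" and ?B = "\<integral>\<omega>. (u t0 x \<omega>)\<^sup>2 \<partial>M"
  \<comment> \<open>\<open>?B\<close> belongs to the fixed time \<open>t0\<close>, so the bound of
    \<open>second_moment_diff_le\<close> has a constant factor and vanishes with the mean-square
    distance.\<close>
  have "((\<lambda>t. ?d t + sqrt (?d t) * (?B + 1)) \<longlongrightarrow> 0 + sqrt 0 * (?B + 1)) (at t0)"
    by (intro tendsto_intros mean_square_continuous_real t0)
  then have lim: "((\<lambda>t. ?d t + sqrt (?d t) * (?B + 1)) \<longlongrightarrow> 0) (at t0)"
    by simp
  have le: "eventually (\<lambda>t. \<bar>(\<integral>\<omega>. (u t x \<omega>)\<^sup>2 \<partial>M) - ?B\<bar> \<le> ?d t + sqrt (?d t) * (?B + 1)) (at t0)"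
    using order_tendstoD(1)[OF tendsto_ident_at t0]
    by eventually_elim (intro second_moment_diff_le u_measurable integrable_sq t0)
  show "((\<lambda>t. \<bar>(\<integral>\<omega>. (u t x \<omega>)\<^sup>2 \<partial>M) - ?B\<bar>) \<longlongrightarrow> 0) (at t0)"
    by (rule tendsto_sandwich[OF _ le tendsto_const lim]) (auto intro: always_eventually)
qed

end

theorem theorem2p10:
  fixes P :: "'b measure" and X :: "real \<Rightarrow> 'b \<Rightarrow> real" and \<Psi> :: "real \<Rightarrow> complex"
    and p :: "real \<Rightarrow> real \<Rightarrow> real \<Rightarrow> real"
    and M :: "'a measure" and \<nu> :: "real measure" and N :: "'a \<Rightarrow> (real \<times> real \<times> real) measure"
    and u0 :: "real \<Rightarrow> real" and lam :: real and \<sigma> :: "real \<Rightarrow> real \<Rightarrow> real"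
    and J :: "real \<Rightarrow> real" and Lip K :: real
    and u :: "real \<Rightarrow> real \<Rightarrow> 'a \<Rightarrow> real"
  assumes "levy_process P X"
    and "characteristic_exponent P X \<Psi>"
    and "transition_density P X p"
    and "\<And>\<beta>. \<beta> > 0 \<Longrightarrow> Upsilon \<Psi> \<beta> < \<infinity>"
    and "u0 \<in> borel_measurable borel" and "\<And>x. 0 \<le> u0 x" and "bounded (range u0)"
    and "levy_measure \<nu>"
    and "poisson_random_measure M (noise_intensity \<nu>) N"
    and "(\<lambda>(x, h). \<sigma> x h) \<in> borel_measurable borel"
    and "J \<in> borel_measurable borel" and "\<And>h. 0 < J h" and "0 < Lip" and "0 < K"
    and "\<And>h. \<bar>\<sigma> 0 h\<bar> \<le> J h"
    and "\<And>x y h. \<bar>\<sigma> x h - \<sigma> y h\<bar> \<le> J h * Lip * \<bar>x - y\<bar>"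
    and "(\<integral>\<^sup>+h. ennreal ((J h)\<^sup>2) \<partial>\<nu>) \<le> ennreal K"
    and "random_field_solution M \<nu> N p u0 lam \<sigma> u"
  shows "\<forall>x. (\<forall>t2>0. ((\<lambda>t1. \<integral>\<omega>. \<bar>u t2 x \<omega> - u t1 x \<omega>\<bar>\<^sup>2 \<partial>M) \<longlongrightarrow> 0) (at_left t2)) \<and>
           continuous_on {0<..} (\<lambda>t. \<integral>\<omega>. \<bar>u t x \<omega>\<bar>\<^sup>2 \<partial>M)"
proof -
  obtain C where C: "\<And>x. \<bar>u0 x\<bar> \<le> C"
    using assms(7) by (auto simp: bounded_iff)
  have sets_nu: "sets \<nu> = sets borel"
    using assms(8) by (simp add: levy_measure_def)
  have mJ: "J \<in> borel_measurable \<nu>"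
    using assms(11) measurable_cong_sets[OF sets_nu refl] by blast
  have m\<sigma>: "(\<lambda>x. \<sigma> x h) \<in> borel_measurable borel" for h
    using measurable_compose[of "\<lambda>x. (x, h)" borel "borel \<Otimes>\<^sub>M borel", OF _ assms(10)[folded borel_prod]] by simp
  have "0 < (J h)\<^sup>2" for h
    using assms(12)[of h] by simp
  \<comment> \<open>The measure may be infinite near the origin; the strictly positive
    \<open>J\<close> with integrable square supplies the exhaustion by sets of finite
    measure.\<close>
  then have "sigma_finite_measure \<nu>"
    using mJ le_less_trans[OF assms(17) ennreal_less_top]
    by (intro sigma_finite_of_positive_integrable[of "\<lambda>h. (J h)\<^sup>2"]) auto
  moreover have "prob_space M"
    using assms(9) by (simp add: poisson_random_measure_def)
  ultimately interpret field_solution P X \<Psi> p M \<nu> N u0 lam \<sigma> J Lip K C u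
    using assms C m\<sigma> sets_nu
    by (intro field_solution.intro levy_kernel.intro poisson_noise.intro poisson_noise_axioms.intro
        field_solution_axioms.intro) (auto simp: less_imp_le)
  show ?thesis
  proof (intro allI conjI impI)
    fix x t2 :: real assume "0 < t2"
    from mean_square_continuous_real[OF this, of x]
    have "((\<lambda>t1. \<integral>\<omega>. (u t1 x \<omega> - u t2 x \<omega>)\<^sup>2 \<partial>M) \<longlongrightarrow> 0) (at_left t2)"
      by (rule tendsto_mono[rotated]) (simp add: at_le)
    then show "((\<lambda>t1. \<integral>\<omega>. \<bar>u t2 x \<omega> - u t1 x \<omega>\<bar>\<^sup>2 \<partial>M) \<longlongrightarrow> 0) (at_left t2)"
      by (simp add: power2_commute)
  next
    fix x :: real
    show "continuous_on {0<..} (\<lambda>t. \<integral>\<omega>. \<bar>u t x \<omega>\<bar>\<^sup>2 \<partial>M)"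
      using second_moment_continuous[of _ x]
      by (auto simp: continuous_on_eq_continuous_at isCont_def)
  qed
qed

end
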